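(* Let $N$ be the once-punctured hyperbolic torus bundle with $$\pi_1(N)=\left\langle\alpha,\beta,\tau\;\middle|\;\tau\alpha\tau^{-1}=(\beta\alpha\beta)^{-1},\ \tau\beta\tau^{-1}=\beta\alpha(\beta\alpha\beta)^{-3}\right\rangle,$$ let $\lambda=[\alpha,\beta]$ (so that $\tau,\lambda$ form a basis of a peripheral subgroup), and let $\mathsf{X}_0,\mathsf{X}_1$ be the two hyperbolic curves in $\mathsf{X}(N)$. Let $\epsilon\in\{0,1\}$ and $l=I_\lambda$. Then: (1) $\mathrm{Rk}_{\mathsf{X}_\epsilon}^{\mathbb{C}}(\lambda)=8$; (2) $\mathrm{Rk}_{\mathsf{X}_\epsilon}^{\mathbb{Q}}(\lambda)=16$; (3) $\mathrm{Rk}_{\mathsf{X}_\epsilon}^{\mathbb{Z}}(\lambda)=17$; (4) as a $\mathbb{Z}[l]$-module, $T(\mathsf{X}_\epsilon)$ is torsion free but not free.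
   Context: $\mathsf{X}(N)$ is the affine algebraic set of characters $\chi_\rho=\mathrm{Tr}\circ\rho$ of representations $\rho\colon\pi_1(N)\to\mathrm{SL}_2(\mathbb{C})$. A hyperbolic curve is an irreducible algebraic component of $\mathsf{X}(N)$ containing the character of a discrete faithful representation; for this $N$ there are exactly two, labelled $\mathsf{X}_0$ and $\mathsf{X}_1$. For $\mathsf{X}\subseteq\mathsf{X}(N)$ algebraic and $\gamma\in\pi_1(N)$, $I_\gamma\in\mathbb{C}[\mathsf{X}]$ is $I_\gamma(\chi)=\chi(\gamma)$. The trace ring $T(\mathsf{X})$ is the subring (with 1) of $\mathbb{C}[\mathsf{X}]$ generated by all $I_\gamma$, and $T_{\mathbb{Q}}(\mathsf{X})$ is the smallest $\mathbb{Q}$-subalgebra of $\mathbb{C}[\mathsf{X}]$ containing $T(\mathsf{X})$. $\mathrm{Rk}_{\mathsf{X}}^{\mathbb{C}}(\lambda)$, $\mathrm{Rk}_{\mathsf{X}}^{\mathbb{Q}}(\lambda)$, $\mathrm{Rk}_{\mathsf{X}}^{\mathbb{Z}}(\lambda)$ are the ranks of $\mathbb{C}[\mathsf{X}]$ as a $\mathbb{C}[I_\lambda]$-module, of $T_{\mathbb{Q}}(\mathsf{X})$ as a $\mathbb{Q}[I_\lambda]$-module, and of $T(\mathsf{X})$ as a $\mathbb{Z}[I_\lambda]$-module, where rank means the minimal number of elements in a generating set ($\infty$ if not finitely generated). *)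

theory Defs
  imports
    "HOL-Analysis.Analysis"
    "HOL-Algebra.Generated_Rings"
    "HOL-Library.Extended_Nat"
    "Jordan_Normal_Form.Missing_VectorSpace"
begin

section \<open>The group\<close>

datatype gen = Alpha | Beta | Tau

text \<open>The letter \<open>(g, True)\<close> stands for \<open>g\<close> and \<open>(g, False)\<close> for its inverse.\<close>

type_synonym word = "(gen \<times> bool) list"

definition word_inv :: "word \<Rightarrow> word" where
  "word_inv w = map (\<lambda>(g, e). (g, \<not> e)) (rev w)"

abbreviation "wa \<equiv> [(Alpha, True)]"
abbreviation "wb \<equiv> [(Beta, True)]"
abbreviation "wt \<equiv> [(Tau, True)]"
abbreviation "wbab \<equiv> wb @ wa @ wb"

text \<open>The smallest congruence on words that allows free cancellation and identifies the two sides
  of the relations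
  \<open>\<tau>\<alpha>\<tau>\<inverse> = (\<beta>\<alpha>\<beta>)\<inverse>\<close> and \<open>\<tau>\<beta>\<tau>\<inverse> = \<beta>\<alpha>(\<beta>\<alpha>\<beta>)\<^sup>-\<^sup>3\<close>.\<close>

inductive word_eq :: "word \<Rightarrow> word \<Rightarrow> bool" where
  refl: "word_eq u u"
| sym: "word_eq u v \<Longrightarrow> word_eq v u"
| trans: "word_eq u v \<Longrightarrow> word_eq v w \<Longrightarrow> word_eq u w"
| append: "word_eq u u' \<Longrightarrow> word_eq v v' \<Longrightarrow> word_eq (u @ v) (u' @ v')"
| cancel: "word_eq [(g, e), (g, \<not> e)] []"
| rel_alpha: "word_eq (wt @ wa @ word_inv wt) (word_inv wbab)"
| rel_beta: "word_eq (wt @ wb @ word_inv wt)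
    (wb @ wa @ word_inv wbab @ word_inv wbab @ word_inv wbab)"

quotient_type pi1 = word / word_eq
  by (rule equivpI) (auto simp: reflp_def symp_def transp_def
    intro: word_eq.refl word_eq.sym word_eq.trans)

lift_definition pi1_mult :: "pi1 \<Rightarrow> pi1 \<Rightarrow> pi1" is "\<lambda>u v. u @ v"
  by (rule word_eq.append)

lift_definition pi1_one :: pi1 is "[]" .

definition pi1_N :: "pi1 monoid" where
  "pi1_N = \<lparr>carrier = UNIV, mult = pi1_mult, one = pi1_one\<rparr>"

lift_definition pi1_gen :: "gen \<Rightarrow> pi1" is "\<lambda>g. [(g, True)]" .

lemma pi1_N_simps [simp]:
  "carrier pi1_N = UNIV" "x \<otimes>\<^bsub>pi1_N\<^esub> y = pi1_mult x y" "\<one>\<^bsub>pi1_N\<^esub> = pi1_one"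
  by (simp_all add: pi1_N_def)

lemma word_inv_left: "word_eq (word_inv w @ w) []"
proof (induction w)
  case Nil
  show ?case by (simp add: word_inv_def word_eq.refl)
next
  case (Cons x w)
  obtain g e where x: "x = (g, e)" by (cases x)
  have "word_eq ([(g, \<not> e), (g, e)]) []"
    using word_eq.cancel[of g "\<not> e"] by simp
  then have "word_eq (word_inv w @ ([(g, \<not> e), (g, e)] @ w)) (word_inv w @ ([] @ w))"
    by (intro word_eq.append word_eq.refl)
  then have "word_eq (word_inv (x # w) @ x # w) (word_inv w @ w)"
    by (simp add: word_inv_def x)
  then show ?case using Cons word_eq.trans by blast
qed

lemma group_pi1_N: "group pi1_N"
proof (rule groupI)
  show "\<exists>y\<in>carrier pi1_N. y \<otimes>\<^bsub>pi1_N\<^esub> x = \<one>\<^bsub>pi1_N\<^esub>" for x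
    unfolding pi1_N_simps by (transfer) (auto intro: word_inv_left)
qed (simp_all, (transfer, simp add: word_eq.refl)+)

definition lam :: pi1 where
  "lam = pi1_gen Alpha \<otimes>\<^bsub>pi1_N\<^esub> pi1_gen Beta
    \<otimes>\<^bsub>pi1_N\<^esub> inv\<^bsub>pi1_N\<^esub> pi1_gen Alpha \<otimes>\<^bsub>pi1_N\<^esub> inv\<^bsub>pi1_N\<^esub> pi1_gen Beta"


section \<open>Characters and the character variety\<close>

definition SL2C :: "(complex^2^2) monoid" where
  "SL2C = \<lparr>carrier = {A. det A = 1}, mult = (**), one = mat 1\<rparr>"

lemma group_SL2C: "group SL2C"
proof (rule groupI)
  fix A assume A: "A \<in> carrier SL2C"
  then have "invertible A" by (simp add: SL2C_def invertible_det_nz)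
  then obtain B where B: "B ** A = mat 1" by (auto simp: invertible_def)
  then have "det B = 1" using A det_mul[of B A] by (simp add: SL2C_def)
  then show "\<exists>B\<in>carrier SL2C. B \<otimes>\<^bsub>SL2C\<^esub> A = \<one>\<^bsub>SL2C\<^esub>"
    using B by (auto simp: SL2C_def)
qed (auto simp: SL2C_def det_mul matrix_mul_assoc)

definition character :: "(pi1 \<Rightarrow> complex^2^2) \<Rightarrow> pi1 \<Rightarrow> complex" where
  "character \<rho> = (\<lambda>\<gamma>. trace (\<rho> \<gamma>))"

definition char_variety :: "(pi1 \<Rightarrow> complex) set" where
  "char_variety = character ` hom pi1_N SL2C"

definition discrete_faithful :: "(pi1 \<Rightarrow> complex^2^2) \<Rightarrow> bool" where
  "discrete_faithful \<rho> \<longleftrightarrow> \<rho> \<in> hom pi1_N SL2C \<and> inj \<rho> \<and> discrete (range \<rho>)"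


section \<open>Rings of functions\<close>

text \<open>Functions on a set \<open>X\<close> are represented by their extensional extension, so that two of them are
  equal iff they agree on \<open>X\<close>.\<close>

definition fun_ring :: "'x set \<Rightarrow> ('x \<Rightarrow> complex) ring" where
  "fun_ring X = \<lparr>carrier = extensional X,
     mult = (\<lambda>f g. \<lambda>x\<in>X. f x * g x), one = (\<lambda>x\<in>X. 1),
     zero = (\<lambda>x\<in>X. 0), add = (\<lambda>f g. \<lambda>x\<in>X. f x + g x)\<rparr>"

lemma cring_fun_ring: "cring (fun_ring X)"
proof (rule cringI)
  show "abelian_group (fun_ring X)"
  proof (rule abelian_groupI)
    fix f assume "f \<in> carrier (fun_ring X)"
    then show "\<exists>g\<in>carrier (fun_ring X). g \<oplus>\<^bsub>fun_ring X\<^esub> f = \<zero>\<^bsub>fun_ring X\<^esub>"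
      by (intro bexI[of _ "\<lambda>x\<in>X. - f x"]) (auto simp: fun_ring_def)
  qed (auto simp: fun_ring_def extensional_def restrict_def fun_eq_iff)
next
  show "Group.comm_monoid (fun_ring X)"
    by (rule comm_monoidI) (auto simp: fun_ring_def extensional_def restrict_def fun_eq_iff)
qed (simp add: fun_ring_def restrict_def fun_eq_iff algebra_simps)

definition consts_on :: "'x set \<Rightarrow> complex set \<Rightarrow> ('x \<Rightarrow> complex) set" where
  "consts_on X k = (\<lambda>c. \<lambda>x\<in>X. c) ` k"

text \<open>The smallest \<open>k\<close>-subalgebra of the ring of functions on \<open>X\<close> that contains \<open>S\<close>, for a
  subring \<open>k\<close> of the complex numbers: a (unital) \<open>k\<close>-subalgebra is a subring that contains the
  constants from \<open>k\<close>. (The library's locale \<open>subalgebra\<close> only asks for a submodule.)\<close>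

definition subalg_gen :: "complex set \<Rightarrow> 'x set \<Rightarrow> ('x \<Rightarrow> complex) set \<Rightarrow> ('x \<Rightarrow> complex) set" where
  "subalg_gen k X S = \<Inter> {A. subring A (fun_ring X) \<and> consts_on X k \<subseteq> A \<and> S \<subseteq> A}"

definition I_fun :: "(pi1 \<Rightarrow> complex) set \<Rightarrow> pi1 \<Rightarrow> (pi1 \<Rightarrow> complex) \<Rightarrow> complex" where
  "I_fun X \<gamma> = (\<lambda>x\<in>X. x \<gamma>)"

text \<open>By Culler and Shalen, finitely many of the functions \<open>I\<^sub>\<gamma>\<close> generate all of them as a ring,
  and these finitely many are the coordinates that make the set of characters an affine algebraic
  set. Its regular functions are therefore the polynomials in the \<open>I\<^sub>\<gamma>\<close>; using all of them as
  coordinates avoids choosing a finite subset.\<close>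

definition coord_ring :: "(pi1 \<Rightarrow> complex) set \<Rightarrow> ((pi1 \<Rightarrow> complex) \<Rightarrow> complex) set" where
  "coord_ring X = subalg_gen UNIV X (range (I_fun X))"

definition trace_ring :: "(pi1 \<Rightarrow> complex) set \<Rightarrow> ((pi1 \<Rightarrow> complex) \<Rightarrow> complex) set" where
  "trace_ring X = generate_ring (fun_ring X) (range (I_fun X))"

definition trace_ring_Q :: "(pi1 \<Rightarrow> complex) set \<Rightarrow> ((pi1 \<Rightarrow> complex) \<Rightarrow> complex) set" where
  "trace_ring_Q X = subalg_gen \<rat> X (trace_ring X)"


section \<open>Hyperbolic curves\<close>

definition zariski_closed :: "(pi1 \<Rightarrow> complex) set \<Rightarrow> bool" where
  "zariski_closed Z \<longleftrightarrow>
     (\<exists>F \<subseteq> coord_ring char_variety. Z = {x \<in> char_variety. \<forall>f\<in>F. f x = 0})"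

definition irreducible_closed :: "(pi1 \<Rightarrow> complex) set \<Rightarrow> bool" where
  "irreducible_closed Z \<longleftrightarrow> zariski_closed Z \<and> Z \<noteq> {} \<and>
     (\<forall>A B. zariski_closed A \<longrightarrow> zariski_closed B \<longrightarrow> Z = A \<union> B \<longrightarrow> Z = A \<or> Z = B)"

definition irreducible_component :: "(pi1 \<Rightarrow> complex) set \<Rightarrow> bool" where
  "irreducible_component Z \<longleftrightarrow> irreducible_closed Z \<and>
     (\<forall>Y. irreducible_closed Y \<longrightarrow> Z \<subseteq> Y \<longrightarrow> Y = Z)"

definition hyperbolic_curve :: "(pi1 \<Rightarrow> complex) set \<Rightarrow> bool" where
  "hyperbolic_curve X \<longleftrightarrow> irreducible_component X \<and>
     (\<exists>\<rho>. discrete_faithful \<rho> \<and> character \<rho> \<in> X)"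


section \<open>Modules and ranks\<close>

definition gen_rank :: "('a, 'm) ring_scheme \<Rightarrow> ('a, 'b, 'n) module_scheme \<Rightarrow> enat" where
  "gen_rank R M =
     (INF A \<in> {A. finite A \<and> A \<subseteq> carrier M \<and> module.span R M A = carrier M}. enat (card A))"

definition torsion_free_module :: "('a, 'm) ring_scheme \<Rightarrow> ('a, 'b, 'n) module_scheme \<Rightarrow> bool" where
  "torsion_free_module R M \<longleftrightarrow>
     (\<forall>r\<in>carrier R. \<forall>m\<in>carrier M. r \<odot>\<^bsub>M\<^esub> m = \<zero>\<^bsub>M\<^esub> \<longrightarrow> r = \<zero>\<^bsub>R\<^esub> \<or> m = \<zero>\<^bsub>M\<^esub>)"

definition free_module :: "('a, 'm) ring_scheme \<Rightarrow> ('a, 'b, 'n) module_scheme \<Rightarrow> bool" where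
  "free_module R M \<longleftrightarrow>
     (\<exists>B \<subseteq> carrier M. module.span R M B = carrier M \<and> module.lin_indpt R M B)"

definition scalars :: "complex set \<Rightarrow> (pi1 \<Rightarrow> complex) set \<Rightarrow> pi1 \<Rightarrow>
    ((pi1 \<Rightarrow> complex) \<Rightarrow> complex) ring" where
  "scalars k X \<gamma> = fun_ring X \<lparr>carrier := subalg_gen k X {I_fun X \<gamma>}\<rparr>"

definition as_module :: "'x set \<Rightarrow> ('x \<Rightarrow> complex) set \<Rightarrow>
    ('x \<Rightarrow> complex, 'x \<Rightarrow> complex) module" where
  "as_module X M = \<lparr>carrier = M,
     mult = mult (fun_ring X), one = one (fun_ring X),
     zero = zero (fun_ring X), add = add (fun_ring X), smult = mult (fun_ring X)\<rparr>"

lemma module_as_module: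
  assumes K: "subring K (fun_ring X)" and M: "subring M (fun_ring X)" and KM: "K \<subseteq> M"
  shows "module (fun_ring X \<lparr>carrier := K\<rparr>) (as_module X M)"
proof -
  interpret F: cring "fun_ring X" by (rule cring_fun_ring)
  have sub: "M \<subseteq> carrier (fun_ring X)" using M by (rule subringE(1))
  have cr: "cring (fun_ring X \<lparr>carrier := A\<rparr>)" if "subring A (fun_ring X)" for A
    using F.subcring_iff[OF subringE(1)[OF that]] F.subcringI' that by blast
  have ab: "abelian_group (as_module X M)"
  proof (rule abelian_groupI)
    fix f assume "f \<in> carrier (as_module X M)"
    then show "\<exists>g\<in>carrier (as_module X M). g \<oplus>\<^bsub>as_module X M\<^esub> f = \<zero>\<^bsub>as_module X M\<^esub>"
      using sub subringE(5)[OF M]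
      by (intro bexI[of _ "\<ominus>\<^bsub>fun_ring X\<^esub> f"]) (auto simp: as_module_def F.l_neg)
  qed (use sub subringE(2)[OF M] subringE(7)[OF M] in
    \<open>auto simp: as_module_def subset_iff F.a_ac\<close>)
  show ?thesis
    by (rule moduleI[OF cr[OF K] ab])
      (use sub KM subringE(6)[OF M] in
        \<open>auto simp: as_module_def subset_iff F.l_distr F.r_distr F.m_assoc\<close>)
qed

definition Rk_C :: "(pi1 \<Rightarrow> complex) set \<Rightarrow> pi1 \<Rightarrow> enat" where
  "Rk_C X \<gamma> = gen_rank (scalars UNIV X \<gamma>) (as_module X (coord_ring X))"

definition Rk_Q :: "(pi1 \<Rightarrow> complex) set \<Rightarrow> pi1 \<Rightarrow> enat" where
  "Rk_Q X \<gamma> = gen_rank (scalars \<rat> X \<gamma>) (as_module X (trace_ring_Q X))"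

definition Rk_Z :: "(pi1 \<Rightarrow> complex) set \<Rightarrow> pi1 \<Rightarrow> enat" where
  "Rk_Z X \<gamma> = gen_rank (scalars \<int> X \<gamma>) (as_module X (trace_ring X))"

end

(*
A representation of the fundamental group is given by matrices A, B, T. Writing x, y, z for the
traces of A, B, AB, the relations give 2x = yz and 2y = x(xy - z), and then
(tr T, tr TA, tr TB, tr TAB) = j (x^2 - 2, x, xz - y, z). If x is nonzero and tr [A,B] is not 2, then
j^2 = -1. If x = 0, then A^4 = 1; if tr [A,B] = 2, then the commutators [A,B] and (BA)^-1 AB commute.
Neither happens for a faithful representation, so the hyperbolic curves are the curves
z^2 = 2x^2 - 4, yz = 2x with the above values on T, for j = i and j = -i; they are rational, hence
irreducible.

On such a curve put p = x^2 and u = x^2 + y^2, so that the trace l of [A,B] is u - 6. The polynomials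
in x, y, z form a free module over the polynomials in l with basis 1, p, x, px, y, py, z, xy. The trace
ring does not contain j, but it contains 2j, jx, jy, jz. Hence it consists of the combinations of this
basis with coefficients in Z[j][l] for which the imaginary part of the coefficient of 1 lies in the
ideal (2, l): as a Z[l]-module it is the sum of a free module of rank 15 and the ideal (2, l), which
needs two generators. With rational coefficients the ideal becomes free, and with complex
coefficients j is a constant.
*)

theory Submission
  imports Defs "HOL-Library.Function_Algebras" "HOL-Library.Z2"
begin

section \<open>Two by two matrices\<close>

text \<open>The argument is run once over a subring k of the complex numbers and used for k = Z, Q,
  C. Two facts carry it. First, multiplication by x, y or z maps the whole k[j][l]-span of the basis
  into the submodule with the restricted constant term, since the coefficients of 1 that arise are
  twice an element of k[j] at l = 0 (there u = 6). This makes the submodule a ring and keeps j out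
  of it. Second, every solution of the two curve equations comes from a representation, so the
  generic fibre of l has eight points and the coefficients are unique. Lower bounds for the ranks
  come from semilinear maps onto vector spaces of the right dimension: values at l = 0 for C, their
  real and imaginary coordinates for Q, and a reduction modulo 2 for Z that separates the two
  generators of (2, l). Freeness fails by counting: twice the trace ring lies in the span of sixteen
  elements, so a basis has at most sixteen elements, against the rank 17. A faithful representation
  avoids each exceptional locus because a word identity valid on the locus is refuted by one
  explicit representation.\<close>

definition mat2 :: "'a::zero \<Rightarrow> 'a \<Rightarrow> 'a \<Rightarrow> 'a \<Rightarrow> 'a^2^2" where
  "mat2 a b c d = vector [vector [a, b], vector [c, d]]"

lemma mat2_nth [simp]:
  "mat2 a b c d $ 1 $ 1 = a" "mat2 a b c d $ 1 $ 2 = b"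
  "mat2 a b c d $ 2 $ 1 = c" "mat2 a b c d $ 2 $ 2 = d"
  for a :: "'a::zero"
  by (simp_all add: mat2_def)

lemma mat2_collapse: "mat2 (M$1$1) (M$1$2) (M$2$1) (M$2$2) = M" for M :: "'a::zero^2^2"
  by (simp add: vec_eq_iff forall_2)

lemma mat2_cases:
  fixes M :: "'a::zero^2^2"
  obtains a b c d where "M = mat2 a b c d"
  using mat2_collapse[of M] by metis

lemma mat2_eq_iff [simp]:
  "mat2 a b c d = mat2 a' b' c' d' \<longleftrightarrow> a = a' \<and> b = b' \<and> c = c' \<and> d = d'" for a :: "'a::zero"
  by (auto simp: vec_eq_iff forall_2)

lemma mat2_mult [simp]:
  "mat2 a b c d ** mat2 a' b' c' d' =
    mat2 (a*a' + b*c') (a*b' + b*d') (c*a' + d*c') (c*b' + d*d')" for a :: "'a::semiring_1"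
  by (simp add: vec_eq_iff forall_2 matrix_matrix_mult_def sum_2)

lemma mat2_add [simp]:
  "mat2 a b c d + mat2 a' b' c' d' = mat2 (a+a') (b+b') (c+c') (d+d')" for a :: "'a::semiring_1"
  by (simp add: vec_eq_iff forall_2)

lemma mat2_diff [simp]:
  "mat2 a b c d - mat2 a' b' c' d' = mat2 (a-a') (b-b') (c-c') (d-d')" for a :: "'a::ring_1"
  by (simp add: vec_eq_iff forall_2)

lemma mat_eq_mat2: "mat c = mat2 c 0 0 c" for c :: "'a::semiring_1"
  by (simp add: vec_eq_iff forall_2 mat_def)

lemma det_mat2 [simp]: "det (mat2 a b c d) = a*d - b*c" for a :: "'a::comm_ring_1"
  by (simp add: det_2)

lemma trace_mat2 [simp]: "trace (mat2 a b c d) = a + d" for a :: "'a::comm_ring_1"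
  by (simp add: trace_def sum_2)

lemma SL2C_simps [simp]:
  "carrier SL2C = {A. det A = 1}" "A \<otimes>\<^bsub>SL2C\<^esub> B = A ** B" "\<one>\<^bsub>SL2C\<^esub> = mat 1"
  by (simp_all add: SL2C_def)

lemma inv_SL2C_mat2:
  assumes "a*d - b*c = 1"
  shows "inv\<^bsub>SL2C\<^esub> (mat2 a b c d) = mat2 d (-b) (-c) a"
proof -
  interpret group SL2C by (rule group_SL2C)
  show ?thesis
    by (rule inv_equality) (use assms in \<open>auto simp: mat_eq_mat2 algebra_simps\<close>)
qed

text \<open>Cayley-Hamilton makes the inverse linear in the matrix; inverses are eliminated in this
  form throughout.\<close>

lemma inv_SL2C:
  assumes "det A = 1"
  shows "inv\<^bsub>SL2C\<^esub> A = mat (trace A) - A"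
proof -
  obtain a b c d where A: "A = mat2 a b c d" by (rule mat2_cases)
  show ?thesis using assms by (simp add: A inv_SL2C_mat2 mat_eq_mat2)
qed


section \<open>Representations of the group\<close>

context group
begin

text \<open>Without inverses the relations become polynomial equations between matrices, linear in
  t. The second rewriting needs the first relation, which turns the cube of inv (bab) into t a^3 inv
  t; hence the equivalence of conjunctions.\<close>

lemma bundle_relations_iff:
  assumes [simp]: "a \<in> carrier G" "b \<in> carrier G" "t \<in> carrier G"
  shows "(t \<otimes> a \<otimes> inv t = inv (b \<otimes> a \<otimes> b) \<and>
      t \<otimes> b \<otimes> inv t = b \<otimes> a \<otimes> inv (b \<otimes> a \<otimes> b) \<otimes> inv (b \<otimes> a \<otimes> b) \<otimes> inv (b \<otimes> a \<otimes> b)) \<longleftrightarrow>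
    (b \<otimes> a \<otimes> b \<otimes> t \<otimes> a = t \<and> b \<otimes> a \<otimes> t \<otimes> a \<otimes> a \<otimes> a = t \<otimes> b)"
    (is "?R1 \<and> ?R2 \<longleftrightarrow> ?S1 \<and> ?S2")
proof -
  let ?u = "b \<otimes> a \<otimes> b"
  have cu [simp]: "?u \<in> carrier G" by simp
  have 1: "?R1 \<longleftrightarrow> ?S1"
  proof -
    have "?R1 \<longleftrightarrow> ?u \<otimes> (t \<otimes> a \<otimes> inv t) = ?u \<otimes> inv ?u"
      by (subst Units_l_cancel) simp_all
    also have "\<dots> \<longleftrightarrow> ?u \<otimes> (t \<otimes> a \<otimes> inv t) \<otimes> t = \<one> \<otimes> t"
      by (subst right_cancel) simp_all
    also have "?u \<otimes> (t \<otimes> a \<otimes> inv t) \<otimes> t = ?u \<otimes> t \<otimes> a" by (simp add: m_assoc)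
    finally show ?thesis by simp
  qed
  have 2: "?R2 \<longleftrightarrow> ?S2" if R1: ?R1
  proof -
    have "b \<otimes> a \<otimes> inv ?u \<otimes> inv ?u \<otimes> inv ?u
      = b \<otimes> a \<otimes> (t \<otimes> a \<otimes> inv t) \<otimes> (t \<otimes> a \<otimes> inv t) \<otimes> (t \<otimes> a \<otimes> inv t)"
      by (simp only: R1)
    also have "\<dots> = b \<otimes> a \<otimes> t \<otimes> a \<otimes> a \<otimes> a \<otimes> inv t"
    proof -
      have c: "inv t \<otimes> (t \<otimes> w) = w" if "w \<in> carrier G" for w
        using that by (simp flip: m_assoc)
      show ?thesis by (simp add: m_assoc c)
    qed
    finally have "?R2 \<longleftrightarrow> t \<otimes> b \<otimes> inv t = b \<otimes> a \<otimes> t \<otimes> a \<otimes> a \<otimes> a \<otimes> inv t" by simp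
    also have "\<dots> \<longleftrightarrow> t \<otimes> b = b \<otimes> a \<otimes> t \<otimes> a \<otimes> a \<otimes> a"
      by (subst right_cancel) simp_all
    finally show ?thesis by auto
  qed
  show ?thesis using 1 2 by blast
qed

fun letter_val :: "(gen \<Rightarrow> 'a) \<Rightarrow> gen \<times> bool \<Rightarrow> 'a" where
  "letter_val f (g, e) = (if e then f g else inv (f g))"

definition word_val :: "(gen \<Rightarrow> 'a) \<Rightarrow> word \<Rightarrow> 'a" where
  "word_val f w = foldr (\<lambda>l v. letter_val f l \<otimes> v) w \<one>"

lemma word_val_simps [simp]:
  "word_val f [] = \<one>" "word_val f (l # w) = letter_val f l \<otimes> word_val f w"
  by (simp_all add: word_val_def)

lemma letter_val_closed [simp]: "range f \<subseteq> carrier G \<Longrightarrow> letter_val f l \<in> carrier G"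
  by (cases l) auto

lemma word_val_closed [simp]: "range f \<subseteq> carrier G \<Longrightarrow> word_val f w \<in> carrier G"
  by (induction w) auto

lemma word_val_append:
  "range f \<subseteq> carrier G \<Longrightarrow> word_val f (v @ w) = word_val f v \<otimes> word_val f w"
  by (induction v) (auto simp: m_assoc)

lemma word_val_inv:
  assumes f: "range f \<subseteq> carrier G"
  shows "word_val f (word_inv w) = inv (word_val f w)"
proof (induction w)
  case Nil
  show ?case by (simp add: word_inv_def)
next
  case (Cons l w)
  obtain g e where l: "l = (g, e)" by (cases l)
  have fg: "f g \<in> carrier G" using f by auto
  have "word_inv (l # w) = word_inv w @ [(g, \<not> e)]" by (simp add: word_inv_def l)
  then show ?case
    using Cons f fg by (simp add: word_val_append l inv_mult_group)
qed

lemma word_val_cong: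
  assumes f: "range f \<subseteq> carrier G"
    and 1: "word_val f (wt @ wa @ word_inv wt) = word_val f (word_inv wbab)"
    and 2: "word_val f (wt @ wb @ word_inv wt)
      = word_val f (wb @ wa @ word_inv wbab @ word_inv wbab @ word_inv wbab)"
  shows "word_eq u v \<Longrightarrow> word_val f u = word_val f v"
proof (induction rule: word_eq.induct)
  case (cancel g e)
  have "f g \<in> carrier G" using f by auto
  then show ?case by (cases e) simp_all
qed (use assms word_val_append[OF f] in auto)

text \<open>Von Dyck's theorem for this presentation.\<close>

lemma pi1_hom_exists:
  assumes [simp]: "a \<in> carrier G" "b \<in> carrier G" "t \<in> carrier G"
    and "b \<otimes> a \<otimes> b \<otimes> t \<otimes> a = t" "b \<otimes> a \<otimes> t \<otimes> a \<otimes> a \<otimes> a = t \<otimes> b"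
  obtains \<rho> where "\<rho> \<in> hom pi1_N G" "\<rho> (pi1_gen Alpha) = a" "\<rho> (pi1_gen Beta) = b"
    "\<rho> (pi1_gen Tau) = t"
proof -
  define f where "f = case_gen a b t"
  have f: "range f \<subseteq> carrier G" by (auto simp: f_def split: gen.splits)
  have rel: "t \<otimes> a \<otimes> inv t = inv (b \<otimes> a \<otimes> b)"
    "t \<otimes> b \<otimes> inv t = b \<otimes> a \<otimes> inv (b \<otimes> a \<otimes> b) \<otimes> inv (b \<otimes> a \<otimes> b) \<otimes> inv (b \<otimes> a \<otimes> b)"
    using bundle_relations_iff[of a b t] assms by auto
  have cong: "word_eq u v \<Longrightarrow> word_val f u = word_val f v" for u v
  proof (rule word_val_cong[OF f])
    show "word_val f (wt @ wa @ word_inv wt) = word_val f (word_inv wbab)"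
      unfolding word_val_append[OF f] word_val_inv[OF f] using rel(1)
      by (simp add: f_def m_assoc)
    show "word_val f (wt @ wb @ word_inv wt)
        = word_val f (wb @ wa @ word_inv wbab @ word_inv wbab @ word_inv wbab)"
      unfolding word_val_append[OF f] word_val_inv[OF f] using rel(2)
      by (simp add: f_def m_assoc)
  qed
  define \<rho> where "\<rho> = (\<lambda>\<gamma>. word_val f (rep_pi1 \<gamma>))"
  have \<rho>: "\<rho> (abs_pi1 w) = word_val f w" for w
    unfolding \<rho>_def by (intro cong) (meson Quotient3_pi1 word_eq.refl rep_abs_rsp_left)
  have "\<rho> (pi1_mult u v) = \<rho> u \<otimes> \<rho> v" for u v
  proof (induction u, induction v)
    fix u v
    show "\<rho> (pi1_mult (abs_pi1 u) (abs_pi1 v)) = \<rho> (abs_pi1 u) \<otimes> \<rho> (abs_pi1 v)"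
      by (simp add: pi1_mult.abs_eq \<rho> word_val_append[OF f])
  qed
  then have "\<rho> \<in> hom pi1_N G" using f by (auto simp: hom_def \<rho>_def)
  moreover have "\<rho> (pi1_gen Alpha) = a" "\<rho> (pi1_gen Beta) = b" "\<rho> (pi1_gen Tau) = t"
    by (simp_all add: pi1_gen.abs_eq \<rho> f_def)
  ultimately show ?thesis using that by blast
qed

lemma pi1_hom_abs:
  assumes \<rho>: "\<rho> \<in> hom pi1_N G"
  shows "\<rho> (abs_pi1 w) = word_val (\<lambda>g. \<rho> (pi1_gen g)) w"
proof -
  interpret h: group_hom pi1_N G \<rho>
    by (intro group_hom.intro group_hom_axioms.intro group_pi1_N \<rho>) unfold_locales
  have mult: "\<rho> (pi1_mult u v) = \<rho> u \<otimes> \<rho> v" for u v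
    using h.hom_mult[of u v] by simp
  have one: "\<rho> pi1_one = \<one>" using h.hom_one by simp
  have cl: "\<rho> u \<in> carrier G" for u using h.hom_closed[of u] by simp
  have letter: "\<rho> (abs_pi1 [(g, e)]) = letter_val (\<lambda>g. \<rho> (pi1_gen g)) (g, e)" for g e
  proof (cases e)
    case False
    have "pi1_mult (abs_pi1 [(g, False)]) (pi1_gen g) = pi1_one"
      using word_eq.cancel[of g False]
      by (simp add: pi1_gen.abs_eq pi1_mult.abs_eq pi1_one_def pi1.abs_eq_iff)
    then have "\<rho> (abs_pi1 [(g, False)]) \<otimes> \<rho> (pi1_gen g) = \<one>"
      by (metis mult one)
    then show ?thesis using False cl by (simp add: inv_equality)
  qed (simp add: pi1_gen.abs_eq)
  show ?thesis
  proof (induction w)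
    case Nil
    show ?case using one by (simp add: pi1_one_def)
  next
    case (Cons l w)
    have "abs_pi1 (l # w) = pi1_mult (abs_pi1 [l]) (abs_pi1 w)" by (simp add: pi1_mult.abs_eq)
    then show ?case using Cons mult letter[of "fst l" "snd l"] by simp
  qed
qed

lemma pi1_hom_relations:
  assumes \<rho>: "\<rho> \<in> hom pi1_N G"
    and a: "a = \<rho> (pi1_gen Alpha)" and b: "b = \<rho> (pi1_gen Beta)" and t: "t = \<rho> (pi1_gen Tau)"
  shows "b \<otimes> a \<otimes> b \<otimes> t \<otimes> a = t" "b \<otimes> a \<otimes> t \<otimes> a \<otimes> a \<otimes> a = t \<otimes> b"
proof -
  define f where "f = (\<lambda>g. \<rho> (pi1_gen g))"
  have f: "range f \<subseteq> carrier G" using \<rho> by (auto simp: f_def hom_def)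
  have [simp]: "a \<in> carrier G" "b \<in> carrier G" "t \<in> carrier G"
    using f by (auto simp: a b t f_def)
  have eq: "word_eq u v \<Longrightarrow> word_val f u = word_val f v" for u v
    unfolding f_def pi1_hom_abs[OF \<rho>, symmetric] by (metis pi1.abs_eq_iff)
  note e = eq[OF word_eq.rel_alpha] eq[OF word_eq.rel_beta]
  have "t \<otimes> a \<otimes> inv t = inv (b \<otimes> a \<otimes> b)"
    "t \<otimes> b \<otimes> inv t = b \<otimes> a \<otimes> inv (b \<otimes> a \<otimes> b) \<otimes> inv (b \<otimes> a \<otimes> b) \<otimes> inv (b \<otimes> a \<otimes> b)"
    using e unfolding word_val_append[OF f] word_val_inv[OF f]
    by (simp_all add: f_def a [symmetric] b [symmetric] t [symmetric] m_assoc)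
  then show "b \<otimes> a \<otimes> b \<otimes> t \<otimes> a = t" "b \<otimes> a \<otimes> t \<otimes> a \<otimes> a \<otimes> a = t \<otimes> b"
    using bundle_relations_iff[of a b t] by auto
qed

lemma pi1_hom_eq:
  assumes \<rho>: "\<rho> \<in> hom pi1_N G"
  shows "\<rho> (pi1_mult u v) = \<rho> u \<otimes> \<rho> v" "\<rho> pi1_one = \<one>" "\<rho> (inv\<^bsub>pi1_N\<^esub> u) = inv (\<rho> u)"
    "\<rho> u \<in> carrier G"
proof -
  interpret h: group_hom pi1_N G \<rho>
    by (intro group_hom.intro group_hom_axioms.intro group_pi1_N \<rho>) unfold_locales
  show "\<rho> (pi1_mult u v) = \<rho> u \<otimes> \<rho> v" "\<rho> pi1_one = \<one>" "\<rho> (inv\<^bsub>pi1_N\<^esub> u) = inv (\<rho> u)"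
    "\<rho> u \<in> carrier G"
    using h.hom_mult[of u v] h.hom_one h.hom_inv[of u] h.hom_closed[of u] by simp_all
qed

end

section \<open>Trace identities\<close>

lemma trace_cyclic: "trace (M ** N ** P) = trace (N ** P ** M)" for M :: "'a::comm_ring_1^'n^'n"
  using trace_mul_sym[of M "N ** P"] by (simp add: matrix_mul_assoc)

lemma trace_mat_1 [simp]: "trace (mat 1 :: 'a::comm_ring_1^2^2) = 2"
  by (simp add: mat_eq_mat2)

text \<open>Cayley-Hamilton for A, multiplied by M.\<close>

lemma trace_square_mult:
  fixes A M :: "'a::comm_ring_1^2^2"
  assumes "det A = 1"
  shows "trace (A ** A ** M) = trace A * trace (A ** M) - trace M"
proof -
  obtain a b c d where A: "A = mat2 a b c d" by (rule mat2_cases)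
  obtain a' b' c' d' where M: "M = mat2 a' b' c' d'" by (rule mat2_cases)
  have "a * d = 1 + b * c" using assms by (simp add: A algebra_simps)
  moreover have "trace (A ** A ** M) - (trace A * trace (A ** M) - trace M)
      = (a' + d') * (1 + b * c - a * d)" by (simp add: A M algebra_simps)
  ultimately show ?thesis by simp
qed

text \<open>\<open>mat (trace N) - N\<close> is the adjugate of N, so in SL2 this is the rule for tr
  (M N^-1).\<close>

lemma trace_mult_inv:
  fixes M N :: "'a::comm_ring_1^2^2"
  shows "trace (M ** (mat (trace N) - N)) = trace M * trace N - trace (M ** N)"
proof -
  obtain a b c d where N: "N = mat2 a b c d" by (rule mat2_cases)
  obtain a' b' c' d' where M: "M = mat2 a' b' c' d'" by (rule mat2_cases)
  show ?thesis by (simp add: N M mat_eq_mat2 algebra_simps)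
qed

text \<open>Cancelling A in Cayley-Hamilton for AB gives BAB = tr(AB) B - adj(A) when det B =
  1.\<close>

lemma trace_sandwich_mult:
  fixes A B M :: "'a::comm_ring_1^2^2"
  assumes "det B = 1"
  shows "trace (B ** A ** B ** M)
    = trace (A ** B) * trace (B ** M) - (trace A * trace M - trace (A ** M))"
proof -
  obtain a b c d where A: "A = mat2 a b c d" by (rule mat2_cases)
  obtain a' b' c' d' where M: "M = mat2 a' b' c' d'" by (rule mat2_cases)
  obtain p q r s where B: "B = mat2 p q r s" by (rule mat2_cases)
  have "p * s - q * r = 1" using assms by (simp add: B)
  moreover have "trace (B ** A ** B ** M) - (trace (A ** B) * trace (B ** M)
      - (trace A * trace M - trace (A ** M)))
    = (trace A * trace M - trace (A ** M)) * (1 - (p * s - q * r))"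
    by (simp add: A M B algebra_simps)
  ultimately show ?thesis by simp
qed

lemma SL2_inverse:
  fixes A :: "'a::comm_ring_1^2^2"
  assumes "det A = 1"
  shows "A ** (mat (trace A) - A) = mat 1" "(mat (trace A) - A) ** A = mat 1"
proof -
  obtain a b c d where A: "A = mat2 a b c d" by (rule mat2_cases)
  show "A ** (mat (trace A) - A) = mat 1" "(mat (trace A) - A) ** A = mat 1"
    using assms by (simp_all add: A mat_eq_mat2 algebra_simps)
qed

lemma det_inverse: "det (mat (trace A) - A) = det A" for A :: "'a::comm_ring_1^2^2"
  by (rule mat2_cases[of A]) (simp add: mat_eq_mat2 algebra_simps)

lemma trace_of_inverse:
  fixes A B :: "'a::comm_ring_1^2^2"
  assumes "det A = 1" "A ** B = mat 1"
  shows "B = mat (trace A) - A" "trace B = trace A"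
proof -
  have "B = (mat (trace A) - A) ** A ** B" by (simp add: SL2_inverse assms)
  also have "\<dots> = mat (trace A) - A" by (simp flip: matrix_mul_assoc add: assms)
  finally show B: "B = mat (trace A) - A" .
  obtain a b c d where A: "A = mat2 a b c d" by (rule mat2_cases)
  show "trace B = trace A" by (simp add: B A mat_eq_mat2)
qed

text \<open>Fricke's formula for the trace of a commutator.\<close>

lemma trace_commutator:
  fixes A B :: "'a::comm_ring_1^2^2"
  assumes "det A = 1" "det B = 1"
  shows "trace (A ** B ** (mat (trace A) - A) ** (mat (trace B) - B))
    = trace A ^ 2 + trace B ^ 2 + trace (A ** B) ^ 2 - trace A * trace B * trace (A ** B) - 2"
proof -
  have "trace (A ** B ** (mat (trace A) - A) ** (mat (trace B) - B))
      = trace (A ** B ** (mat (trace A) - A)) * trace B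
        - trace (A ** B ** (mat (trace A) - A) ** B)"
    by (rule trace_mult_inv)
  also have "trace (A ** B ** (mat (trace A) - A))
      = trace (A ** B) * trace A - trace (A ** B ** A)" by (rule trace_mult_inv)
  also have "trace (A ** B ** A) = trace A * trace (A ** B) - trace B"
    using trace_square_mult[OF assms(1), of B] trace_cyclic[of A B A] trace_cyclic[of B A A]
    by simp
  also have "trace (A ** B ** (mat (trace A) - A) ** B)
      = trace (B ** A ** B ** (mat (trace A) - A))"
    using trace_mul_sym[of "A ** B ** (mat (trace A) - A)" B] by (simp add: matrix_mul_assoc)
  also have "\<dots> = trace (B ** A ** B) * trace A - trace (B ** A ** B ** A)"
    by (rule trace_mult_inv)
  also have "trace (B ** A ** B ** A) = trace (A ** B) * trace (B ** A) - (trace A * trace A - trace (A ** A))"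
    by (rule trace_sandwich_mult[OF assms(2)])
  also have "trace (A ** A) = trace A * trace A - 2"
    using trace_square_mult[OF assms(1), of "mat 1"] by simp
  also have "trace (B ** A ** B) = trace B * trace (A ** B) - trace A"
    using trace_square_mult[OF assms(2), of A] trace_cyclic[of B A B]
      trace_mul_sym[of A B] trace_cyclic[of B B A] by simp
  finally show ?thesis
    by (simp add: trace_mul_sym[of B A] power2_eq_square algebra_simps)
qed

text \<open>With U = BAB and V = T A T^-1 the relations say V = U^-1 and T B T^-1 = B A V^3. Each
  equation results from computing the trace of one consequence of them in two ways.\<close>

lemma bundle_trace_relations:
  fixes A B T :: "'a::comm_ring_1^2^2"
  assumes det: "det A = 1" "det B = 1" "det T = 1"
    and R1: "B ** A ** B ** T ** A = T" and R2: "B ** A ** T ** A ** A ** A = T ** B"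
  defines "x \<equiv> trace A" and "y \<equiv> trace B" and "z \<equiv> trace (A ** B)" and "t \<equiv> trace T"
    and "ta \<equiv> trace (T ** A)" and "tb \<equiv> trace (T ** B)" and "tab \<equiv> trace (T ** (A ** B))"
  shows "2 * x = y * z" "2 * y = x * (x * y - z)" "2 * t = z * tab" "z * tb = 2 * (x * t - ta)"
    "x * (z * ta - y * t) = 0" "x * t * ta - t\<^sup>2 - ta\<^sup>2 = x\<^sup>2 - z\<^sup>2"
proof -
  let ?A' = "mat x - A" and ?B' = "mat y - B" and ?T' = "mat t - T"
  let ?U = "B ** A ** B" and ?V = "T ** A ** ?T'"
  have inv: "A ** ?A' = mat 1" "?A' ** A = mat 1" "B ** ?B' = mat 1" "?B' ** B = mat 1"
    "T ** ?T' = mat 1" "?T' ** T = mat 1"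
    unfolding x_def y_def t_def using SL2_inverse det by blast+
  have detU: "det ?U = 1" by (simp add: det_mul det)
  have UV: "?U ** ?V = mat 1"
  proof -
    have "?U ** ?V = (B ** A ** B ** T ** A) ** ?T'" by (simp add: matrix_mul_assoc)
    then show ?thesis by (simp add: R1 inv)
  qed
  have V: "?V = mat (trace ?U) - ?U" and trV: "trace ?V = trace ?U"
    using trace_of_inverse[OF detU UV] by auto
  have trU: "trace ?U = y * z - x"
    using trace_square_mult[OF det(2), of A]
      trace_mul_sym[of A B] trace_cyclic[of B A B] trace_cyclic[of B B A]
    by (simp flip: x_def y_def z_def)
  have trV2: "trace ?V = x"
  proof -
    have "trace ?V = trace (?T' ** T ** A)" using trace_cyclic[of ?T' T A] by simp
    then show ?thesis by (simp add: inv x_def)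
  qed
  from trV trU trV2 show 1: "2 * x = y * z" by (simp add: algebra_simps)
  have trUx: "trace ?U = x" using trV trV2 by simp
  have detV: "det ?V = 1" unfolding V
    by (simp only: det_inverse detU)
  \<comment> \<open>By cyclicity \<open>R1\<close> makes tr ((AB)^2 T) equal to tr T, while
    Cayley-Hamilton for AB expands it.\<close>
  have "trace (A ** B ** (A ** B) ** T) = z * trace (A ** B ** T) - t"
    unfolding z_def t_def by (rule trace_square_mult) (simp add: det_mul det)
  moreover have "trace (A ** B ** (A ** B) ** T) = t"
    using R1 trace_mul_sym[of A "B ** A ** B ** T"] by (simp add: matrix_mul_assoc t_def)
  moreover have "trace (A ** B ** T) = tab" unfolding tab_def by (rule trace_mul_sym)
  ultimately show "2 * t = z * tab" by (simp add: algebra_simps)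
  have BT: "trace (B ** T) = tb" and AT: "trace (A ** T) = ta"
    unfolding tb_def ta_def by (rule trace_mul_sym)+
  \<comment> \<open>\<open>R1\<close> with its last factor A moved to the other side; the sandwich
    rule expands the left trace.\<close>
  have "B ** A ** B ** T = (B ** A ** B ** T ** A) ** ?A'"
    by (simp add: inv flip: matrix_mul_assoc)
  then have "B ** A ** B ** T = T ** ?A'" by (simp only: R1)
  then have "z * tb - (x * t - ta) = t * x - ta"
    using trace_sandwich_mult[OF det(2), of A T] trace_mult_inv[of T A]
    unfolding BT AT by (simp flip: x_def y_def z_def t_def ta_def)
  then show "z * tb = 2 * (x * t - ta)" by (simp add: algebra_simps)
  \<comment> \<open>\<open>R2\<close> with its last factor A moved to the other side.\<close>
  have "B ** A ** T ** A ** A = (B ** A ** T ** A ** A ** A) ** ?A'"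
    by (simp add: inv flip: matrix_mul_assoc)
  then have "B ** A ** T ** A ** A = T ** B ** ?A'" by (simp only: R2)
  then have "trace (B ** A ** T ** A ** A) = tb * x - trace (T ** B ** A)"
    using trace_mult_inv[of "T ** B" A] by (simp flip: x_def tb_def)
  moreover have "trace (B ** A ** T ** A ** A) = trace (A ** A ** (B ** A ** T))"
    using trace_mul_sym[of "B ** A ** T" "A ** A"] by (simp add: matrix_mul_assoc)
  moreover have "\<dots> = x * trace (A ** (B ** A ** T)) - trace (B ** A ** T)"
    unfolding x_def by (rule trace_square_mult[OF det(1)])
  moreover have "trace (A ** (B ** A ** T)) = z * ta - (y * t - tb)"
    using trace_sandwich_mult[OF det(1), of B T] unfolding BT AT
    by (simp add: matrix_mul_assoc trace_mul_sym[of B A] flip: z_def y_def t_def)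
  moreover have "trace (B ** A ** T) = trace (T ** B ** A)"
    using trace_mul_sym[of "B ** A" T] by (simp add: matrix_mul_assoc)
  ultimately show "x * (z * ta - y * t) = 0" by (simp add: algebra_simps)
  \<comment> \<open>The trace of AV, expanded once through T^-1 and once through V = U^-1.\<close>
  have "trace (A ** T ** A ** ?T') = trace (A ** T ** A) * t - trace (A ** T ** A ** T)"
    unfolding t_def by (rule trace_mult_inv)
  also have "trace (A ** T ** A) = x * ta - t"
    using trace_square_mult[OF det(1), of T] AT trace_cyclic[of A T A] trace_cyclic[of T A A]
    unfolding x_def t_def by simp
  also have "trace (A ** T ** A ** T) = ta * ta - 2"
    using trace_square_mult[of "A ** T" "mat 1"] AT
    by (simp add: det_mul det matrix_mul_assoc)
  also have "trace (A ** T ** A ** ?T') = trace (A ** ?V)" by (simp add: matrix_mul_assoc)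
  also have "trace (A ** ?V) = x * x - trace (A ** ?U)"
    unfolding V using trace_mult_inv[of A ?U] trUx by (simp add: x_def)
  also have "trace (A ** ?U) = z * z - 2"
    using trace_square_mult[of "A ** B" "mat 1"]
    by (simp add: det_mul det matrix_mul_assoc flip: z_def)
  finally show "x * t * ta - t\<^sup>2 - ta\<^sup>2 = x\<^sup>2 - z\<^sup>2"
    by (simp add: power2_eq_square algebra_simps)
  \<comment> \<open>From V = (BAB)^-1. It replaces one factor V in tr (B A V^3), leaving tr (V^2
    B^-1).\<close>
  have 2: "?V ** (B ** A) = ?B'"
  proof -
    have "?V ** (B ** A) ** B = mat 1"
      using SL2_inverse(2)[OF detU] unfolding V by (simp add: matrix_mul_assoc)
    then have "?V ** (B ** A) ** B ** ?B' = ?B'" by simp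
    then show ?thesis by (simp add: inv flip: matrix_mul_assoc)
  qed
  have "y = trace (T ** B ** ?T')"
  proof -
    have "trace (T ** B ** ?T') = trace (?T' ** T ** B)" using trace_cyclic[of ?T' T B] by simp
    then show ?thesis by (simp add: inv y_def)
  qed
  also have "T ** B ** ?T' = B ** A ** ?V ** ?V ** ?V"
  proof -
    have c: "?T' ** (T ** W) = W" for W by (simp add: inv matrix_mul_assoc)
    have "B ** A ** ?V ** ?V ** ?V = (B ** A ** T ** A ** A ** A) ** ?T'"
      by (simp add: c flip: matrix_mul_assoc)
    then show ?thesis by (simp only: R2)
  qed
  also have "trace \<dots> = trace (?V ** ?V ** ?B')"
    unfolding 2[symmetric] using trace_mul_sym[of "B ** A" "?V ** ?V ** ?V"]
    by (simp add: matrix_mul_assoc)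
  also have "\<dots> = x * trace (?V ** ?B') - trace ?B'"
    by (subst trace_square_mult[OF detV]) (simp only: trV2)
  also have "trace (?V ** ?B') = trace (B ** ?U)"
  proof (rule trace_of_inverse(2))
    have "B ** ?U ** (?V ** ?B') = B ** (?U ** ?V) ** ?B'" by (simp add: matrix_mul_assoc)
    then show "B ** ?U ** (?V ** ?B') = mat 1" by (simp only: UV inv matrix_mul_rid)
  qed (simp add: det_mul det)
  also have "trace (B ** ?U) = y * trace ?U - z"
    using trace_square_mult[OF det(2), of "A ** B"] by (simp add: matrix_mul_assoc y_def z_def)
  also have "trace ?B' = y" using trace_of_inverse(2)[OF det(2) inv(3)] by (simp add: y_def)
  finally show "2 * y = x * (x * y - z)" unfolding trUx by (simp add: algebra_simps)
qed

section \<open>Traces of the two hyperbolic curves\<close>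

lemma csquare_plus_1: "k * k = -1 \<longleftrightarrow> k = \<i> \<or> k = - \<i>" for k :: complex
proof -
  have "k * k = -1 \<longleftrightarrow> (k - \<i>) * (k + \<i>) = 0" by (simp add: algebra_simps eq_neg_iff_add_eq_0 add.commute)
  then show ?thesis by (auto simp: eq_neg_iff_add_eq_0)
qed

text \<open>Three of the equations are linear and homogeneous in t, ta, tb, tab and fix these up to
  a common factor k. The quadratic one then reads (k^2 + 1)(x^2 - 4) = 0, and x^2 = 4 would force
  the commutator trace to be 2.\<close>

lemma curve_traces:
  fixes x y z t ta tb tab :: complex
  assumes e: "2 * x = y * z" "2 * y = x * (x * y - z)" "2 * t = z * tab" "z * tb = 2 * (x * t - ta)"
    "x * (z * ta - y * t) = 0" "x * t * ta - t\<^sup>2 - ta\<^sup>2 = x\<^sup>2 - z\<^sup>2"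
    and x: "x \<noteq> 0" and l: "x^2 + y^2 + z^2 - x * y * z - 2 \<noteq> 2"
  shows "\<exists>k. k * k = -1 \<and> y * z = 2 * x \<and> z^2 = 2 * x^2 - 4 \<and> t = k * (x^2 - 2) \<and> ta = k * x \<and>
    tb = k * (x * z - y) \<and> tab = k * z"
proof -
  have nz: "y \<noteq> 0" "z \<noteq> 0" using e(1) x by auto
  define k where "k = tab / z"
  have "x * (z^2 - (2 * x^2 - 4)) = 0" using e(1,2) by Groebner_Basis.algebra
  then have z2: "z^2 = 2 * x^2 - 4" using x by simp
  have tab: "tab = k * z" using nz by (simp add: k_def)
  have t: "t = k * (x^2 - 2)" using e(3) tab z2 by Groebner_Basis.algebra
  have "z * ta = y * t" using e(5) x by simp
  then have "z * (ta - k * x) = 0" using t z2 e(1) by Groebner_Basis.algebra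
  then have ta: "ta = k * x" using nz by simp
  have "z * (tb - k * (x * z - y)) = 0" using e(4) t ta z2 e(1) by Groebner_Basis.algebra
  then have tb: "tb = k * (x * z - y)" using nz by simp
  have "x^2 \<noteq> 4"
  proof
    assume x4: "x^2 = 4"
    then have z4: "z^2 = 4" using z2 by simp
    have "y^2 * z^2 = 4 * x^2" using e(1) by Groebner_Basis.algebra
    then have "y^2 = 4" using x4 z4 by simp
    moreover have "x * y * z = 2 * x^2" using e(1) by Groebner_Basis.algebra
    ultimately show False using l x4 z4 by simp
  qed
  moreover have "(k * k + 1) * (x^2 - 4) = 0" using e(6) t ta z2 by Groebner_Basis.algebra
  ultimately have "k * k + 1 = 0" by simp
  then have "k * k = -1" by (simp add: eq_neg_iff_add_eq_0)
  then show ?thesis using e(1) z2 t ta tb tab by auto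
qed

lemma mat_commute: "mat c ** M = M ** mat c" for M :: "'a::comm_ring_1^2^2"
  by (rule mat2_cases[of M]) (simp add: mat_eq_mat2 mult.commute)

text \<open>A and B are normalised so that AB is upper and BA lower triangular, with the eigenvalues
  b and c. The variables e and f stand for the inverses of b + c and b - c, which keeps all steps
  polynomial. As the relations are linear in T, the factor j is left out here.\<close>

lemma curve_matrix_relations:
  fixes x y z b c e f p q r s :: complex
  assumes bc: "b * c = 1" and f: "f * (b - c) = 1" and xx: "2 * x * x = (b + c)^2 + 4"
    and e: "e * (b + c) = 1" and y: "y = 2 * x * e" and p: "p = (b * b + 3) * b * f" and r: "r = x * (b + c) * f"
    and q: "q = - (b * b * r)" and s: "s = 1 + (b - c)^2 / 2 - (b + c)^2 * b * f"
  defines "A \<equiv> mat2 x (-1) 1 0" and "B \<equiv> mat2 0 b (-c) y" and "T \<equiv> mat2 p q r s"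
  shows "B ** A ** B ** T ** A = T" "B ** A ** T ** A ** A ** A = T ** B"
proof -
  have yy: "y * (b + c) = 2 * x" unfolding y using e by Groebner_Basis.algebra
  have BA: "B ** A = mat2 b 0 (y - c * x) c" by (simp add: A_def B_def)
  have "(y - c * x) * b + c * y = x" using yy bc by Groebner_Basis.algebra
  then have U: "B ** A ** B = mat2 0 (b * b) (- (c * c)) x" unfolding BA by (simp add: B_def)
  \<comment> \<open>The first relation amounts to this equation together with
    \<open>q = - (b * b * r)\<close>.\<close>
  have s': "s = c * c * p - x * r" unfolding s p r using bc f xx by Groebner_Basis.algebra
  show "B ** A ** B ** T ** A = T"
    unfolding U unfolding A_def T_def mat2_mult mat2_eq_iff s' q
    by (insert bc, intro conjI; (simp add: algebra_simps; fail | Groebner_Basis.algebra))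
  have A3: "A ** A ** A = mat2 (x*x*x - 2*x) (1 - x*x) (x*x - 1) (-x)"
    by (simp add: A_def algebra_simps)
  \<comment> \<open>\<open>e0\<close> and \<open>e1\<close> fix the ratio of p and r; the four
    entries of the second relation, \<open>e2\<close> to \<open>e5\<close>, follow from
    them.\<close>
  have e0: "b * r * (y + b * x) = p * x * x" unfolding p r using bc yy by Groebner_Basis.algebra
  have e1: "b * r * (c - b + b * x * x) = p * x * (x * x - 2)"
     unfolding p r using bc xx by Groebner_Basis.algebra
  have e2: "b * (p * (x*x*x - 2*x) + q * (x*x - 1)) = - (c * q)"
    unfolding q using e1 bc by Groebner_Basis.algebra
  have e3: "b * (p * (1 - x*x) - q * x) = p * b + q * y"
    unfolding q using e0 bc by Groebner_Basis.algebra
  show "B ** A ** T ** A ** A ** A = T ** B"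
  proof -
    have eq: "B ** A ** T ** A ** A ** A = B ** A ** T ** (A ** A ** A)"
      by (simp add: matrix_mul_assoc)
    have G: "p * (x*x*x - 2*x) + q * (x*x - 1) = r"
      unfolding q using e1 bc by Groebner_Basis.algebra
    have e4: "(y - c*x) * (p * (x*x*x - 2*x) + q * (x*x - 1))
        + c * (r * (x*x*x - 2*x) + s * (x*x - 1)) = - (c * s)"
      unfolding G unfolding s' using e0 bc yy by Groebner_Basis.algebra
    have e5: "(y - c*x) * (p * (1 - x*x) - q * x) + c * (r * (1 - x*x) - s * x) = r * b + s * y"
      unfolding q s' p r y using bc xx e by Groebner_Basis.algebra
    show ?thesis
      unfolding eq unfolding BA A3 unfolding T_def B_def mat2_mult mat2_eq_iff
      by (insert e2 e3 e4 e5, intro conjI; Groebner_Basis.algebra)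
  qed
qed

text \<open>With \<open>b + 1/b = z\<close>, the matrix \<open>T\<close> below is \<open>j (1 + (x\<^sup>2 - 4) h)\<close>, where \<open>h\<close> is determined by
  \<open>tr h = 1\<close>, \<open>tr (hA) = tr (hAB) = 0\<close> and \<open>tr (hB) = y\<close>.
  When \<open>x\<^sup>2 = 4\<close>, the representation degenerates to one with central \<open>A\<close> and \<open>B\<close>.\<close>

lemma curve_matrices:
  fixes x y z j :: complex
  assumes j: "j * j = -1" and yz: "y * z = 2 * x" and z2: "z^2 = 2 * x^2 - 4"
  obtains A B T :: "complex^2^2" where "det A = 1" "det B = 1" "det T = 1"
    "B ** A ** B ** T ** A = T" "B ** A ** T ** A ** A ** A = T ** B"
    "trace A = x" "trace B = y" "trace (A ** B) = z" "trace T = j * (x^2 - 2)"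
    "trace (T ** A) = j * x" "trace (T ** B) = j * (x * z - y)" "trace (T ** (A ** B)) = j * z"
proof (cases "x^2 = 4")
  case True
  \<comment> \<open>The prescribed trace of T is now 2j, so T is taken diagonal with the roots m, n
    of w^2 - 2jw + 1.\<close>
  define s where "s = csqrt ((2 * j)^2 - 4)"
  define m n where "m = (2 * j + s) / 2" and "n = (2 * j - s) / 2"
  have s: "s^2 = (2 * j)^2 - 4" by (simp add: s_def)
  have mn: "m * n = 1" using s by (simp add: m_def n_def field_simps power2_eq_square)
  have mn': "m + n = 2 * j" by (simp add: m_def n_def field_simps)
  define a b where "a = x / 2" and "b = y / 2"
  have z4: "z^2 = 4" using z2 True by simp
  have "y^2 * z^2 = 4 * x^2" using yz by Groebner_Basis.algebra
  then have y4: "y^2 = 4" using True z4 by simp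
  have a: "a * a = 1" and b: "b * b = 1" using True y4 by (simp_all add: a_def b_def power2_eq_square)
  have x: "x = 2 * a" and y: "y = 2 * b" by (simp_all add: a_def b_def)
  have z: "z = 2 * (a * b)"
  proof -
    have "b * z = 2 * a" using yz x y by simp
    then have "b * b * z = 2 * (a * b)" by (simp add: mult.assoc)
    then show ?thesis using b by simp
  qed
  show ?thesis
  proof (rule that[of "mat2 a 0 0 a" "mat2 b 0 0 b" "mat2 m 0 0 n"])
    show "trace (mat2 m 0 0 n) = j * (x^2 - 2)" using True mn' by (simp add: mult.commute)
    show "trace (mat2 m 0 0 n ** mat2 a 0 0 a) = j * x" using mn' x by (simp; Groebner_Basis.algebra)
    show "trace (mat2 m 0 0 n ** mat2 b 0 0 b) = j * (x * z - y)" using mn' x y z a by (simp; Groebner_Basis.algebra)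
    show "trace (mat2 m 0 0 n ** (mat2 a 0 0 a ** mat2 b 0 0 b)) = j * z"
      using mn' z by (simp; Groebner_Basis.algebra)
    show "mat2 b 0 0 b ** mat2 a 0 0 a ** mat2 b 0 0 b ** mat2 m 0 0 n ** mat2 a 0 0 a = mat2 m 0 0 n"
      using a b by (simp; Groebner_Basis.algebra)
    show "mat2 b 0 0 b ** mat2 a 0 0 a ** mat2 m 0 0 n ** mat2 a 0 0 a ** mat2 a 0 0 a ** mat2 a 0 0 a
        = mat2 m 0 0 n ** mat2 b 0 0 b"
      using a b by (simp; Groebner_Basis.algebra)
  qed (use a b mn x y z in \<open>simp_all\<close>)
next
  case False
  \<comment> \<open>b and c are the eigenvalues of AB; they are distinct because z^2 = 4 is
    equivalent to x^2 = 4.\<close>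
  define s where "s = csqrt (z^2 - 4)"
  define b c where "b = (z + s) / 2" and "c = (z - s) / 2"
  have s: "s^2 = z^2 - 4" by (simp add: s_def)
  have bc: "b * c = 1" using s by (simp add: b_def c_def field_simps power2_eq_square)
  have bcz: "b + c = z" by (simp add: b_def c_def field_simps)
  have "z \<noteq> 0"
  proof
    assume "z = 0"
    then have "x = 0" using yz by simp
    then show False using z2 \<open>z = 0\<close> by simp
  qed
  have b0: "b \<noteq> 0" using bc by auto
  have "b - c \<noteq> 0"
  proof
    assume "b - c = 0"
    moreover have "z^2 = (b - c)^2 + 4 * (b * c)"
      by (simp add: power2_eq_square algebra_simps flip: bcz)
    ultimately have "z^2 = 4" using bc by simp
    then show False using z2 False by simp
  qed
  define f where "f = 1 / (b - c)"
  have f: "f * (b - c) = 1" using \<open>b - c \<noteq> 0\<close> by (simp add: f_def)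
  define T where "T = mat2 (j * ((b * b + 3) * b * f)) (j * (- (b * b * (x * (b + c) * f))))
    (j * (x * (b + c) * f)) (j * (1 + (b - c)^2 / 2 - (b + c)^2 * b * f))"
  have c: "z = b + c" using bcz by simp
  have xx: "2 * x * x = (b + c)^2 + 4" using z2 c by Groebner_Basis.algebra
  have yy: "y * (b + c) = 2 * x" using yz c by simp
  define e where "e = 1 / z"
  have e: "e * (b + c) = 1" and y: "y = 2 * x * e" using \<open>z \<noteq> 0\<close> yz bcz by (simp_all add: e_def field_simps)
  define T0 where "T0 = mat2 ((b * b + 3) * b * f) (- (b * b * (x * (b + c) * f))) (x * (b + c) * f)
    (1 + (b - c)^2 / 2 - (b + c)^2 * b * f)"
  define A where "A = mat2 x (-1) 1 0"
  define B where "B = mat2 0 b (-c) y"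
  note defs = A_def B_def T_def
  show ?thesis
  proof (rule that[of A B T])
    show "trace (A ** B) = z" using bcz by (simp add: defs add.commute)
    show "det T = 1" unfolding defs det_mat2 using j bc f xx yy c by Groebner_Basis.algebra
    show "trace T = j * (x^2 - 2)" unfolding defs trace_mat2 using j bc f xx yy c by Groebner_Basis.algebra
    show "trace (T ** A) = j * x" unfolding defs trace_mat2 mat2_mult using j bc f xx yy c by Groebner_Basis.algebra
    show "trace (T ** B) = j * (x * z - y)"
      unfolding defs trace_mat2 mat2_mult using j bc f xx yy c by Groebner_Basis.algebra
    show "trace (T ** (A ** B)) = j * z"
      unfolding defs trace_mat2 mat2_mult using j bc f xx yy c by Groebner_Basis.algebra
    have "T = mat j ** T0" by (simp add: defs T0_def mat_eq_mat2)
    have T: "M ** (mat j ** N) = mat j ** (M ** N)" for M N :: "complex^2^2"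
      by (simp only: matrix_mul_assoc mat_commute[of j M])
    have "B ** A ** B ** T0 ** A = T0" "B ** A ** T0 ** A ** A ** A = T0 ** B"
      unfolding A_def B_def T0_def
      by (rule curve_matrix_relations[OF bc f xx e y HOL.refl HOL.refl HOL.refl HOL.refl])+
    then show "B ** A ** B ** T ** A = T" "B ** A ** T ** A ** A ** A = T ** B"
      unfolding \<open>T = mat j ** T0\<close> by (simp_all add: T flip: matrix_mul_assoc)
  qed (use bc in \<open>simp_all add: defs mult.commute\<close>)
qed


section \<open>Commutators of SL2 matrices whose trace is 2\<close>

lemma matrix_add_rdistrib: "(A + B) ** C = A ** C + B ** C" for A :: "'a::semiring_1^'n^'m"
  by (simp add: matrix_matrix_mult_def vec_eq_iff distrib_right sum.distrib)

lemma zero_mult: "0 ** A = 0" "A ** 0 = 0" for A :: "'a::semiring_1^2^2"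
  by (simp_all add: matrix_matrix_mult_def vec_eq_iff)

lemma mat_0_mult: "mat 0 ** A = 0" for A :: "'a::semiring_1^2^2"
  by (rule mat2_cases[of A]) (simp add: mat_eq_mat2, simp add: vec_eq_iff forall_2)

text \<open>For K = u v^T the middle factor v^T M u is a scalar, namely tr (KM).\<close>

lemma rank_one_sandwich:
  fixes K M :: "'a::comm_ring_1^2^2"
  assumes "det K = 0"
  shows "K ** M ** K = mat (trace (K ** M)) ** K"
proof -
  obtain a b c d where K: "K = mat2 a b c d" by (rule mat2_cases)
  obtain p q r s where M: "M = mat2 p q r s" by (rule mat2_cases)
  have ad: "a * d = b * c" using assms by (simp add: K)
  have ad': "a * (d * w) = b * (c * w)" "d * (a * w) = b * (c * w)" for w
    using ad by (metis mult.assoc mult.commute)+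
  show ?thesis using ad by (simp add: K M mat_eq_mat2 algebra_simps ad')
qed

text \<open>For \<open>P = AB\<close> and \<open>Q = BA\<close>, these are the two commutators \<open>P Q\<inverse>\<close> and \<open>Q\<inverse> P\<close>: they
  differ from the identity by \<open>K Q\<inverse>\<close> and \<open>Q\<inverse> K\<close> with \<open>K = P - Q\<close> of rank at most one.\<close>

lemma commutators_commute:
  fixes P Q :: "'a::comm_ring_1^2^2"
  assumes Q: "det P = 1" "det Q = 1" and tr: "trace P = trace Q"
  defines "Q' \<equiv> mat (trace Q) - Q"
  assumes l: "trace (P ** Q') = 2"
  shows "P ** Q' ** (Q' ** P) = Q' ** P ** (P ** Q')"
proof -
  define K where "K = P - Q"
  \<comment> \<open>Polarised determinant: the commutator trace 2 means exactly that K is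
    singular.\<close>
  have "det K = det P + det Q - trace (P ** Q')"
  proof -
    obtain a b c d where P: "P = mat2 a b c d" by (rule mat2_cases)
    obtain p q r s where Q: "Q = mat2 p q r s" by (rule mat2_cases)
    show ?thesis by (simp add: K_def P Q Q'_def mat_eq_mat2 algebra_simps)
  qed
  then have detK: "det K = 0" using Q l by simp
  have trK: "trace K = 0" using tr by (simp add: K_def trace_sub)
  have inv: "Q ** Q' = mat 1" "Q' ** Q = mat 1"
    unfolding Q'_def using SL2_inverse[OF Q(2)] by auto
  have PQ: "P = Q + K" by (simp add: K_def)
  have tQ: "trace Q' = trace Q" by (rule trace_of_inverse(2)[OF Q(2) inv(1)])
  \<comment> \<open>P = Q + K gives tr (P Q') = 2 + tr (Q' K). With tr K = 0, Cayley-Hamilton for Q'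
    then also kills tr (Q'^2 K).\<close>
  have "trace (Q' ** K) = 0"
  proof -
    have "trace (P ** Q') = trace (mat 1 + K ** Q')" by (simp add: PQ inv matrix_add_rdistrib)
    also have "\<dots> = 2 + trace (Q' ** K)" by (simp add: trace_add trace_mul_sym[of K])
    finally show ?thesis using l by simp
  qed
  moreover have "det Q' = 1" unfolding Q'_def by (simp only: det_inverse Q)
  ultimately have "trace (Q' ** Q' ** K) = 0" using trK by (simp add: trace_square_mult)
  then have "trace (K ** (Q' ** Q')) = 0" by (subst trace_mul_sym)
  then have 1: "K ** (Q' ** Q') ** K = 0"
    by (simp only: rank_one_sandwich[OF detK] mat_0_mult)
  have 2: "K ** K = 0"
    using rank_one_sandwich[OF detK, of "mat 1"] by (simp add: trK mat_0_mult)
  have C: "P ** Q' = mat 1 + K ** Q'" "Q' ** P = mat 1 + Q' ** K"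
    by (simp_all add: PQ inv matrix_add_rdistrib matrix_add_ldistrib)
  have "(K ** Q') ** (Q' ** K) = (Q' ** K) ** (K ** Q')"
  proof -
    have "(K ** Q') ** (Q' ** K) = K ** (Q' ** Q') ** K" by (simp add: matrix_mul_assoc)
    moreover have "(Q' ** K) ** (K ** Q') = Q' ** (K ** K) ** Q'" by (simp add: matrix_mul_assoc)
    ultimately show ?thesis by (simp add: 1 2 zero_mult)
  qed
  then show ?thesis unfolding C
    by (simp add: matrix_add_rdistrib matrix_add_ldistrib algebra_simps)
qed

text \<open>The commutator is the identity, so Fricke's formula has the value 2.\<close>

lemma commuting_trace_relation:
  fixes C D :: "'a::comm_ring_1^2^2"
  assumes "det C = 1" "det D = 1" "C ** D = D ** C"
  shows "trace C ^ 2 + trace D ^ 2 + trace (C ** D) ^ 2 - trace C * trace D * trace (C ** D) = 4"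
proof -
  let ?C' = "mat (trace C) - C" and ?D' = "mat (trace D) - D"
  have "C ** D ** ?C' ** ?D' = D ** (C ** ?C') ** ?D'" by (simp only: assms(3) matrix_mul_assoc)
  also have "\<dots> = mat 1" by (simp add: SL2_inverse assms)
  finally have "trace (C ** D ** ?C' ** ?D') = 2" by simp
  then show ?thesis unfolding trace_commutator[OF assms(1,2)] by (simp add: algebra_simps)
qed

text \<open>Entering the traces of both commutators and of their product into the relation for
  commuting matrices gives z^2 (l - 2)^2 (z^2 - l - 2) = 0.\<close>

lemma commutators_dont_commute:
  fixes P Q :: "complex^2^2"
  assumes Q: "det P = 1" "det Q = 1" and tr: "trace P = z" "trace Q = z"
  defines "Q' \<equiv> mat (trace Q) - Q"
  assumes l: "trace (P ** Q') = l" "l \<noteq> 2" "z \<noteq> 0" "z^2 \<noteq> l + 2"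
  shows "P ** Q' ** (Q' ** P) \<noteq> Q' ** P ** (P ** Q')"
proof
  assume comm: "P ** Q' ** (Q' ** P) = Q' ** P ** (P ** Q')"
  have inv: "Q ** Q' = mat 1" "Q' ** Q = mat 1"
    unfolding Q'_def using SL2_inverse[OF Q(2)] by auto
  have tQ: "trace Q' = z" using trace_of_inverse(2)[OF Q(2) inv(1)] tr by simp
  have dQ: "det Q' = 1" unfolding Q'_def by (simp only: det_inverse Q)
  have "trace (P ** Q' ** (Q' ** P)) = trace (P ** P ** (Q' ** Q'))"
    using trace_mul_sym[of "P ** Q' ** Q'" P] by (simp add: matrix_mul_assoc)
  also have "\<dots> = z * trace (Q' ** Q' ** P) - trace (Q' ** Q')"
    using trace_square_mult[OF Q(1), of "Q' ** Q'"] trace_mul_sym[of P "Q' ** Q'"] tr by simp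
  also have "trace (Q' ** Q' ** P) = z * l - z"
    using trace_square_mult[OF dQ, of P] trace_mul_sym[of Q' P] tQ l tr by simp
  also have "trace (Q' ** Q') = z * z - 2"
    using trace_square_mult[OF dQ, of "mat 1"] tQ by simp
  finally have t: "trace (P ** Q' ** (Q' ** P)) = z * (z * l - z) - (z * z - 2)" .
  have "trace (P ** Q')^2 + trace (Q' ** P)^2 + trace (P ** Q' ** (Q' ** P))^2
      - trace (P ** Q') * trace (Q' ** P) * trace (P ** Q' ** (Q' ** P)) = 4"
    by (rule commuting_trace_relation) (simp_all add: det_mul Q dQ comm)
  moreover have "z * z * ((l - 2) * (l - 2) * (z^2 - (l + 2)))
      = l^2 + l^2 + (z * (z * l - z) - (z * z - 2))^2 - l * l * (z * (z * l - z) - (z * z - 2)) - 4"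
    by (simp add: power2_eq_square algebra_simps)
  ultimately have "z * z * ((l - 2) * (l - 2) * (z^2 - (l + 2))) = 0"
    unfolding t trace_mul_sym[of Q' P] l by simp
  then show False using l by simp
qed


section \<open>Characters\<close>

text \<open>The Fricke coordinates for three generators: every trace is an integer polynomial in
  these seven.\<close>

abbreviation (input) "cx ch \<equiv> ch (pi1_gen Alpha)"
abbreviation (input) "cy ch \<equiv> ch (pi1_gen Beta)"
abbreviation (input) "cz ch \<equiv> ch (pi1_mult (pi1_gen Alpha) (pi1_gen Beta))"
abbreviation (input) "ct ch \<equiv> ch (pi1_gen Tau)"
abbreviation (input) "cta ch \<equiv> ch (pi1_mult (pi1_gen Tau) (pi1_gen Alpha))"
abbreviation (input) "ctb ch \<equiv> ch (pi1_mult (pi1_gen Tau) (pi1_gen Beta))"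
abbreviation (input) "ctab ch \<equiv> ch (pi1_mult (pi1_gen Tau) (pi1_mult (pi1_gen Alpha) (pi1_gen Beta)))"

lemmas SL2C_hom_eq = group.pi1_hom_eq[OF group_SL2C]

lemma hom_lam:
  assumes "\<rho> \<in> hom pi1_N SL2C"
  defines "A \<equiv> \<rho> (pi1_gen Alpha)" and "B \<equiv> \<rho> (pi1_gen Beta)"
  shows "\<rho> lam = A ** B ** (mat (trace A) - A) ** (mat (trace B) - B)"
  using SL2C_hom_eq[OF assms(1)] by (simp add: lam_def A_def B_def inv_SL2C)

lemma char_lam:
  assumes "ch \<in> char_variety"
  shows "ch lam = cx ch ^ 2 + cy ch ^ 2 + cz ch ^ 2 - cx ch * cy ch * cz ch - 2"
proof -
  obtain \<rho> where \<rho>: "\<rho> \<in> hom pi1_N SL2C" and ch: "ch = character \<rho>"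
    using assms by (auto simp: char_variety_def)
  show ?thesis
    using SL2C_hom_eq[OF \<rho>]
    by (simp add: ch character_def hom_lam[OF \<rho>] trace_commutator)
qed

lemma char_relations:
  assumes "ch \<in> char_variety"
  shows "2 * cx ch = cy ch * cz ch" "2 * cy ch = cx ch * (cx ch * cy ch - cz ch)"
    "2 * ct ch = cz ch * ctab ch" "cz ch * ctb ch = 2 * (cx ch * ct ch - cta ch)"
    "cx ch * (cz ch * cta ch - cy ch * ct ch) = 0"
    "cx ch * ct ch * cta ch - (ct ch)\<^sup>2 - (cta ch)\<^sup>2 = (cx ch)\<^sup>2 - (cz ch)\<^sup>2"
proof -
  obtain \<rho> where \<rho>: "\<rho> \<in> hom pi1_N SL2C" and ch: "ch = character \<rho>"
    using assms by (auto simp: char_variety_def)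
  note h = SL2C_hom_eq[OF \<rho>]
  note r = bundle_trace_relations[of "\<rho> (pi1_gen Alpha)" "\<rho> (pi1_gen Beta)" "\<rho> (pi1_gen Tau)"]
  note rel = group.pi1_hom_relations[OF group_SL2C \<rho> HOL.refl HOL.refl HOL.refl]
  show "2 * cx ch = cy ch * cz ch" "2 * cy ch = cx ch * (cx ch * cy ch - cz ch)"
    "2 * ct ch = cz ch * ctab ch" "cz ch * ctb ch = 2 * (cx ch * ct ch - cta ch)"
    "cx ch * (cz ch * cta ch - cy ch * ct ch) = 0"
    "cx ch * ct ch * cta ch - (ct ch)\<^sup>2 - (cta ch)\<^sup>2 = (cx ch)\<^sup>2 - (cz ch)\<^sup>2"
    unfolding ch character_def using r h rel by simp_all
qed

definition curve_chars :: "complex \<Rightarrow> (pi1 \<Rightarrow> complex) set" where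
  "curve_chars j = {ch \<in> char_variety. cy ch * cz ch = 2 * cx ch \<and> cz ch ^ 2 = 2 * cx ch ^ 2 - 4 \<and>
     ct ch = j * (cx ch ^ 2 - 2) \<and> cta ch = j * cx ch \<and> ctb ch = j * (cx ch * cz ch - cy ch) \<and>
     ctab ch = j * cz ch}"

lemma char_variety_cases:
  assumes "ch \<in> char_variety" "cx ch \<noteq> 0" "ch lam \<noteq> 2"
  shows "ch \<in> curve_chars \<i> \<or> ch \<in> curve_chars (- \<i>)"
  using curve_traces[OF char_relations[OF assms(1)] assms(2)] assms
  unfolding char_lam[OF assms(1)] csquare_plus_1 curve_chars_def by auto

text \<open>All points of the plane model are attained. The uniqueness of coefficients and the
  irreducibility of the curve both rest on this.\<close>

lemma curve_chars_point:
  assumes "j * j = -1" "y * z = 2 * x" "z^2 = 2 * x^2 - 4"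
  obtains ch where "ch \<in> curve_chars j" "cx ch = x" "cy ch = y" "cz ch = z"
proof -
  obtain A B T :: "complex^2^2" where *: "det A = 1" "det B = 1" "det T = 1"
    "B ** A ** B ** T ** A = T" "B ** A ** T ** A ** A ** A = T ** B"
    "trace A = x" "trace B = y" "trace (A ** B) = z" "trace T = j * (x^2 - 2)"
    "trace (T ** A) = j * x" "trace (T ** B) = j * (x * z - y)" "trace (T ** (A ** B)) = j * z"
    using curve_matrices[OF assms] .
  interpret group SL2C by (rule group_SL2C)
  obtain \<rho> where \<rho>: "\<rho> \<in> hom pi1_N SL2C" "\<rho> (pi1_gen Alpha) = A" "\<rho> (pi1_gen Beta) = B"
    "\<rho> (pi1_gen Tau) = T"
    using pi1_hom_exists[of A B T] * by auto
  have "character \<rho> \<in> curve_chars j"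
    using \<rho> * assms SL2C_hom_eq[OF \<rho>(1)]
    by (auto simp: curve_chars_def char_variety_def character_def)
  then show ?thesis
    by (rule that) (use \<rho> * SL2C_hom_eq[OF \<rho>(1)] in \<open>simp_all add: character_def\<close>)
qed

lemma curve_chars_lam:
  assumes "ch \<in> curve_chars j"
  shows "ch lam = cx ch ^ 2 + cy ch ^ 2 - 6"
proof -
  have "cx ch * cy ch * cz ch = 2 * cx ch ^ 2"
    using assms by (simp add: curve_chars_def power2_eq_square mult.assoc)
  then show ?thesis using assms char_lam[of ch] by (simp add: curve_chars_def)
qed

text \<open>The representation at \<open>x = 1\<close> serves as a test for the nontriviality of elements.\<close>

lemma test_rep:
  obtains \<rho> where "\<rho> \<in> hom pi1_N SL2C" "trace (\<rho> (pi1_gen Alpha)) = 1"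
    "trace (\<rho> lam) = -7" "trace (\<rho> (pi1_mult (pi1_gen Alpha) (pi1_gen Beta))) ^ 2 = -2"
proof -
  define z where "z = csqrt (-2)"
  have z2: "z^2 = -2" unfolding z_def by (rule power2_csqrt)
  \<comment> \<open>At x = 1 the equations give z^2 = -2 and y = 2/z = -z, hence l = 1 + y^2 - 6 =
    -7.\<close>
  obtain ch where ch: "ch \<in> curve_chars \<i>" "cx ch = 1" "cy ch = - z" "cz ch = z"
    by (rule curve_chars_point[of \<i> "- z" z 1])
      (use z2 in \<open>simp_all add: power2_eq_square\<close>)
  have "ch lam = -7" using curve_chars_lam[OF ch(1)] ch z2 by simp
  moreover obtain \<rho> where "\<rho> \<in> hom pi1_N SL2C" "ch = character \<rho>"
    using ch by (auto simp: curve_chars_def char_variety_def)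
  ultimately show ?thesis using ch z2 that[of \<rho>] by (simp add: character_def)
qed

text \<open>Trace 0 means A^2 = -1, so injectivity would kill the fourth power of alpha. In the test
  representation alpha has primitive sixth roots of unity as eigenvalues, and its fourth power has
  trace -1.\<close>

lemma faithful_cx:
  assumes \<rho>: "\<rho> \<in> hom pi1_N SL2C" and inj: "inj \<rho>"
  shows "trace (\<rho> (pi1_gen Alpha)) \<noteq> 0"
proof
  assume tr: "trace (\<rho> (pi1_gen Alpha)) = 0"
  let ?a = "pi1_gen Alpha"
  let ?w = "pi1_mult (pi1_mult ?a ?a) (pi1_mult ?a ?a)"
  let ?A = "\<rho> ?a"
  note h = SL2C_hom_eq[OF \<rho>]
  have "det ?A = 1" using h by simp
  then have "?A ** (mat 0 - ?A) = mat 1" using SL2_inverse[of ?A] tr by simp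
  then have "?A ** ?A ** (?A ** ?A) = mat 1"
  proof -
    obtain a b c d where A: "?A = mat2 a b c d" by (rule mat2_cases)
    have d: "d = - a" using tr by (simp add: A eq_neg_iff_add_eq_0 add.commute)
    have e: "a * a + b * c = -1" using \<open>det ?A = 1\<close> unfolding A d det_mat2 by Groebner_Basis.algebra
    show ?thesis by (simp add: A d mat_eq_mat2 e mult.commute[of c b] add.commute[of "b * c"])
  qed
  then have "\<rho> ?w = \<rho> pi1_one" using h by simp
  then have w: "?w = pi1_one" using inj by (simp add: inj_eq)
  obtain \<rho>' where \<rho>': "\<rho>' \<in> hom pi1_N SL2C" "trace (\<rho>' ?a) = 1" using test_rep .
  note h' = SL2C_hom_eq[OF \<rho>'(1)]
  have d: "det (\<rho>' ?a) = 1" using h' by simp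
  note sq = trace_square_mult[OF d]
  have "trace (\<rho>' ?w) = -1"
    using sq[of "\<rho>' ?a ** \<rho>' ?a"] sq[of "\<rho>' ?a"] sq[of "mat 1"] h' \<rho>'(2)
    by (simp add: matrix_mul_assoc)
  moreover have "trace (\<rho>' ?w) = 2" unfolding w using h' by simp
  ultimately show False by simp
qed

text \<open>With p = ab and q = ba, lambda is p q^-1. If its trace is 2, then p q^-1 and q^-1 p
  commute in the image, hence in the group; in the test representation they do not, since z^2 = -2
  is neither 0 nor l + 2 = -5.\<close>

lemma faithful_lam:
  assumes \<rho>: "\<rho> \<in> hom pi1_N SL2C" and inj: "inj \<rho>"
  shows "trace (\<rho> lam) \<noteq> 2"
proof
  assume tr: "trace (\<rho> lam) = 2"
  let ?a = "pi1_gen Alpha" and ?b = "pi1_gen Beta"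
  let ?p = "pi1_mult ?a ?b" and ?q = "pi1_mult ?b ?a"
  let ?q' = "inv\<^bsub>pi1_N\<^esub> ?q"
  let ?u = "pi1_mult (pi1_mult ?p ?q') (pi1_mult ?q' ?p)"
  let ?v = "pi1_mult (pi1_mult ?q' ?p) (pi1_mult ?p ?q')"
  have trl: "trace (\<sigma> ?p ** (mat (trace (\<sigma> ?q)) - \<sigma> ?q)) = trace (\<sigma> lam)"
    "det (\<sigma> ?p) = 1" "det (\<sigma> ?q) = 1" "trace (\<sigma> ?p) = trace (\<sigma> ?q)"
    "\<sigma> ?q' = mat (trace (\<sigma> ?q)) - \<sigma> ?q"
    if \<sigma>: "\<sigma> \<in> hom pi1_N SL2C" for \<sigma>
  proof -
    note h = SL2C_hom_eq[OF \<sigma>]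
    interpret G: group pi1_N by (rule group_pi1_N)
    have lam: "lam = pi1_mult ?p ?q'"
      using G.inv_mult_group[of ?b ?a] G.m_assoc[of "pi1_mult ?a ?b"] by (simp add: lam_def)
    have "\<sigma> lam = \<sigma> ?p ** \<sigma> ?q'" by (simp only: lam h(1) SL2C_simps)
    then show "trace (\<sigma> ?p ** (mat (trace (\<sigma> ?q)) - \<sigma> ?q)) = trace (\<sigma> lam)"
      using h by (simp add: inv_SL2C det_mul)
    show "det (\<sigma> ?p) = 1" "det (\<sigma> ?q) = 1" "trace (\<sigma> ?p) = trace (\<sigma> ?q)"
      "\<sigma> ?q' = mat (trace (\<sigma> ?q)) - \<sigma> ?q"
      using h by (simp_all add: det_mul inv_SL2C trace_mul_sym[of "\<sigma> ?a"])
  qed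
  note h = SL2C_hom_eq[OF \<rho>]
  have "\<rho> ?u = \<rho> ?v"
    using commutators_commute[of "\<rho> ?p" "\<rho> ?q"] trl[OF \<rho>] tr by (simp only: h SL2C_simps)
  then have w: "?u = ?v" using inj by (simp add: inj_eq)
  obtain \<rho>' where \<rho>': "\<rho>' \<in> hom pi1_N SL2C" "trace (\<rho>' lam) = -7" "trace (\<rho>' ?p) ^ 2 = -2"
    using test_rep .
  note h' = SL2C_hom_eq[OF \<rho>'(1)]
  have "trace (\<rho>' ?p) \<noteq> 0" using \<rho>'(3) by auto
  then have "\<rho>' ?u \<noteq> \<rho>' ?v"
    using commutators_dont_commute[of "\<rho>' ?p" "\<rho>' ?q" "trace (\<rho>' ?q)" "-7"] trl[OF \<rho>'(1)] \<rho>'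
    by (simp only: h' SL2C_simps) simp
  then show False using w by simp
qed

section \<open>The trace ring as a module\<close>

definition coeff_ring :: "complex set \<Rightarrow> bool" where
  "coeff_ring k \<longleftrightarrow> 1 \<in> k \<and> (\<forall>a\<in>k. \<forall>b\<in>k. a - b \<in> k \<and> a * b \<in> k)"

lemma coeff_ring_examples: "coeff_ring \<int>" "coeff_ring \<rat>" "coeff_ring UNIV"
  by (auto simp: coeff_ring_def)

lemma sum_8: "(\<Sum>m<8. f m) = f 0 + f (Suc 0) + f 2 + f 3 + f 4 + f 5 + f 6 + f 7"
  for f :: "nat \<Rightarrow> 'a::comm_monoid_add"
  by (simp add: eval_nat_numeral add.assoc)

lemma less_8: "m < 8 \<longleftrightarrow> m = 0 \<or> m = Suc 0 \<or> m = 2 \<or> m = 3 \<or> m = 4 \<or> m = 5 \<or> m = 6 \<or> m = 7"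
  for m :: nat
  by auto

text \<open>One locale serves all ranks: it is interpreted with k = Z, Q and C.\<close>

locale curve =
  fixes j :: complex and k :: "complex set"
  assumes j: "j * j = -1" and k: "coeff_ring k"
begin

abbreviation "X \<equiv> curve_chars j"

lemma k_simps [simp]: "1 \<in> k" "0 \<in> k"
  and k_diff: "a \<in> k \<Longrightarrow> b \<in> k \<Longrightarrow> a - b \<in> k"
  and k_mult: "a \<in> k \<Longrightarrow> b \<in> k \<Longrightarrow> a * b \<in> k"
  using k unfolding coeff_ring_def by (auto, metis diff_self)

lemma k_uminus: "a \<in> k \<Longrightarrow> - a \<in> k"
  using k_diff[of 0 a] by simp

lemma k_add: "a \<in> k \<Longrightarrow> b \<in> k \<Longrightarrow> a + b \<in> k"
  using k_diff[of a "- b"] k_uminus[of b] by simp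

lemma k_of_nat: "of_nat n \<in> k"
  by (induction n) (auto intro: k_add)

lemma k_numeral [simp]: "numeral n \<in> k"
  using k_of_nat[of "numeral n"] by simp

definition kj :: "complex set" where
  "kj = {a + j * b | a b. a \<in> k \<and> b \<in> k}"

text \<open>The subring k[2j] of k[j]; the two coincide as soon as 2 is invertible in k.\<close>

definition k2j :: "complex set" where
  "k2j = {a + 2 * j * b | a b. a \<in> k \<and> b \<in> k}"

lemma kjI: "a \<in> k \<Longrightarrow> b \<in> k \<Longrightarrow> a + j * b \<in> kj"
  by (auto simp: kj_def)

lemma k2jI: "a \<in> k \<Longrightarrow> b \<in> k \<Longrightarrow> a + 2 * j * b \<in> k2j"
  by (auto simp: k2j_def)

lemma k2j_subset: "c \<in> k2j \<Longrightarrow> c \<in> kj"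
  unfolding k2j_def
proof clarify
  fix a b assume "a \<in> k" "b \<in> k"
  then have "a + j * (2 * b) \<in> kj" by (intro kjI k_mult) auto
  then show "a + 2 * j * b \<in> kj" by (simp add: mult.assoc mult.left_commute)
qed

lemma kj_add: "c \<in> kj \<Longrightarrow> d \<in> kj \<Longrightarrow> c + d \<in> kj"
proof -
  assume "c \<in> kj" "d \<in> kj"
  then obtain a b a' b' where *: "c = a + j * b" "d = a' + j * b'" "a \<in> k" "b \<in> k" "a' \<in> k" "b' \<in> k"
    by (auto simp: kj_def)
  then have "c + d = (a + a') + j * (b + b')" by (simp add: algebra_simps)
  moreover have "(a + a') + j * (b + b') \<in> kj" using * by (intro kjI k_add)
  ultimately show ?thesis by simp
qed

lemma kj_mult: "c \<in> kj \<Longrightarrow> d \<in> kj \<Longrightarrow> c * d \<in> kj"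
proof -
  assume "c \<in> kj" "d \<in> kj"
  then obtain a b a' b' where *: "c = a + j * b" "d = a' + j * b'" "a \<in> k" "b \<in> k" "a' \<in> k" "b' \<in> k"
    by (auto simp: kj_def)
  have "c * d = (a * a' + (j * j) * (b * b')) + j * (a * b' + b * a')"
    by (simp add: * algebra_simps)
  also have "\<dots> = (a * a' - b * b') + j * (a * b' + b * a')" by (simp add: j)
  also have "\<dots> \<in> kj" using * by (intro kjI k_add k_diff k_mult)
  finally show ?thesis .
qed

lemma k2j_add: "c \<in> k2j \<Longrightarrow> d \<in> k2j \<Longrightarrow> c + d \<in> k2j"
proof -
  assume "c \<in> k2j" "d \<in> k2j"
  then obtain a b a' b' where *: "c = a + 2 * j * b" "d = a' + 2 * j * b'" "a \<in> k" "b \<in> k" "a' \<in> k" "b' \<in> k"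
    by (auto simp: k2j_def)
  then have "c + d = (a + a') + 2 * j * (b + b')" by (simp add: algebra_simps)
  moreover have "(a + a') + 2 * j * (b + b') \<in> k2j" using * by (intro k2jI k_add)
  ultimately show ?thesis by simp
qed

lemma k2j_mult: "c \<in> k2j \<Longrightarrow> d \<in> k2j \<Longrightarrow> c * d \<in> k2j"
proof -
  assume "c \<in> k2j" "d \<in> k2j"
  then obtain a b a' b' where *: "c = a + 2 * j * b" "d = a' + 2 * j * b'" "a \<in> k" "b \<in> k" "a' \<in> k" "b' \<in> k"
    by (auto simp: k2j_def)
  have "c * d = (a * a' + 4 * (j * j) * (b * b')) + 2 * j * (a * b' + b * a')"
    by (simp add: * algebra_simps)
  also have "\<dots> = (a * a' - 4 * (b * b')) + 2 * j * (a * b' + b * a')" by (simp add: j)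
  also have "\<dots> \<in> k2j" using * by (intro k2jI k_add k_diff k_mult) simp_all
  finally show ?thesis .
qed

text \<open>2 lies in the conductor of k[2j] in k[j]; the parity conditions on constant terms are
  verified through this.\<close>

lemma kj_double: "c \<in> kj \<Longrightarrow> 2 * c \<in> k2j"
  unfolding kj_def
proof clarify
  fix a b assume "a \<in> k" "b \<in> k"
  then have "2 * a + 2 * j * b \<in> k2j" by (intro k2jI k_mult) auto
  then show "2 * (a + j * b) \<in> k2j" by (simp add: algebra_simps)
qed

lemma k_subset: "a \<in> k \<Longrightarrow> a \<in> kj" "a \<in> k \<Longrightarrow> a \<in> k2j"
  using kjI[of a 0] k2jI[of a 0] by auto

lemma kj_simps [simp]: "0 \<in> kj" "1 \<in> kj" "numeral n \<in> kj" "- numeral n \<in> kj" "-1 \<in> kj" "j \<in> kj" "- j \<in> kj"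
    "0 \<in> k2j" "1 \<in> k2j"
  using kjI[of 0 1] kjI[of 0 "-1"] k_uminus[of 1] by (auto intro!: k_subset k_uminus)

definition coeffs_in :: "complex poly \<Rightarrow> bool" where
  "coeffs_in p \<longleftrightarrow> (\<forall>n. poly.coeff p n \<in> kj)"

lemma coeffs_in_simps [simp]: "coeffs_in 0" "coeffs_in 1"
  and coeffs_in_add: "coeffs_in p \<Longrightarrow> coeffs_in q \<Longrightarrow> coeffs_in (p + q)"
  and coeffs_in_smult: "c \<in> kj \<Longrightarrow> coeffs_in p \<Longrightarrow> coeffs_in (Polynomial.smult c p)"
  and coeffs_in_pCons: "coeffs_in (pCons c p) \<longleftrightarrow> c \<in> kj \<and> coeffs_in p"
  by (auto simp: coeffs_in_def kj_add kj_mult one_pCons coeff_pCons split: nat.splits)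

text \<open>Multiplication by u = l + 6.\<close>

definition u_mult :: "complex poly \<Rightarrow> complex poly" where
  "u_mult p = Polynomial.smult 6 p + pCons 0 p"

lemma poly_u_mult [simp]: "poly (u_mult p) c = (c + 6) * poly p c"
  by (simp add: u_mult_def algebra_simps)

lemma coeffs_in_u_mult: "coeffs_in p \<Longrightarrow> coeffs_in (u_mult p)"
  by (simp add: u_mult_def coeffs_in_add coeffs_in_smult coeffs_in_pCons)

lemma coeff_u_mult_0 [simp]: "poly.coeff (u_mult p) 0 = 2 * (3 * poly.coeff p 0)"
  by (simp add: u_mult_def)

definition bas :: "nat \<Rightarrow> (pi1 \<Rightarrow> complex) \<Rightarrow> complex" where
  "bas m ch = [1, cx ch * cx ch, cx ch, cx ch * (cx ch * cx ch), cy ch, cx ch * (cx ch * cy ch),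
     cz ch, cx ch * cy ch] ! m"

definition val :: "(nat \<Rightarrow> complex poly) \<Rightarrow> (pi1 \<Rightarrow> complex) \<Rightarrow> complex" where
  "val P ch = (\<Sum>m<8. poly (P m) (ch lam) * bas m ch)"

lemma bas_simps [simp]: "bas 0 ch = 1" "bas (Suc 0) ch = cx ch * cx ch" "bas 2 ch = cx ch"
  "bas 3 ch = cx ch * (cx ch * cx ch)" "bas 4 ch = cy ch" "bas 5 ch = cx ch * (cx ch * cy ch)"
  "bas 6 ch = cz ch" "bas 7 ch = cx ch * cy ch"
  by (simp_all add: bas_def)

text \<open>The span of the basis over k[j][l], which l, x, y and z multiply into
  \<open>M\<close>.\<close>

definition N :: "((pi1 \<Rightarrow> complex) \<Rightarrow> complex) \<Rightarrow> bool" where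
  "N f \<longleftrightarrow> (\<exists>P. (\<forall>m<8. coeffs_in (P m)) \<and> (\<forall>ch\<in>X. f ch = val P ch))"

text \<open>The functions that will turn out to form the k-algebra generated by the traces. The
  ideal (2, l) appears as a condition on a single number: only the constant term of
  \<open>P 0\<close> is restricted, to k[2j].\<close>

definition M :: "((pi1 \<Rightarrow> complex) \<Rightarrow> complex) \<Rightarrow> bool" where
  "M f \<longleftrightarrow> (\<exists>P. (\<forall>m<8. coeffs_in (P m)) \<and> poly.coeff (P 0) 0 \<in> k2j \<and> (\<forall>ch\<in>X. f ch = val P ch))"

lemma M_imp_N: "M f \<Longrightarrow> N f"
  by (auto simp: M_def N_def)

lemma N_cong: "N f \<Longrightarrow> (\<And>ch. ch \<in> X \<Longrightarrow> f ch = g ch) \<Longrightarrow> N g"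
  by (simp add: N_def)

lemma M_cong: "M f \<Longrightarrow> (\<And>ch. ch \<in> X \<Longrightarrow> f ch = g ch) \<Longrightarrow> M g"
  by (simp add: M_def)

lemma val_add: "val (\<lambda>m. P m + Q m) ch = val P ch + val Q ch"
  by (simp add: val_def algebra_simps sum.distrib)

lemma val_smult: "val (\<lambda>m. Polynomial.smult c (P m)) ch = c * val P ch"
  by (simp add: val_def sum_distrib_left mult.assoc)

lemma val_pCons: "val (\<lambda>m. pCons 0 (P m)) ch = ch lam * val P ch"
  by (simp add: val_def sum_distrib_left mult.assoc)

lemma N_add: "N f \<Longrightarrow> N g \<Longrightarrow> N (\<lambda>ch. f ch + g ch)"
  unfolding N_def by (metis (no_types, lifting) val_add coeffs_in_add)

lemma M_add: "M f \<Longrightarrow> M g \<Longrightarrow> M (\<lambda>ch. f ch + g ch)"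
proof -
  assume "M f" "M g"
  then obtain P Q where *: "\<forall>m<8. coeffs_in (P m)" "poly.coeff (P 0) 0 \<in> k2j" "\<forall>ch\<in>X. f ch = val P ch"
    "\<forall>m<8. coeffs_in (Q m)" "poly.coeff (Q 0) 0 \<in> k2j" "\<forall>ch\<in>X. g ch = val Q ch"
    unfolding M_def by blast
  then show ?thesis unfolding M_def
    by (intro exI[of _ "\<lambda>m. P m + Q m"]) (simp add: val_add coeffs_in_add k2j_add)
qed

lemma N_smult: "c \<in> kj \<Longrightarrow> N f \<Longrightarrow> N (\<lambda>ch. c * f ch)"
  unfolding N_def by (metis (no_types, lifting) val_smult coeffs_in_smult)

lemma M_smult:
  assumes "c \<in> k2j" "M f"
  shows "M (\<lambda>ch. c * f ch)"
proof -
  obtain P where *: "\<forall>m<8. coeffs_in (P m)" "poly.coeff (P 0) 0 \<in> k2j" "\<forall>ch\<in>X. f ch = val P ch"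
    using assms unfolding M_def by blast
  then show ?thesis unfolding M_def using assms k2j_subset
    by (intro exI[of _ "\<lambda>m. Polynomial.smult c (P m)"]) (simp add: val_smult coeffs_in_smult k2j_mult)
qed

text \<open>A factor l removes the constant term, the only one subject to a condition.\<close>

lemma M_lam:
  assumes "N f"
  shows "M (\<lambda>ch. ch lam * f ch)"
proof -
  obtain P where *: "\<forall>m<8. coeffs_in (P m)" "\<forall>ch\<in>X. f ch = val P ch"
    using assms unfolding N_def by blast
  then show ?thesis unfolding M_def
    by (intro exI[of _ "\<lambda>m. pCons 0 (P m)"]) (simp add: val_pCons coeffs_in_pCons)
qed

lemma N_poly_mult: "coeffs_in p \<Longrightarrow> N f \<Longrightarrow> N (\<lambda>ch. poly p (ch lam) * f ch)"
proof (induction p)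
  case 0
  then show ?case using N_smult[of 0 f] by simp
next
  case (pCons a p)
  then have "N (\<lambda>ch. a * f ch + ch lam * (poly p (ch lam) * f ch))"
    by (intro N_add N_smult M_lam[THEN M_imp_N]) (auto simp: coeffs_in_pCons)
  then show ?case by (rule N_cong) (simp add: algebra_simps)
qed

text \<open>The rules that reduce products of coordinates to the basis.\<close>

lemma curve_eqs:
  assumes "ch \<in> X"
  shows "cy ch * cz ch = 2 * cx ch" "cz ch * cz ch = 2 * (cx ch * cx ch) - 4"
    "cx ch * cz ch = cx ch * (cx ch * cy ch) - 2 * cy ch"
    "cx ch * cx ch * (cy ch * cy ch) = 2 * (cx ch * cx ch) + 2 * (cy ch * cy ch)"
    "ch lam = cx ch * cx ch + cy ch * cy ch - 6" "cz ch \<noteq> 0"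
proof -
  show 1: "cy ch * cz ch = 2 * cx ch" "cz ch * cz ch = 2 * (cx ch * cx ch) - 4"
    "ch lam = cx ch * cx ch + cy ch * cy ch - 6"
    using assms curve_chars_lam[OF assms] by (auto simp: curve_chars_def power2_eq_square)
  show nz: "cz ch \<noteq> 0"
  proof
    assume "cz ch = 0"
    then show False using 1 by simp
  qed
  \<comment> \<open>The remaining rules follow from the two curve equations only after
    multiplication by z, which has no zero on the curve: z = 0 would give x = 0 and then z^2 =
    -4.\<close>
  have "cz ch * (cx ch * cz ch - (cx ch * (cx ch * cy ch) - 2 * cy ch)) = 0"
    using 1 by Groebner_Basis.algebra
  then show 2: "cx ch * cz ch = cx ch * (cx ch * cy ch) - 2 * cy ch" using nz by simp
  have "cz ch * (cx ch * cx ch * (cy ch * cy ch) - (2 * (cx ch * cx ch) + 2 * (cy ch * cy ch))) = 0"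
    using 1 2 by Groebner_Basis.algebra
  then show "cx ch * cx ch * (cy ch * cy ch) = 2 * (cx ch * cx ch) + 2 * (cy ch * cy ch)"
    using nz by simp
qed

text \<open>Multiplication by the coordinates in the basis \<open>1, p, x, px, y, py, z, xy\<close> with \<open>p = x\<^sup>2\<close>; with
  \<open>u = l + 6\<close> one has \<open>p\<^sup>2 = up - 2u\<close> and \<open>y\<^sup>2 = u - p\<close>. The constant terms become even.\<close>

definition x_mult :: "(nat \<Rightarrow> complex poly) \<Rightarrow> nat \<Rightarrow> complex poly" where
  "x_mult P m = [Polynomial.smult (-2) (u_mult (P 3)), P 2 + u_mult (P 3), P 0, P 1, Polynomial.smult (-2) (P 6),
     P 6 + P 7, u_mult (P 5), P 4] ! m"

definition y_mult :: "(nat \<Rightarrow> complex poly) \<Rightarrow> nat \<Rightarrow> complex poly" where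
  "y_mult P m = [u_mult (P 4) + Polynomial.smult 2 (u_mult (P 5)), Polynomial.smult (-1) (P 4),
     Polynomial.smult 2 (P 6) + u_mult (P 7), Polynomial.smult (-1) (P 7), P 0, P 1, u_mult (P 3), P 2] ! m"

definition z_mult :: "(nat \<Rightarrow> complex poly) \<Rightarrow> nat \<Rightarrow> complex poly" where
  "z_mult P m = [Polynomial.smult (-4) (P 6), Polynomial.smult 2 (P 6) + Polynomial.smult 2 (P 7), Polynomial.smult 2 (P 4), Polynomial.smult 2 (P 5),
     Polynomial.smult (-2) (P 2) + Polynomial.smult (-2) (u_mult (P 3)), P 2 + u_mult (P 3) + Polynomial.smult (-2) (P 3),
     P 0 + u_mult (P 1), Polynomial.smult (-2) (P 1)] ! m"

lemma val_mult:
  assumes ch: "ch \<in> X"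
  shows "val (x_mult P) ch = cx ch * val P ch" "val (y_mult P) ch = cy ch * val P ch"
    "val (z_mult P) ch = cz ch * val P ch"
proof -
  note e = curve_eqs(1-4)[OF ch]
  note l = curve_eqs(5)[OF ch]
  note defs = val_def sum_8 bas_simps x_mult_def y_mult_def z_mult_def
  define c where "c m = poly (P m) (ch lam)" for m
  define x y z where "x = cx ch" "y = cy ch" "z = cz ch"
  note f = c_def[symmetric] x_y_z_def[symmetric]
  note e' = e[folded x_y_z_def] and l' = l[folded x_y_z_def]
  show "val (x_mult P) ch = cx ch * val P ch"
    unfolding defs by (simp add: f l', insert e', Groebner_Basis.algebra)
  show "val (y_mult P) ch = cy ch * val P ch"
    unfolding defs by (simp add: f l', insert e', Groebner_Basis.algebra)
  show "val (z_mult P) ch = cz ch * val P ch"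
    unfolding defs by (simp add: f l', insert e', Groebner_Basis.algebra)
qed

lemma
  assumes P: "\<forall>m<8. coeffs_in (P m)"
  shows coeffs_in_x_mult: "\<forall>m<8. coeffs_in (x_mult P m)"
    and coeffs_in_y_mult: "\<forall>m<8. coeffs_in (y_mult P m)"
    and coeffs_in_z_mult: "\<forall>m<8. coeffs_in (z_mult P m)"
proof -
  have P': "coeffs_in (P 0)" "coeffs_in (P (Suc 0))" "coeffs_in (P 2)" "coeffs_in (P 3)"
    "coeffs_in (P 4)" "coeffs_in (P 5)" "coeffs_in (P 6)" "coeffs_in (P 7)"
    using P by simp_all
  have "coeffs_in (x_mult P m) \<and> coeffs_in (y_mult P m) \<and> coeffs_in (z_mult P m)" if "m < 8" for m
    using that unfolding less_8 x_mult_def y_mult_def z_mult_def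
    by (elim disjE)
      (simp_all add: P' coeffs_in_add coeffs_in_smult coeffs_in_u_mult del: smult_minus_left)
  then show "\<forall>m<8. coeffs_in (x_mult P m)" "\<forall>m<8. coeffs_in (y_mult P m)"
    "\<forall>m<8. coeffs_in (z_mult P m)" by auto
qed

text \<open>The hypothesis is membership in the larger module \<open>N\<close>. The conclusion
  improves it to \<open>M\<close> because the new constant term is twice an element of k[j]; for y
  this uses that u is 6 at l = 0.\<close>

lemma M_coord_mult:
  assumes "N f"
  shows "M (\<lambda>ch. cx ch * f ch)" "M (\<lambda>ch. cy ch * f ch)" "M (\<lambda>ch. cz ch * f ch)"
proof -
  obtain P where P: "\<forall>m<8. coeffs_in (P m)" "\<forall>ch\<in>X. f ch = val P ch"
    using assms unfolding N_def by blast
  have c: "poly.coeff (P m) n \<in> kj" if "m < 8" for m n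
    using P(1) that by (auto simp: coeffs_in_def)
  have even: "2 * (c * d) \<in> k2j" if "c \<in> kj" "d \<in> kj" for c d
    using that by (intro kj_double kj_mult)
  have "poly.coeff (x_mult P 0) 0 = 2 * (-6 * poly.coeff (P 3) 0)" by (simp add: x_mult_def)
  then have "poly.coeff (x_mult P 0) 0 \<in> k2j" using even[OF _ c[of 3 0], of "-6"] by simp
  then show "M (\<lambda>ch. cx ch * f ch)" unfolding M_def
    using P(2) coeffs_in_x_mult[OF P(1)] by (intro exI[of _ "x_mult P"]) (simp add: val_mult)
  have "poly.coeff (y_mult P 0) 0 = 2 * (3 * poly.coeff (P 4) 0) + 2 * (6 * poly.coeff (P 5) 0)"
    by (simp add: y_mult_def)
  then have "poly.coeff (y_mult P 0) 0 \<in> k2j" using k2j_add[OF even[OF _ c[of 4 0], of 3] even[OF _ c[of 5 0], of 6]] by simp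
  then show "M (\<lambda>ch. cy ch * f ch)" unfolding M_def
    using P(2) coeffs_in_y_mult[OF P(1)] by (intro exI[of _ "y_mult P"]) (simp add: val_mult)
  have "poly.coeff (z_mult P 0) 0 = 2 * (-2 * poly.coeff (P 6) 0)" by (simp add: z_mult_def)
  then have "poly.coeff (z_mult P 0) 0 \<in> k2j" using even[OF _ c[of 6 0], of "-2"] by simp
  then show "M (\<lambda>ch. cz ch * f ch)" unfolding M_def
    using P(2) coeffs_in_z_mult[OF P(1)] by (intro exI[of _ "z_mult P"]) (simp add: val_mult)
qed

lemma M_bas_mult:
  assumes "N f" "0 < m" "m < 8"
  shows "M (\<lambda>ch. bas m ch * f ch)"
proof -
  note c = M_coord_mult and c' = M_coord_mult[OF M_imp_N]
  have 1: "M (\<lambda>ch. cx ch * f ch)" "M (\<lambda>ch. cy ch * f ch)" "M (\<lambda>ch. cz ch * f ch)"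
    using c[OF assms(1)] .
  have 2: "M (\<lambda>ch. cx ch * (cx ch * f ch))" "M (\<lambda>ch. cx ch * (cy ch * f ch))"
    using c'(1)[OF 1(1)] c'(1)[OF 1(2)] .
  have "M (\<lambda>ch. cx ch * (cx ch * (cx ch * f ch)))" "M (\<lambda>ch. cx ch * (cx ch * (cy ch * f ch)))"
    using c'(1)[OF 2(1)] c'(1)[OF 2(2)] .
  with 1 2 show ?thesis using assms(2,3) unfolding less_8 by (auto simp: mult.assoc)
qed

lemma M_0: "M (\<lambda>_. 0)"
  unfolding M_def by (rule exI[of _ "\<lambda>_. 0"]) (simp add: val_def)

lemma M_sum: "finite S \<Longrightarrow> (\<And>i. i \<in> S \<Longrightarrow> M (f i)) \<Longrightarrow> M (\<lambda>ch. \<Sum>i\<in>S. f i ch)"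
  by (induction S rule: finite_induct) (auto intro: M_0 M_add)

text \<open>Only the constant term of \<open>P 0\<close> needs g in \<open>M\<close>, and it lies in
  k[2j]. Every other part of f carries a factor l or a basis element other than 1, and both send
  \<open>N\<close> into \<open>M\<close>.\<close>

lemma M_mult:
  assumes f: "M f" and g: "M g"
  shows "M (\<lambda>ch. f ch * g ch)"
proof -
  obtain P where P: "\<forall>m<8. coeffs_in (P m)" "poly.coeff (P 0) 0 \<in> k2j" "\<forall>ch\<in>X. f ch = val P ch"
    using f unfolding M_def by blast
  have "M (\<lambda>ch. bas m ch * (poly (P m) (ch lam) * g ch))" if "m < 8" for m
  proof (cases "m = 0")
    case True
    obtain a p where p: "P 0 = pCons a p" by (cases "P 0")
    have "M (\<lambda>ch. a * g ch + ch lam * (poly p (ch lam) * g ch))"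
      using P p g by (intro M_add M_smult M_lam N_poly_mult M_imp_N[OF g])
        (auto simp: coeffs_in_pCons dest: spec[of _ 0])
    then show ?thesis using True p by (simp add: algebra_simps)
  qed (use that P in \<open>auto intro!: M_bas_mult N_poly_mult M_imp_N[OF g]\<close>)
  then have "M (\<lambda>ch. \<Sum>m<8. bas m ch * (poly (P m) (ch lam) * g ch))" by (intro M_sum) auto
  then show ?thesis
    by (rule M_cong) (simp add: P(3) val_def sum_distrib_left sum_distrib_right mult_ac)
qed

lemma M_1: "M (\<lambda>_. 1)"
  unfolding M_def by (rule exI[of _ "\<lambda>m. if m = 0 then 1 else 0"]) (simp add: val_def sum_8)

lemma M_const: "c \<in> k2j \<Longrightarrow> M (\<lambda>_. c)"
  using M_smult[OF _ M_1, of c] by simp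

lemma N_const: "c \<in> kj \<Longrightarrow> N (\<lambda>_. c)"
  using N_smult[OF _ M_imp_N[OF M_1], of c] by simp

lemma M_uminus: "M f \<Longrightarrow> M (\<lambda>ch. - f ch)"
  using M_smult[of "-1" f] k_uminus[of 1] k_subset by simp

lemma M_diff: "M f \<Longrightarrow> M g \<Longrightarrow> M (\<lambda>ch. f ch - g ch)"
  using M_add[of f "\<lambda>ch. - g ch"] M_uminus[of g] by simp

lemma M_2j: "M (\<lambda>_. 2 * j)"
  using M_const[OF k2jI[of 0 1]] by simp

text \<open>The traces involving T are j times polynomials in x, y, z without constant term, apart
  from the summand -2j in \<open>ct\<close>.\<close>

lemma M_coords: "M cx" "M cy" "M cz" "M ct" "M cta" "M ctb" "M ctab"
proof -
  note c = M_coord_mult[OF N_const]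
  have xyz: "M (\<lambda>ch. cx ch * c)" "M (\<lambda>ch. cy ch * c)" "M (\<lambda>ch. cz ch * c)" if "c \<in> kj" for c
    using c[OF that] .
  show "M cx" "M cy" "M cz" using xyz[of 1] by simp_all
  have "M (\<lambda>ch. cx ch * (cx ch * j) - 2 * j)"
    by (intro M_diff M_2j M_coord_mult M_imp_N[OF xyz(1)]) simp
  then show "M ct" by (rule M_cong) (simp add: curve_chars_def power2_eq_square algebra_simps)
  show "M cta" by (rule M_cong[OF xyz(1)[of j]]) (auto simp: curve_chars_def)
  show "M ctab" by (rule M_cong[OF xyz(3)[of j]]) (auto simp: curve_chars_def)
  have "M (\<lambda>ch. cx ch * (cz ch * j) + cy ch * (- j))"
    by (intro M_add xyz(2) M_coord_mult M_imp_N[OF xyz(3)]) simp_all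
  then show "M ctb" by (rule M_cong) (simp add: curve_chars_def algebra_simps)
qed


section \<open>All traces are polynomials in seven of them\<close>

text \<open>Choosing a representation for each character allows matrix-valued functions on the
  curve.\<close>

definition rep :: "(pi1 \<Rightarrow> complex) \<Rightarrow> pi1 \<Rightarrow> complex^2^2" where
  "rep ch = (SOME \<rho>. \<rho> \<in> hom pi1_N SL2C \<and> ch = character \<rho>)"

lemma rep:
  assumes "ch \<in> X"
  shows "rep ch \<in> hom pi1_N SL2C" "ch \<gamma> = trace (rep ch \<gamma>)"
proof -
  have "\<exists>\<rho>. \<rho> \<in> hom pi1_N SL2C \<and> ch = character \<rho>"
    using assms by (auto simp: curve_chars_def char_variety_def)
  from someI_ex[OF this] have "rep ch \<in> hom pi1_N SL2C" "ch = character (rep ch)"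
    unfolding rep_def by auto
  then show "rep ch \<in> hom pi1_N SL2C" "ch \<gamma> = trace (rep ch \<gamma>)"
    by (auto simp: character_def fun_eq_iff)
qed

abbreviation "A ch \<equiv> rep ch (pi1_gen Alpha)"
abbreviation "B ch \<equiv> rep ch (pi1_gen Beta)"
abbreviation "T ch \<equiv> rep ch (pi1_gen Tau)"

definition monomial :: "bool \<Rightarrow> bool \<Rightarrow> bool \<Rightarrow> (pi1 \<Rightarrow> complex) \<Rightarrow> complex^2^2" where
  "monomial p q r ch = (if p then A ch else mat 1) **
    ((if q then B ch else mat 1) ** (if r then T ch else mat 1))"

text \<open>The module spanned by the ordered monomials in \<open>A, B, T\<close>; it is closed under left
  multiplication because \<open>VW + WV\<close> is a combination of \<open>1, V, W\<close>.\<close>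

inductive L :: "((pi1 \<Rightarrow> complex) \<Rightarrow> complex^2^2) \<Rightarrow> bool" where
  base: "L (monomial p q r)"
| add: "L F \<Longrightarrow> L G \<Longrightarrow> L (\<lambda>ch. F ch + G ch)"
| scale: "M c \<Longrightarrow> L F \<Longrightarrow> L (\<lambda>ch. mat (c ch) ** F ch)"
| agree: "L F \<Longrightarrow> (\<forall>ch\<in>X. F ch = G ch) \<Longrightarrow> L G"

end

section \<open>Reduction of words to ordered monomials\<close>

lemma matrix_diff_rdistrib: "(A - B) ** C = A ** C - B ** C" for A :: "'a::ring_1^'n^'m"
  by (simp add: matrix_matrix_mult_def vec_eq_iff left_diff_distrib sum_subtractf)

lemma mat_uminus_mult: "mat (- c) ** F = - (mat c ** F)" for F :: "complex^2^2"
  by (rule mat2_cases[of F]) (simp add: mat_eq_mat2, simp add: vec_eq_iff forall_2)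

lemma mat_mult_left_commute: "A ** (mat c ** F) = mat c ** (A ** F)" for A F :: "complex^2^2"
  by (simp add: matrix_mul_assoc mat_commute[of c A])

lemma SL2_square_mult:
  fixes A W :: "complex^2^2"
  assumes "det A = 1"
  shows "A ** (A ** W) = mat (trace A) ** (A ** W) + mat (-1) ** W"
proof -
  obtain a b c d where A: "A = mat2 a b c d" by (rule mat2_cases)
  have "A ** A = mat (trace A) ** A + mat (-1)"
    using assms by (simp add: A mat_eq_mat2 algebra_simps)
  then show ?thesis by (simp add: matrix_mul_assoc matrix_add_rdistrib)
qed

text \<open>Polarised Cayley-Hamilton, multiplied by Z; it exchanges two letters of a word at the
  cost of shorter words.\<close>

lemma SL2_anticommute:
  fixes V W Z :: "complex^2^2"
  shows "V ** (W ** Z) = mat (-1) ** (W ** (V ** Z)) + mat (trace V) ** (W ** Z)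
    + mat (trace W) ** (V ** Z) + mat (trace (V ** W) - trace V * trace W) ** Z"
proof -
  obtain a b c d where V: "V = mat2 a b c d" by (rule mat2_cases)
  obtain p q r s where W: "W = mat2 p q r s" by (rule mat2_cases)
  have "V ** W = mat (-1) ** (W ** V) + mat (trace V) ** W + mat (trace W) ** V
      + mat (trace (V ** W) - trace V * trace W)"
    by (simp add: V W mat_eq_mat2 algebra_simps)
  then have "V ** W ** Z = (mat (-1) ** (W ** V) + mat (trace V) ** W + mat (trace W) ** V
      + mat (trace (V ** W) - trace V * trace W)) ** Z" by simp
  then show ?thesis by (simp add: matrix_mul_assoc matrix_add_rdistrib)
qed

context curve
begin

lemma det_rep: "ch \<in> X \<Longrightarrow> det (rep ch \<gamma>) = 1"
  using SL2C_hom_eq(4)[OF rep(1), of ch \<gamma>] by simp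

lemma rep_mult: "ch \<in> X \<Longrightarrow> rep ch (pi1_mult u v) = rep ch u ** rep ch v"
  using SL2C_hom_eq(1)[OF rep(1), of ch u v] by simp

definition stable :: "((pi1 \<Rightarrow> complex) \<Rightarrow> complex^2^2) \<Rightarrow> bool" where
  "stable V \<longleftrightarrow> (\<forall>F. L F \<longrightarrow> L (\<lambda>ch. V ch ** F ch))"

lemma stableD: "stable V \<Longrightarrow> L F \<Longrightarrow> L (\<lambda>ch. V ch ** F ch)"
  by (simp add: stable_def)

lemma stableI:
  assumes "\<And>p q r. L (\<lambda>ch. V ch ** monomial p q r ch)"
  shows "stable V"
  unfolding stable_def
proof (intro allI impI)
  fix F assume "L F"
  then show "L (\<lambda>ch. V ch ** F ch)"
  proof (induction rule: L.induct)
    case (add F G)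
    then show ?case using L.add by (simp add: matrix_add_ldistrib)
  next
    case (scale c F)
    then show ?case using L.scale by (simp add: mat_mult_left_commute)
  next
    case (agree F G)
    then show ?case using L.agree[of "\<lambda>ch. V ch ** F ch"] by auto
  qed (rule assms)
qed

lemma L_square:
  assumes "M (\<lambda>ch. ch \<gamma>)" "L F" "L (\<lambda>ch. rep ch \<gamma> ** F ch)"
  shows "L (\<lambda>ch. rep ch \<gamma> ** (rep ch \<gamma> ** F ch))"
proof -
  have "L (\<lambda>ch. mat (ch \<gamma>) ** (rep ch \<gamma> ** F ch) + mat (-1) ** F ch)"
    using assms by (intro L.add L.scale M_const k_subset k_uminus) simp_all
  then show ?thesis
    by (rule L.agree) (auto simp: SL2_square_mult[OF det_rep] simp flip: rep(2))
qed

lemma L_anticommute: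
  assumes "M (\<lambda>ch. ch \<gamma>)" "M (\<lambda>ch. ch \<delta>)" "M (\<lambda>ch. ch (pi1_mult \<gamma> \<delta>))" "stable (\<lambda>ch. rep ch \<delta>)"
    "L F" "L (\<lambda>ch. rep ch \<gamma> ** F ch)"
  shows "L (\<lambda>ch. rep ch \<gamma> ** (rep ch \<delta> ** F ch))"
proof -
  have "L (\<lambda>ch. mat (-1) ** (rep ch \<delta> ** (rep ch \<gamma> ** F ch)) + mat (ch \<gamma>) ** (rep ch \<delta> ** F ch)
      + mat (ch \<delta>) ** (rep ch \<gamma> ** F ch)
      + mat (ch (pi1_mult \<gamma> \<delta>) - ch \<gamma> * ch \<delta>) ** F ch)"
    using assms by (intro L.add L.scale M_const k_subset k_uminus stableD[OF assms(4)] M_diff M_mult)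
      simp_all
  then show ?thesis
    by (rule L.agree)
      (auto simp: SL2_anticommute[of "rep _ \<gamma>" "rep _ \<delta>"] rep_mult rep(2))
qed

text \<open>Stability is shown in the order A, B, T. Moving a letter behind an earlier one leaves
  the earlier one outermost, where its stability is already known.\<close>

lemma stable_A: "stable A"
proof (rule stableI)
  fix p q r
  have *: "L (\<lambda>ch. A ch ** monomial False q r ch)"
    by (rule L.agree[OF L.base[of True q r]]) (simp add: monomial_def)
  show "L (\<lambda>ch. A ch ** monomial p q r ch)"
  proof (cases p)
    case True
    have "L (\<lambda>ch. A ch ** (A ch ** monomial False q r ch))"
      by (rule L_square[OF M_coords(1) L.base *])
    then show ?thesis by (rule L.agree) (simp add: True monomial_def)
  qed (use * in simp)
qed

lemma M_cyx: "M (\<lambda>ch. ch (pi1_mult (pi1_gen Beta) (pi1_gen Alpha)))"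
  by (rule M_cong[OF M_coords(3)])
    (auto simp: rep(2) rep_mult trace_mul_sym[of "A _"] simp del: One_nat_def)

lemma stable_B: "stable B"
proof (rule stableI)
  fix p q r
  have 1: "L (\<lambda>ch. B ch ** monomial False False r ch)"
    by (rule L.agree[OF L.base[of False True r]]) (simp add: monomial_def)
  have 2: "L (\<lambda>ch. B ch ** monomial False q r ch)"
  proof (cases q)
    case True
    have "L (\<lambda>ch. B ch ** (B ch ** monomial False False r ch))"
      by (rule L_square[OF M_coords(2) L.base 1])
    then show ?thesis by (rule L.agree) (simp add: True monomial_def)
  qed (use 1 in simp)
  show "L (\<lambda>ch. B ch ** monomial p q r ch)"
  proof (cases p)
    case True
    have "L (\<lambda>ch. B ch ** (A ch ** monomial False q r ch))"
      by (rule L_anticommute[OF M_coords(2,1) M_cyx stable_A L.base 2])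
    then show ?thesis by (rule L.agree) (simp add: True monomial_def)
  qed (use 2 in simp)
qed

lemma stable_T: "stable T"
proof (rule stableI)
  fix p q r
  have 0: "L (\<lambda>ch. T ch ** monomial False False False ch)"
    by (rule L.agree[OF L.base[of False False True]]) (simp add: monomial_def)
  have 1: "L (\<lambda>ch. T ch ** monomial False False r ch)"
  proof (cases r)
    case True
    have "L (\<lambda>ch. T ch ** (T ch ** monomial False False False ch))"
      by (rule L_square[OF M_coords(4) L.base 0])
    then show ?thesis by (rule L.agree) (simp add: True monomial_def)
  qed (use 0 in simp)
  have 2: "L (\<lambda>ch. T ch ** monomial False q r ch)"
  proof (cases q)
    case True
    have "L (\<lambda>ch. T ch ** (B ch ** monomial False False r ch))"
      by (rule L_anticommute[OF M_coords(4,2,6) stable_B L.base 1])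
    then show ?thesis by (rule L.agree) (simp add: True monomial_def)
  qed (use 1 in simp)
  show "L (\<lambda>ch. T ch ** monomial p q r ch)"
  proof (cases p)
    case True
    have "L (\<lambda>ch. T ch ** (A ch ** monomial False q r ch))"
      by (rule L_anticommute[OF M_coords(4,1,5) stable_A L.base 2])
    then show ?thesis by (rule L.agree) (simp add: True monomial_def)
  qed (use 2 in simp)
qed

lemma stable_inverse:
  assumes "stable V" "M (\<lambda>ch. trace (V ch))"
  shows "stable (\<lambda>ch. mat (trace (V ch)) - V ch)"
  unfolding stable_def
proof (intro allI impI)
  fix F assume F: "L F"
  have "L (\<lambda>ch. mat (trace (V ch)) ** F ch + mat (-1) ** (V ch ** F ch))"
    using assms F by (intro L.add L.scale stableD[OF assms(1)] M_const k_subset k_uminus) simp_all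
  then show "L (\<lambda>ch. (mat (trace (V ch)) - V ch) ** F ch)"
    by (rule L.agree) (simp add: matrix_diff_rdistrib mat_uminus_mult)
qed

lemma L_word: "L (\<lambda>ch. group.word_val SL2C (\<lambda>g. rep ch (pi1_gen g)) w)"
proof -
  interpret S: group SL2C by (rule group_SL2C)
  show ?thesis
  proof (induction w)
    case Nil
    show ?case by (rule L.agree[OF L.base[of False False False]]) (simp add: monomial_def)
  next
    case (Cons l w)
    obtain g e where l: "l = (g, e)" by (cases l)
    have st: "stable (\<lambda>ch. rep ch (pi1_gen g))"
      using stable_A stable_B stable_T by (cases g) auto
    have tr: "M (\<lambda>ch. trace (rep ch (pi1_gen g)))"
      by (rule M_cong[of "\<lambda>ch. ch (pi1_gen g)"])
        (use M_coords(1,2,4) in \<open>cases g; simp\<close>, simp add: rep(2))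
    show ?case
    proof (cases e)
      case True
      then show ?thesis using stableD[OF st Cons] by (simp add: l)
    next
      case False
      have "L (\<lambda>ch. (mat (trace (rep ch (pi1_gen g))) - rep ch (pi1_gen g)) **
          S.word_val (\<lambda>g. rep ch (pi1_gen g)) w)"
        by (rule stableD[OF stable_inverse[OF st tr] Cons])
      then show ?thesis by (rule L.agree) (simp add: l False inv_SL2C det_rep)
    qed
  qed
qed

lemma trace_mat_mult: "trace (mat c ** F) = c * trace F" for F :: "complex^2^2"
  by (rule mat2_cases[of F]) (simp add: mat_eq_mat2 algebra_simps)

text \<open>The traces of the eight ordered monomials are 2 and the seven coordinates.\<close>

lemma M_trace: "L F \<Longrightarrow> M (\<lambda>ch. trace (F ch))"
proof (induction rule: L.induct)
  case (base p q r)
  have "M (\<lambda>ch. 2)" using M_const k_subset by simp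
  moreover have "M (\<lambda>ch. trace (A ch))"
    by (rule M_cong[OF M_coords(1)]) (simp add: rep(2))
  moreover have "M (\<lambda>ch. trace (B ch))"
    by (rule M_cong[OF M_coords(2)]) (simp add: rep(2))
  moreover have "M (\<lambda>ch. trace (T ch))"
    by (rule M_cong[OF M_coords(4)]) (simp add: rep(2))
  moreover have "M (\<lambda>ch. trace (A ch ** B ch))"
    by (rule M_cong[OF M_coords(3)]) (simp add: rep(2) rep_mult)
  moreover have "M (\<lambda>ch. trace (A ch ** T ch))"
    by (rule M_cong[OF M_coords(5)]) (simp add: rep(2) rep_mult trace_mul_sym[of "T _"])
  moreover have "M (\<lambda>ch. trace (B ch ** T ch))"
    by (rule M_cong[OF M_coords(6)]) (simp add: rep(2) rep_mult trace_mul_sym[of "T _"])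
  moreover have "M (\<lambda>ch. trace (A ch ** (B ch ** T ch)))"
    by (rule M_cong[OF M_coords(7)])
      (simp add: rep(2) rep_mult trace_mul_sym[of "T _" "_ ** _"], simp add: matrix_mul_assoc)
  ultimately show ?case by (cases p; cases q; cases r) (simp_all add: monomial_def)
qed (auto simp: trace_add trace_mat_mult intro: M_add M_mult M_cong)

lemma M_trace_fun: "M (\<lambda>ch. ch \<gamma>)"
proof -
  have "\<exists>w. \<gamma> = abs_pi1 w" by (induction \<gamma>) blast
  then obtain w where w: "\<gamma> = abs_pi1 w" ..
  show ?thesis
    by (rule M_cong[OF M_trace[OF L_word[of w]]])
      (simp add: rep(2) w group.pi1_hom_abs[OF group_SL2C rep(1)])
qed

end

section \<open>Subalgebras of function rings\<close>

lemma fun_ring_simps [simp]: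
  "carrier (fun_ring Y) = extensional Y"
  "f \<otimes>\<^bsub>fun_ring Y\<^esub> g = restrict (\<lambda>x. f x * g x) Y"
  "f \<oplus>\<^bsub>fun_ring Y\<^esub> g = restrict (\<lambda>x. f x + g x) Y"
  "\<one>\<^bsub>fun_ring Y\<^esub> = restrict (\<lambda>_. 1) Y" "\<zero>\<^bsub>fun_ring Y\<^esub> = restrict (\<lambda>_. 0) Y"
  by (simp_all add: fun_ring_def)

lemma fun_ring_uminus:
  assumes "f \<in> extensional Y"
  shows "\<ominus>\<^bsub>fun_ring Y\<^esub> f = restrict (\<lambda>x. - f x) Y"
proof -
  interpret cring "fun_ring Y" by (rule cring_fun_ring)
  show ?thesis by (rule minus_equality) (use assms in \<open>auto simp: extensional_def fun_eq_iff\<close>)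
qed

lemma subring_fun_ringI:
  assumes "H \<subseteq> extensional Y" "restrict (\<lambda>_. 1) Y \<in> H"
    and "\<And>f. f \<in> H \<Longrightarrow> restrict (\<lambda>x. - f x) Y \<in> H"
    and "\<And>f g. f \<in> H \<Longrightarrow> g \<in> H \<Longrightarrow> restrict (\<lambda>x. f x * g x) Y \<in> H"
    and "\<And>f g. f \<in> H \<Longrightarrow> g \<in> H \<Longrightarrow> restrict (\<lambda>x. f x + g x) Y \<in> H"
  shows "subring H (fun_ring Y)"
proof -
  interpret cring "fun_ring Y" by (rule cring_fun_ring)
  show ?thesis
  proof (rule subringI)
    fix f assume f: "f \<in> H"
    then have "\<ominus>\<^bsub>fun_ring Y\<^esub> f = restrict (\<lambda>x. - f x) Y" using assms(1) by (intro fun_ring_uminus) auto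
    with assms(3)[OF f] show "\<ominus>\<^bsub>fun_ring Y\<^esub> f \<in> H" by simp
  qed (use assms in auto)
qed

lemma restrict_eqI: "(\<And>x. x \<in> Y \<Longrightarrow> f x = g x) \<Longrightarrow> restrict f Y = restrict g Y"
  by (auto simp: restrict_def)

lemma restrict_eq_iff: "restrict f Y = restrict g Y \<longleftrightarrow> (\<forall>x\<in>Y. f x = g x)"
  by (auto simp: restrict_def fun_eq_iff)

lemma subring_fun_ring_closed:
  assumes "subring R (fun_ring Y)"
  shows "restrict f Y \<in> R \<Longrightarrow> restrict g Y \<in> R \<Longrightarrow> restrict (\<lambda>x. f x + g x) Y \<in> R"
    and "restrict f Y \<in> R \<Longrightarrow> restrict g Y \<in> R \<Longrightarrow> restrict (\<lambda>x. f x * g x) Y \<in> R"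
    and "restrict f Y \<in> R \<Longrightarrow> restrict (\<lambda>x. - f x) Y \<in> R"
    and "restrict f Y \<in> R \<Longrightarrow> restrict g Y \<in> R \<Longrightarrow> restrict (\<lambda>x. f x - g x) Y \<in> R"
    and "restrict f Y \<in> R \<Longrightarrow> restrict (\<lambda>x. f x ^ n) Y \<in> R"
    and "restrict (\<lambda>_. 0) Y \<in> R" "restrict (\<lambda>_. 1) Y \<in> R"
proof -
  note E = subringE[OF assms]
  show add: "restrict (\<lambda>x. f x + g x) Y \<in> R" if "restrict f Y \<in> R" "restrict g Y \<in> R" for f g
    using E(7)[OF that] by (simp cong: restrict_cong)
  show mult: "restrict (\<lambda>x. f x * g x) Y \<in> R" if "restrict f Y \<in> R" "restrict g Y \<in> R" for f g
    using E(6)[OF that] by (simp cong: restrict_cong)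
  show minus: "restrict (\<lambda>x. - f x) Y \<in> R" if "restrict f Y \<in> R" for f
    using E(5)[OF that] fun_ring_uminus[of "restrict f Y" Y] by (simp cong: restrict_cong)
  show "restrict (\<lambda>x. f x - g x) Y \<in> R" if "restrict f Y \<in> R" "restrict g Y \<in> R" for f g
    using add[OF that(1) minus[OF that(2)]] by simp
  show one: "restrict (\<lambda>_. 1) Y \<in> R" using E(3) by simp
  show "restrict (\<lambda>_. 0) Y \<in> R" using E(2) by simp
  show "restrict (\<lambda>x. f x ^ n) Y \<in> R" if "restrict f Y \<in> R"
  proof (induction n)
    case 0
    show ?case using one by (simp only: power_0)
  next
    case (Suc n)
    show ?case using mult[OF that Suc] by (simp only: power_Suc)
  qed
qed

lemma subalg_gen_subring:
  assumes "S \<subseteq> extensional Y"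
  shows "subring (subalg_gen c Y S) (fun_ring Y)"
proof -
  interpret cring "fun_ring Y" by (rule cring_fun_ring)
  show ?thesis unfolding subalg_gen_def
  proof (rule subring_Inter)
    have "subring (extensional Y) (fun_ring Y)" by (rule subring_fun_ringI) auto
    then have "extensional Y \<in> {A. subring A (fun_ring Y) \<and> consts_on Y c \<subseteq> A \<and> S \<subseteq> A}"
      using assms by (auto simp: consts_on_def)
    then show "{A. subring A (fun_ring Y) \<and> consts_on Y c \<subseteq> A \<and> S \<subseteq> A} \<noteq> {}" by auto
  qed auto
qed

lemma subalg_gen_least:
  "subring A (fun_ring Y) \<Longrightarrow> consts_on Y c \<subseteq> A \<Longrightarrow> S \<subseteq> A \<Longrightarrow> subalg_gen c Y S \<subseteq> A"
  by (auto simp: subalg_gen_def)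

lemma subalg_gen_contains: "consts_on Y c \<subseteq> subalg_gen c Y S" "S \<subseteq> subalg_gen c Y S"
  by (auto simp: subalg_gen_def)

lemma consts_on_Ints:
  assumes "subring A (fun_ring Y)"
  shows "consts_on Y \<int> \<subseteq> A"
proof -
  note c = subring_fun_ring_closed[OF assms]
  have nat: "restrict (\<lambda>_. of_nat n) Y \<in> A" for n
  proof (induction n)
    case 0
    show ?case using c(6) by (simp only: of_nat_0)
  next
    case (Suc n)
    show ?case using c(1)[OF c(7) Suc] by (simp only: of_nat_Suc)
  qed
  have "restrict (\<lambda>_. of_int n) Y \<in> A" for n
  proof (cases n rule: int_cases2)
    case (nonneg m)
    show ?thesis using nat[of m] by (simp only: nonneg of_int_of_nat_eq)
  next
    case (nonpos m)
    show ?thesis using c(3)[OF nat[of m]] by (simp only: nonpos of_int_minus of_int_of_nat_eq)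
  qed
  then show ?thesis by (auto simp: consts_on_def elim!: Ints_cases)
qed

lemma I_fun_extensional: "range (I_fun Y) \<subseteq> extensional Y"
  by (auto simp: I_fun_def)

text \<open>A subring contains the integer constants, so the trace ring takes the same form as the
  algebras over Q and C.\<close>

lemma trace_ring_eq: "trace_ring Y = subalg_gen \<int> Y (range (I_fun Y))"
proof -
  interpret cring "fun_ring Y" by (rule cring_fun_ring)
  have I: "range (I_fun Y) \<subseteq> carrier (fun_ring Y)" using I_fun_extensional by simp
  note E = generate_ringE[OF I HOL.refl]
  show ?thesis
  proof
    show "trace_ring Y \<subseteq> subalg_gen \<int> Y (range (I_fun Y))"
      unfolding trace_ring_def
      by (rule E(3)[OF subalg_gen_subring subalg_gen_contains(2)]) (rule I_fun_extensional)
    show "subalg_gen \<int> Y (range (I_fun Y)) \<subseteq> trace_ring Y"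
      unfolding trace_ring_def by (intro subalg_gen_least E consts_on_Ints)
  qed
qed

lemma trace_ring_Q_eq: "trace_ring_Q Y = subalg_gen \<rat> Y (range (I_fun Y))"
  unfolding trace_ring_Q_def trace_ring_eq
proof
  let ?I = "range (I_fun Y)"
  have s: "subring (subalg_gen \<rat> Y ?I) (fun_ring Y)" by (intro subalg_gen_subring I_fun_extensional)
  have "consts_on Y \<int> \<subseteq> subalg_gen \<rat> Y ?I" by (rule consts_on_Ints[OF s])
  then show "subalg_gen \<rat> Y (subalg_gen \<int> Y ?I) \<subseteq> subalg_gen \<rat> Y ?I"
    by (intro subalg_gen_least s subalg_gen_contains)
  have e: "subalg_gen \<int> Y ?I \<subseteq> extensional Y"
    using subringE(1)[OF subalg_gen_subring[OF I_fun_extensional]] by simp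
  have "?I \<subseteq> subalg_gen \<rat> Y (subalg_gen \<int> Y ?I)"
    using subalg_gen_contains(2)[of ?I \<int> Y] subalg_gen_contains(2)[of "subalg_gen \<int> Y ?I" \<rat> Y]
    by blast
  then show "subalg_gen \<rat> Y ?I \<subseteq> subalg_gen \<rat> Y (subalg_gen \<int> Y ?I)"
    by (intro subalg_gen_least subalg_gen_subring[OF e] subalg_gen_contains)
qed

context curve
begin

definition M_ring :: "((pi1 \<Rightarrow> complex) \<Rightarrow> complex) set" where
  "M_ring = {restrict f X | f. M f}"

lemma M_restrict: "M (restrict f X) \<longleftrightarrow> M f"
  using M_cong[of f "restrict f X"] M_cong[of "restrict f X" f] by auto

lemma M_ring_iff: "f \<in> M_ring \<longleftrightarrow> M f \<and> f \<in> extensional X"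
proof
  assume "M f \<and> f \<in> extensional X"
  then show "f \<in> M_ring" unfolding M_ring_def
    by (intro CollectI exI[of _ f]) (simp add: extensional_restrict)
qed (auto simp: M_ring_def M_restrict)

lemma M_ring_subring: "subring M_ring (fun_ring X)"
  by (rule subring_fun_ringI)
    (auto simp: M_ring_iff M_restrict intro: M_1 M_uminus M_mult M_add)

lemma sum_closed:
  fixes S :: "('x \<Rightarrow> complex) \<Rightarrow> bool"
  assumes "S (\<lambda>_. 0)" "\<And>f g. S f \<Longrightarrow> S g \<Longrightarrow> S (\<lambda>ch. f ch + g ch)"
  shows "finite I \<Longrightarrow> (\<And>i. i \<in> I \<Longrightarrow> S (f i)) \<Longrightarrow> S (\<lambda>ch. \<Sum>i\<in>I. f i ch)"
  by (induction I rule: finite_induct) (use assms in auto)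

text \<open>Additive generators of \<open>M\<close>: the real multiples, the imaginary multiples of
  the basis elements other than 1, and for the basis element 1 the imaginary parts j l^(n+1) and 2j,
  which reflect the ideal (2, l).\<close>

lemma M_induct [consumes 1, case_names zero add agree real imag imag_lam imag_2]:
  fixes S :: "((pi1 \<Rightarrow> complex) \<Rightarrow> complex) \<Rightarrow> bool"
  assumes M: "M f" and zero: "S (\<lambda>_. 0)"
    and add: "\<And>f g. S f \<Longrightarrow> S g \<Longrightarrow> S (\<lambda>ch. f ch + g ch)"
    and agree: "\<And>f g. S f \<Longrightarrow> (\<And>ch. ch \<in> X \<Longrightarrow> f ch = g ch) \<Longrightarrow> S g"
    and real: "\<And>a n m. a \<in> k \<Longrightarrow> m < 8 \<Longrightarrow> S (\<lambda>ch. a * ch lam ^ n * bas m ch)"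
    and imag: "\<And>b n m. b \<in> k \<Longrightarrow> 0 < m \<Longrightarrow> m < 8 \<Longrightarrow> S (\<lambda>ch. b * ch lam ^ n * (j * bas m ch))"
    and imag_lam: "\<And>b n. b \<in> k \<Longrightarrow> S (\<lambda>ch. b * ch lam ^ n * (j * ch lam))"
    and imag_2: "\<And>b. b \<in> k \<Longrightarrow> S (\<lambda>ch. b * (2 * j))"
  shows "S f"
proof -
  obtain P where P: "\<forall>m<8. coeffs_in (P m)" "poly.coeff (P 0) 0 \<in> k2j" "\<forall>ch\<in>X. f ch = val P ch"
    using M unfolding M_def by blast
  have "S (\<lambda>ch. poly.coeff (P m) n * ch lam ^ n * bas m ch)" if m: "m < 8" for m n
  proof (cases "m = 0 \<and> n = 0")
    case True
    obtain a b where ab: "a \<in> k" "b \<in> k" "poly.coeff (P 0) 0 = a + 2 * j * b"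
      using P(2) by (auto simp: k2j_def)
    show ?thesis
      by (rule agree[OF add[OF real[OF ab(1), of 0 0] imag_2[OF ab(2)]]])
        (use True ab in \<open>simp_all add: algebra_simps\<close>)
  next
    case False
    have "poly.coeff (P m) n \<in> kj" using P(1) m by (simp add: coeffs_in_def)
    then obtain a b where ab: "a \<in> k" "b \<in> k" "poly.coeff (P m) n = a + j * b"
      by (auto simp: kj_def)
    have *: "S (\<lambda>ch. b * ch lam ^ n * (j * bas m ch))"
    proof (cases "m = 0")
      case True
      then obtain n' where "n = Suc n'" using False by (cases n) auto
      then show ?thesis using imag_lam[OF ab(2), of n'] True by (simp add: algebra_simps)
    qed (use imag ab m in auto)
    show ?thesis
      by (rule agree[OF add[OF real[OF ab(1) m, of n] *]]) (simp add: ab algebra_simps)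
  qed
  then have "S (\<lambda>ch. \<Sum>m<8. \<Sum>n\<le>degree (P m). poly.coeff (P m) n * ch lam ^ n * bas m ch)"
    by (intro sum_closed[of S] zero add) auto
  then show "S f"
    by (rule agree) (simp add: P(3) val_def poly_altdef sum_distrib_right)
qed

text \<open>Minimality of \<open>M\<close>: each of its additive generators is a polynomial in
  traces.\<close>

lemma in_ring:
  assumes R: "subring R (fun_ring X)" and c: "consts_on X k \<subseteq> R" and I: "range (I_fun X) \<subseteq> R"
    and f: "M f"
  shows "restrict f X \<in> R"
proof -
  define S where "S f \<longleftrightarrow> restrict f X \<in> R" for f
  note cl = subring_fun_ring_closed[OF R, folded S_def]
  have const: "S (\<lambda>_. a)" if "a \<in> k" for a
    using c that by (auto simp: S_def consts_on_def)
  have tr: "S (\<lambda>ch. ch \<gamma>)" for \<gamma>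
    using I by (auto simp: S_def I_fun_def)
  have *: "S f \<Longrightarrow> (\<And>ch. ch \<in> X \<Longrightarrow> f ch = g ch) \<Longrightarrow> S g" for f g
    unfolding S_def by (metis restrict_eqI)
  \<comment> \<open>x (jx) - j (x^2 - 2) = 2j.\<close>
  have "S (\<lambda>ch. cx ch * cta ch - ct ch)" by (intro cl tr)
  then have 2: "S (\<lambda>ch. 2 * j)"
    by (rule *) (simp add: curve_chars_def power2_eq_square algebra_simps)
  have jx: "S (\<lambda>ch. j * cx ch)"
    by (rule *[OF tr]) (auto simp: curve_chars_def)
  have "S (\<lambda>ch. cta ch * cz ch - ctb ch)" by (intro cl tr)
  then have jy: "S (\<lambda>ch. j * cy ch)"
    by (rule *) (simp add: curve_chars_def algebra_simps)
  have jz: "S (\<lambda>ch. j * cz ch)"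
    by (rule *[OF tr]) (auto simp: curve_chars_def)
  have bas: "S (bas m)" if "m < 8" for m
  proof -
    have "S (\<lambda>ch. bas m ch)" using that unfolding less_8
      by (elim disjE; simp; intro cl tr)
    then show ?thesis .
  qed
  have jbas: "S (\<lambda>ch. j * bas m ch)" if "0 < m" "m < 8" for m
  proof -
    have "S (\<lambda>ch. (j * cx ch) * cx ch)" "S (\<lambda>ch. (j * cx ch) * (cx ch * cx ch))"
      "S (\<lambda>ch. (j * cx ch) * (cx ch * cy ch))" "S (\<lambda>ch. (j * cx ch) * cy ch)"
      by (intro cl tr jx)+
    then show ?thesis using that jx jy jz unfolding less_8 by (elim disjE) (simp_all add: mult.assoc)
  qed
  \<comment> \<open>jl = (jx) x + (jy) y - 3 (2j), the second generator of the ideal.\<close>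
  have "S (\<lambda>ch. (j * cx ch) * cx ch + (j * cy ch) * cy ch - (1 + (1 + 1)) * (2 * j))"
    by (intro cl tr jx jy 2)
  then have jl: "S (\<lambda>ch. j * ch lam)"
    by (rule *) (simp add: curve_eqs(5) algebra_simps)
  from f have "S f"
  proof (induction rule: M_induct)
    case (agree f g)
    then show ?case by (rule *)
  next
    case (real a n m)
    then show ?case by (intro cl(2) cl(5) const tr bas)
  next
    case (imag b n m)
    then show ?case by (intro cl(2) cl(5)[OF tr] const jbas)
  next
    case (imag_lam b n)
    then show ?case by (intro cl(2)[OF cl(2)[OF const cl(5)[OF tr]] jl])
  next
    case (imag_2 b)
    then show ?case by (intro cl(2)[OF const 2])
  qed (rule cl, assumption?)+
  then show ?thesis by (simp add: S_def)
qed

lemma subalg_gen_eq: "subalg_gen k X (range (I_fun X)) = M_ring"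
proof
  show "subalg_gen k X (range (I_fun X)) \<subseteq> M_ring"
    by (rule subalg_gen_least[OF M_ring_subring])
      (auto simp: consts_on_def M_ring_iff M_restrict I_fun_def intro!: M_const k_subset(2) M_trace_fun)
  show "M_ring \<subseteq> subalg_gen k X (range (I_fun X))"
    unfolding M_ring_def
    using in_ring[OF subalg_gen_subring[OF I_fun_extensional] subalg_gen_contains] by auto
qed

section \<open>The scalars as polynomials in l\<close>

definition in_k :: "complex poly \<Rightarrow> bool" where
  "in_k p \<longleftrightarrow> (\<forall>n. poly.coeff p n \<in> k)"

lemma in_k_pCons: "in_k (pCons a p) \<longleftrightarrow> a \<in> k \<and> in_k p"
  by (auto simp: in_k_def coeff_pCons split: nat.splits)

lemma in_k_0 [simp]: "in_k 0"
  by (simp add: in_k_def)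

lemma in_k_add: "in_k p \<Longrightarrow> in_k q \<Longrightarrow> in_k (p + q)"
  by (simp add: in_k_def k_add)

lemma in_k_mult: "in_k p \<Longrightarrow> in_k q \<Longrightarrow> in_k (p * q)"
proof (induction p)
  case (pCons a p)
  have "in_k (Polynomial.smult a q)" using pCons.prems by (auto simp: in_k_pCons) (simp add: in_k_def k_mult)
  then show ?case using pCons by (simp add: in_k_pCons in_k_add)
qed simp

lemma in_k_uminus: "in_k p \<Longrightarrow> in_k (- p)"
  by (simp add: in_k_def k_uminus)

lemma scalars_carrier:
  "subalg_gen k X {I_fun X lam} = {restrict (\<lambda>ch. poly p (ch lam)) X | p. in_k p}"
proof
  let ?K = "{restrict (\<lambda>ch. poly p (ch lam)) X | p. in_k p}"
  have K: "restrict (\<lambda>ch. poly p (ch lam)) X \<in> ?K" if "in_k p" for p using that by blast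
  show "subalg_gen k X {I_fun X lam} \<subseteq> ?K"
  proof (rule subalg_gen_least)
    have 1: "in_k 1" by (simp add: one_pCons in_k_pCons)
    show "subring ?K (fun_ring X)"
    proof (rule subring_fun_ringI)
      show "restrict (\<lambda>_. 1) X \<in> ?K" using K[OF 1] by simp
    next
      fix f assume "f \<in> ?K"
      then obtain p where p: "in_k p" "f = restrict (\<lambda>ch. poly p (ch lam)) X" by blast
      show "restrict (\<lambda>x. - f x) X \<in> ?K"
        using K[OF in_k_uminus[OF p(1)]] by (simp add: p cong: restrict_cong)
    next
      fix f g assume "f \<in> ?K" "g \<in> ?K"
      then obtain p q where p: "in_k p" "f = restrict (\<lambda>ch. poly p (ch lam)) X"
        and q: "in_k q" "g = restrict (\<lambda>ch. poly q (ch lam)) X" by blast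
      show "restrict (\<lambda>x. f x * g x) X \<in> ?K"
        using K[OF in_k_mult[OF p(1) q(1)]] by (simp add: p q cong: restrict_cong)
      show "restrict (\<lambda>x. f x + g x) X \<in> ?K"
        using K[OF in_k_add[OF p(1) q(1)]] by (simp add: p q cong: restrict_cong)
    qed auto
    show "consts_on X k \<subseteq> ?K"
    proof
      fix f assume "f \<in> consts_on X k"
      then obtain a where "a \<in> k" "f = restrict (\<lambda>_. a) X" by (auto simp: consts_on_def)
      then show "f \<in> ?K" using K[of "[:a:]"] by (simp add: in_k_pCons)
    qed
    show "{I_fun X lam} \<subseteq> ?K"
      using K[of "[:0, 1:]"] by (simp add: in_k_pCons I_fun_def)
  qed
  show "?K \<subseteq> subalg_gen k X {I_fun X lam}"
  proof clarify
    fix p assume "in_k p"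
    have "subring (subalg_gen k X {I_fun X lam}) (fun_ring X)"
      by (rule subalg_gen_subring) (simp add: I_fun_def)
    note cl = subring_fun_ring_closed[OF this]
    have I: "restrict (\<lambda>ch. ch lam) X \<in> subalg_gen k X {I_fun X lam}"
      using subalg_gen_contains(2)[of "{I_fun X lam}" k X] by (simp add: I_fun_def)
    have c: "restrict (\<lambda>_. a) X \<in> subalg_gen k X {I_fun X lam}" if "a \<in> k" for a
      using subalg_gen_contains(1)[of X k] that by (auto simp: consts_on_def)
    show "restrict (\<lambda>ch. poly p (ch lam)) X \<in> subalg_gen k X {I_fun X lam}"
      using \<open>in_k p\<close>
    proof (induction p)
      case 0
      show ?case using c[OF k_simps(2)] by (simp only: poly_0)
    next
      case (pCons a p)
      have ih: "restrict (\<lambda>ch. poly p (ch lam)) X \<in> subalg_gen k X {I_fun X lam}" and a: "a \<in> k"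
        using pCons by (simp_all only: in_k_pCons)
      show ?case unfolding poly_pCons by (rule cl(1)[OF c[OF a] cl(2)[OF I ih]])
    qed
  qed
qed

end

section \<open>Uniqueness of the coefficients\<close>

text \<open>The eight points of the fibre over \<open>c\<close> are \<open>(\<plusminus>x, \<plusminus>y, \<plusminus>\<plusminus>z)\<close> and the same with the two roots \<open>x\<^sup>2\<close>,
  \<open>y\<^sup>2\<close> of \<open>p\<^sup>2 - up + 2u = 0\<close> exchanged, where \<open>u = c + 6\<close>.\<close>

lemma fibre_independent:
  fixes a :: "nat \<Rightarrow> complex" and c :: complex
  assumes c: "c \<noteq> -6" "c \<noteq> 2"
    and zero: "\<And>x y z. y * z = 2 * x \<Longrightarrow> z^2 = 2 * x^2 - 4 \<Longrightarrow> x^2 + y^2 - 6 = c \<Longrightarrow>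
      a 0 + a 1 * (x * x) + a 2 * x + a 3 * (x * (x * x)) + a 4 * y + a 5 * (x * (x * y))
        + a 6 * z + a 7 * (x * y) = 0"
    and m: "m < 8"
  shows "a m = 0"
proof -
  define u where "u = c + 6"
  define s where "s = csqrt (u^2 - 8 * u)"
  have s2: "s^2 = u^2 - 8 * u" unfolding s_def by (rule power2_csqrt)
  define p1 p2 where "p1 = (u + s) / 2" and "p2 = (u - s) / 2"
  \<comment> \<open>0 and 8 are the zeros of the discriminant u^2 - 8u of p^2 - up + 2u.\<close>
  have u: "u \<noteq> 0" "u \<noteq> 8" using c by (auto simp: u_def eq_neg_iff_add_eq_0)
  have sum: "p1 + p2 = u" and dif: "p1 - p2 = s" by (simp_all add: p1_def p2_def field_simps)
  have prod: "p1 * p2 = 2 * u" using s2 by (simp add: p1_def p2_def field_simps power2_eq_square)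
  have "s \<noteq> 0"
  proof
    assume "s = 0"
    then have "u * (u - 8) = 0" using s2 by (simp add: power2_eq_square algebra_simps)
    then show False using u by simp
  qed
  then have ne: "p1 \<noteq> p2" using dif by auto
  have p0: "p1 \<noteq> 0" "p2 \<noteq> 0" using prod u by auto
  have key: "a 0 + a 1 * p = 0 \<and> a 2 + a 3 * p = 0 \<and> a 4 + a 5 * p = 0 \<and> 2 * a 6 + a 7 * q = 0"
    if pq: "p + q = u" "p * q = 2 * u" "p \<noteq> 0" "q \<noteq> 0" for p q
  proof -
    define x y z where "x = csqrt p" and "y = csqrt q" and "z = 2 * x / y"
    have x2: "x^2 = p" and y2: "y^2 = q" unfolding x_def y_def by (rule power2_csqrt)+
    have nz: "x \<noteq> 0" "y \<noteq> 0" using x2 y2 pq by auto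
    have yz: "y * z = 2 * x" using nz by (simp add: z_def)
    have "q * (z^2 - (2 * p - 4)) = 0"
    proof -
      have "q * z^2 = 4 * p" using yz x2 y2 by Groebner_Basis.algebra
      then show ?thesis using pq(1,2) by Groebner_Basis.algebra
    qed
    then have z2: "z^2 = 2 * x^2 - 4" using pq x2 by simp
    have cc: "x^2 + y^2 - 6 = c" using pq x2 y2 by (simp add: u_def)
    \<comment> \<open>The four sign changes preserve the fibre. Under them the basis splits into the
      pairs 1, p; x, px; y, py; z, xy of equal behaviour, and signed sums of the four equations
      isolate each pair.\<close>
    note e = zero[of y z x] zero[of "-y" "-z" x] zero[of y "-z" "-x"] zero[of "-y" z "-x"]
    have E: "a 0 + a 1 * (x * x) + a 2 * x + a 3 * (x * (x * x)) + a 4 * y + a 5 * (x * (x * y))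
        + a 6 * z + a 7 * (x * y) = 0"
      "a 0 + a 1 * (x * x) + a 2 * x + a 3 * (x * (x * x)) - a 4 * y - a 5 * (x * (x * y))
        - a 6 * z - a 7 * (x * y) = 0"
      "a 0 + a 1 * (x * x) - a 2 * x - a 3 * (x * (x * x)) + a 4 * y + a 5 * (x * (x * y))
        - a 6 * z - a 7 * (x * y) = 0"
      "a 0 + a 1 * (x * x) - a 2 * x - a 3 * (x * (x * x)) - a 4 * y - a 5 * (x * (x * y))
        + a 6 * z + a 7 * (x * y) = 0"
      using e yz z2 cc by simp_all
    have xx: "x * x = p" and yy: "y * y = q" using x2 y2 by (simp_all add: power2_eq_square)
    have cancel: "w = 0" if "v * (4 * w) = 0" "v \<noteq> 0" for v w :: complex
      using that by simp
    have "1 * (4 * (a 0 + a 1 * p)) = 0" using E xx by Groebner_Basis.algebra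
    moreover have "x * (4 * (a 2 + a 3 * p)) = 0" using E xx by Groebner_Basis.algebra
    moreover have "y * (4 * (a 4 + a 5 * p)) = 0" using E xx by Groebner_Basis.algebra
    moreover have "4 * (a 6 * z + a 7 * (x * y)) = 0" using E by Groebner_Basis.algebra
    then have "x * (4 * (2 * a 6 + a 7 * q)) = 0" using yz yy by Groebner_Basis.algebra
    ultimately show ?thesis using nz cancel one_neq_zero by blast
  qed
  note k1 = key[OF sum prod p0]
    and k2 = key[OF sum[unfolded add.commute[of p1]] prod[unfolded mult.commute[of p1]] p0(2,1)]
  \<comment> \<open>Each pair now gives a linear polynomial with the two distinct zeros p1 and
    p2.\<close>
  have lin: "b = 0 \<and> d = 0" if "b + d * p1 = 0" "b + d * p2 = 0" for b d :: complex
  proof -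
    have "d * (p1 - p2) = 0" using that by Groebner_Basis.algebra
    then have "d = 0" using ne by simp
    then show ?thesis using that by simp
  qed
  have "a 0 = 0 \<and> a 1 = 0" "a 2 = 0 \<and> a 3 = 0" "a 4 = 0 \<and> a 5 = 0" "2 * a 6 = 0 \<and> a 7 = 0"
    using k1 k2 lin[of "a 0" "a 1"] lin[of "a 2" "a 3"] lin[of "a 4" "a 5"] lin[of "2 * a 6" "a 7"]
    by blast+
  then show ?thesis using m unfolding less_8 by auto
qed

context curve
begin

text \<open>Over all but two values of l the fibre forces each coefficient polynomial to vanish
  there, so it has infinitely many zeros.\<close>

lemma val_eq_0_imp:
  assumes "\<forall>ch\<in>X. val P ch = 0" "m < 8"
  shows "P m = 0"
proof (rule ccontr)
  assume "P m \<noteq> 0"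
  then have "finite {c. poly (P m) c = 0}" by (rule poly_roots_finite)
  moreover have "UNIV - {-6, 2} \<subseteq> {c. poly (P m) c = 0}"
  proof
    fix c :: complex assume c: "c \<in> UNIV - {-6, 2}"
    have "poly (P m) c = 0"
    proof (rule fibre_independent[where a = "\<lambda>m. poly (P m) c", OF _ _ _ assms(2)])
      fix x y z :: complex
      assume *: "y * z = 2 * x" "z^2 = 2 * x^2 - 4" "x^2 + y^2 - 6 = c"
      obtain ch where ch: "ch \<in> X" "cx ch = x" "cy ch = y" "cz ch = z"
        using curve_chars_point[OF j *(1,2)] .
      have "ch lam = c" using curve_chars_lam[OF ch(1)] ch * by simp
      then show "poly (P 0) c + poly (P 1) c * (x * x) + poly (P 2) c * x + poly (P 3) c * (x * (x * x))
          + poly (P 4) c * y + poly (P 5) c * (x * (x * y)) + poly (P 6) c * z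
          + poly (P 7) c * (x * y) = 0"
        using assms(1) ch unfolding val_def sum_8 by (auto dest!: bspec[of _ _ ch])
    qed (use c in auto)
    then show "c \<in> {c. poly (P m) c = 0}" by simp
  qed
  moreover have "infinite (UNIV - {-6, 2 :: complex})"
    by (simp add: infinite_UNIV_char_0)
  ultimately show False using finite_subset by blast
qed

lemma val_eqD:
  assumes "\<forall>ch\<in>X. val P ch = val Q ch" "m < 8"
  shows "P m = Q m"
proof -
  have "val (\<lambda>m. P m - Q m) ch = val P ch - val Q ch" for ch
    by (simp add: val_def algebra_simps sum_subtractf)
  then show ?thesis using val_eq_0_imp[of "\<lambda>m. P m - Q m" m] assms by simp
qed

lemma X_nonempty: "X \<noteq> {}"
proof -
  define y where "y = csqrt (-2)"
  have y: "y^2 = -2" unfolding y_def by (rule power2_csqrt)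
  obtain ch where "ch \<in> X"
    by (rule curve_chars_point[OF j, of "-y" y 1]) (use y in \<open>auto simp: power2_eq_square\<close>)
  then show ?thesis by auto
qed


section \<open>Bounds for the rank\<close>

abbreviation "scal_ring \<equiv> scalars k X lam"
abbreviation "trace_mod \<equiv> as_module X M_ring"

lemma scal_ring_simps [simp]:
  "carrier scal_ring = {restrict (\<lambda>ch. poly p (ch lam)) X | p. in_k p}"
  "\<zero>\<^bsub>scal_ring\<^esub> = restrict (\<lambda>_. 0) X"
  by (simp_all add: scalars_def scalars_carrier)

lemma trace_mod_simps [simp]:
  "carrier trace_mod = M_ring" "f \<oplus>\<^bsub>trace_mod\<^esub> g = restrict (\<lambda>ch. f ch + g ch) X"
  "\<zero>\<^bsub>trace_mod\<^esub> = restrict (\<lambda>_. 0) X" "r \<odot>\<^bsub>trace_mod\<^esub> f = restrict (\<lambda>ch. r ch * f ch) X"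
  by (simp_all add: as_module_def)

lemma module_M: "module scal_ring trace_mod"
  unfolding scalars_def
proof (rule module_as_module[OF _ M_ring_subring])
  show "subring (subalg_gen k X {I_fun X lam}) (fun_ring X)"
    by (rule subalg_gen_subring) (simp add: I_fun_def)
  show "subalg_gen k X {I_fun X lam} \<subseteq> M_ring"
    unfolding subalg_gen_eq[symmetric]
    by (intro subalg_gen_least subalg_gen_subring I_fun_extensional subalg_gen_contains)
      (use subalg_gen_contains(2)[of "range (I_fun X)" k X] in auto)
qed

lemma span_least:
  assumes "S \<subseteq> N'" "N' \<subseteq> M_ring" "restrict (\<lambda>_. 0) X \<in> N'"
    and "\<And>f g. f \<in> N' \<Longrightarrow> g \<in> N' \<Longrightarrow> restrict (\<lambda>ch. f ch + g ch) X \<in> N'"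
    and "\<And>p f. in_k p \<Longrightarrow> f \<in> N' \<Longrightarrow> restrict (\<lambda>ch. poly p (ch lam) * f ch) X \<in> N'"
  shows "module.span scal_ring trace_mod S \<subseteq> N'"
proof -
  interpret M: module scal_ring trace_mod by (rule module_M)
  have "submodule scal_ring N' trace_mod"
    using assms(2-5) by (intro submodule.intro module_M) (auto cong: restrict_cong)
  then show ?thesis by (rule M.span_is_subset[OF assms(1)])
qed

lemma span_closed:
  assumes "S \<subseteq> M_ring"
  defines "N' \<equiv> module.span scal_ring trace_mod S"
  shows "S \<subseteq> N'" "N' \<subseteq> M_ring" "restrict (\<lambda>_. 0) X \<in> N'"
    and "\<And>f g. f \<in> N' \<Longrightarrow> g \<in> N' \<Longrightarrow> restrict (\<lambda>ch. f ch + g ch) X \<in> N'"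
    and "\<And>p f. in_k p \<Longrightarrow> f \<in> N' \<Longrightarrow> restrict (\<lambda>ch. poly p (ch lam) * f ch) X \<in> N'"
proof -
  interpret M: module scal_ring trace_mod by (rule module_M)
  have S: "S \<subseteq> carrier trace_mod" using assms by simp
  show "S \<subseteq> N'" unfolding N'_def by (rule M.in_own_span[OF S])
  interpret N: submodule scal_ring N' trace_mod
    unfolding N'_def by (rule M.span_is_submodule[OF S])
  show "N' \<subseteq> M_ring" using N.subset by simp
  show "restrict (\<lambda>_. 0) X \<in> N'" using N.zero_closed by simp
  show "restrict (\<lambda>ch. f ch + g ch) X \<in> N'" if "f \<in> N'" "g \<in> N'" for f g
    using N.m_closed[OF that] by simp
  show "restrict (\<lambda>ch. poly p (ch lam) * f ch) X \<in> N'" if "in_k p" "f \<in> N'" for p f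
    using N.smult_closed[OF _ that(2), of "restrict (\<lambda>ch. poly p (ch lam)) X"] that(1)
    by (auto cong: restrict_cong)
qed

text \<open>Hitting the generators of \<open>M_induct\<close> is enough, since powers of l and
  constants from k are scalars.\<close>

lemma gen_rank_le:
  fixes g :: "nat \<Rightarrow> (pi1 \<Rightarrow> complex) \<Rightarrow> complex" and n :: nat
  assumes g: "\<And>i. i < n \<Longrightarrow> M (g i)"
  defines "multiple f \<equiv> \<exists>i<n. \<exists>p. in_k p \<and> (\<forall>ch\<in>X. f ch = poly p (ch lam) * g i ch)"
  assumes real: "\<And>m. m < 8 \<Longrightarrow> multiple (bas m)"
    and imag: "\<And>m. 0 < m \<Longrightarrow> m < 8 \<Longrightarrow> multiple (\<lambda>ch. j * bas m ch)"
    and imag_0: "multiple (\<lambda>ch. j * ch lam)" "multiple (\<lambda>ch. 2 * j)"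
  shows "gen_rank scal_ring trace_mod \<le> enat n"
proof -
  define S where "S = (\<lambda>i. restrict (g i) X) ` {..<n}"
  have S: "S \<subseteq> M_ring" using g by (auto simp: S_def M_ring_def)
  define N' where "N' = module.span scal_ring trace_mod S"
  note cl = span_closed[OF S, folded N'_def]
  define Q where "Q f \<longleftrightarrow> restrict f X \<in> N'" for f
  have add: "Q (\<lambda>ch. f ch + h ch)" if "Q f" "Q h" for f h
    using cl(4)[of "restrict f X" "restrict h X"] that by (simp add: Q_def cong: restrict_cong)
  have scale: "Q (\<lambda>ch. poly p (ch lam) * f ch)" if "in_k p" "Q f" for p f
    using cl(5)[of p "restrict f X"] that by (simp add: Q_def cong: restrict_cong)
  have agr: "Q h" if "Q f" "\<And>ch. ch \<in> X \<Longrightarrow> f ch = h ch" for f h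
    using restrict_eqI[of X f h, OF that(2)] that(1) by (simp add: Q_def)
  have Qg: "Q (g i)" if "i < n" for i using cl(1) that by (auto simp: S_def Q_def)
  have mult: "Q f" if "multiple f" for f
    using that unfolding multiple_def by (auto intro: agr[OF scale[OF _ Qg]])
  have monom: "Q (\<lambda>ch. a * ch lam ^ i * f ch)" if "a \<in> k" "multiple f" for a i f
  proof (rule agr[OF scale[OF _ mult[OF that(2)]]])
    show "in_k (Polynomial.monom a i)" using that by (simp add: in_k_def)
  qed (simp add: poly_monom)
  have "Q f" if "M f" for f
    using that
  proof (induction rule: M_induct)
    case zero
    show ?case using cl(3) by (simp add: Q_def)
  next
    case (agree f h)
    then show ?case by (rule agr)
  next
    case (imag_2 b)
    show ?case using monom[OF imag_2 imag_0(2), of 0] by simp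
  qed (intro add monom real imag imag_0; assumption)+
  then have "N' = M_ring" using cl(2) by (auto simp: Q_def M_ring_def)
  moreover have "card S \<le> n" unfolding S_def using card_image_le[of "{..<n}"] by simp
  ultimately show ?thesis unfolding gen_rank_def using S
    by (intro INF_lower2[of S]) (auto simp: N'_def S_def)
qed

end

section \<open>Lower bounds for the number of generators\<close>

lemma sum_fun_apply: "(\<Sum>x\<in>S. F x) i = (\<Sum>x\<in>S. F x i)" for F :: "'b \<Rightarrow> 'i \<Rightarrow> 'f::comm_monoid_add"
  by (induction S rule: infinite_finite_induct) auto

text \<open>The hypothesis puts the unit vectors indexed by I into the linear span of W. It speaks
  of every V closed under the operations, so that it can be used for a preimage of V without
  reference to a vector space structure.\<close>

lemma delta_card_le:
  fixes W :: "('i \<Rightarrow> 'f::field) set"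
  assumes W: "finite W" and I: "finite I"
    and span: "\<And>V i. i \<in> I \<Longrightarrow> W \<subseteq> V \<Longrightarrow> 0 \<in> V \<Longrightarrow> (\<And>v w. v \<in> V \<Longrightarrow> w \<in> V \<Longrightarrow> v + w \<in> V) \<Longrightarrow>
      (\<And>c v. v \<in> V \<Longrightarrow> (\<lambda>i. c * v i) \<in> V) \<Longrightarrow> (\<lambda>i'. if i' = i then 1 else 0) \<in> V"
  shows "card I \<le> card W"
proof -
  interpret V: vector_space "\<lambda>(c::'f) (v::'i \<Rightarrow> 'f) i. c * v i"
    by unfold_locales (auto simp: fun_eq_iff algebra_simps)
  define d where "d = (\<lambda>i i'::'i. if i' = i then 1 else 0 :: 'f)"
  have inj: "inj_on d I" by (rule inj_onI) (metis d_def zero_neq_one)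
  have "V.independent (d ` I)"
  proof (rule V.independent_if_scalars_zero)
    fix f x assume sum: "(\<Sum>x\<in>d ` I. (\<lambda>i. f x * x i)) = 0" and "x \<in> d ` I"
    then obtain i where i: "i \<in> I" "x = d i" by auto
    have "0 = (\<Sum>x\<in>d ` I. (\<lambda>i. f x * x i)) i" by (simp add: sum)
    also have "\<dots> = (\<Sum>i'\<in>I. f (d i') * d i' i)"
      by (simp add: sum.reindex[OF inj] sum_fun_apply)
    also have "\<dots> = (\<Sum>i'\<in>I. if i' = i then f (d i) else 0)"
      by (rule sum.cong) (auto simp: d_def)
    also have "\<dots> = f x" using i I by simp
    finally show "f x = 0" by simp
  qed (use I in auto)
  moreover have "d ` I \<subseteq> V.span W"
    unfolding d_def
    by (auto intro!: span V.span_superset V.span_add V.span_scale V.span_zero)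
  ultimately have "card (d ` I) \<le> card W"
    using V.independent_span_bound[OF W] by blast
  then show ?thesis by (simp add: card_image[OF inj])
qed

context curve
begin

definition G :: "(nat \<Rightarrow> complex poly) \<Rightarrow> bool" where
  "G P \<longleftrightarrow> (\<forall>m<8. coeffs_in (P m)) \<and> poly.coeff (P 0) 0 \<in> k2j"

lemma M_iff_G: "M f \<longleftrightarrow> (\<exists>P. G P \<and> (\<forall>ch\<in>X. f ch = val P ch))"
  by (auto simp: M_def G_def)

lemma coeffs_in_mult: "in_k p \<Longrightarrow> coeffs_in q \<Longrightarrow> coeffs_in (p * q)"
proof (induction p)
  case (pCons a p)
  then show ?case by (auto simp: in_k_pCons coeffs_in_pCons intro!: coeffs_in_add coeffs_in_smult k_subset)
qed simp

lemma G_add: "G P \<Longrightarrow> G Q \<Longrightarrow> G (\<lambda>m. P m + Q m)"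
  by (simp add: G_def coeffs_in_add k2j_add)

lemma G_mult: "in_k p \<Longrightarrow> G P \<Longrightarrow> G (\<lambda>m. p * P m)"
  by (simp add: G_def coeffs_in_mult coeff_mult_0 k2j_mult k_subset in_k_def)

lemma val_mult_left: "val (\<lambda>m. p * P m) ch = poly p (ch lam) * val P ch"
  by (simp add: val_def sum_distrib_left mult.assoc)

text \<open>\<phi> induces a map from the module to a vector space, semilinear along h, whose image
  contains n unit vectors; the images of generators therefore span at least n dimensions. Being
  defined on coefficient families, it descends to functions by uniqueness of coefficients and
  \<open>cong\<close>.\<close>

lemma gen_rank_ge:
  fixes \<phi> :: "(nat \<Rightarrow> complex poly) \<Rightarrow> nat \<Rightarrow> 'f::field" and h :: "complex poly \<Rightarrow> 'f"
    and n :: nat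
  assumes zero: "\<phi> (\<lambda>_. 0) = 0"
    and add: "\<And>P Q. G P \<Longrightarrow> G Q \<Longrightarrow> \<phi> (\<lambda>m. P m + Q m) = \<phi> P + \<phi> Q"
    and mult: "\<And>p P. in_k p \<Longrightarrow> G P \<Longrightarrow> \<phi> (\<lambda>m. p * P m) = (\<lambda>i. h p * \<phi> P i)"
    and cong: "\<And>P Q. (\<And>m. m < 8 \<Longrightarrow> P m = Q m) \<Longrightarrow> \<phi> P = \<phi> Q"
    and delta: "\<And>i. i < n \<Longrightarrow> \<exists>U. G U \<and> \<phi> U = (\<lambda>i'. if i' = i then 1 else 0)"
  shows "enat n \<le> gen_rank scal_ring trace_mod"
  unfolding gen_rank_def
proof (rule INF_greatest, clarsimp)
  fix S assume fin: "finite S" and S: "S \<subseteq> M_ring" and sp: "module.span scal_ring trace_mod S = M_ring"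
  have "\<forall>s\<in>S. \<exists>P. G P \<and> s = restrict (val P) X"
  proof
    fix s assume "s \<in> S"
    then obtain f P where "s = restrict f X" "G P" "\<forall>ch\<in>X. f ch = val P ch"
      using S unfolding M_ring_def M_iff_G by blast
    then show "\<exists>P. G P \<and> s = restrict (val P) X" using restrict_eqI[of X f "val P"] by auto
  qed
  then obtain Ps where Ps: "\<And>s. s \<in> S \<Longrightarrow> G (Ps s) \<and> s = restrict (val (Ps s)) X" by metis
  have "card {..<n} \<le> card ((\<lambda>s. \<phi> (Ps s)) ` S)"
  proof (rule delta_card_le)
    fix V i
    assume i: "i \<in> {..<n}" and V: "(\<lambda>s. \<phi> (Ps s)) ` S \<subseteq> V" "0 \<in> V"
      "\<And>v w. v \<in> V \<Longrightarrow> w \<in> V \<Longrightarrow> v + w \<in> V" "\<And>c v. v \<in> V \<Longrightarrow> (\<lambda>i. c * v i) \<in> V"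
    \<comment> \<open>The preimage of V is a submodule containing S, hence everything.\<close>
    define N' where "N' = {restrict (val P) X | P. G P \<and> \<phi> P \<in> V}"
    have N': "restrict (val P) X \<in> N'" if "G P" "\<phi> P \<in> V" for P using that by (auto simp: N'_def)
    have "module.span scal_ring trace_mod S \<subseteq> N'"
    proof (rule span_least)
      show "S \<subseteq> N'" using Ps V(1) by (fastforce simp: N'_def)
      show "N' \<subseteq> M_ring" by (auto simp: N'_def M_ring_def M_iff_G)
      have "G (\<lambda>_. 0)" by (simp add: G_def)
      moreover have "val (\<lambda>_. 0) = (\<lambda>_. 0)" by (simp add: fun_eq_iff val_def)
      ultimately show "restrict (\<lambda>_. 0) X \<in> N'" using N'[of "\<lambda>_. 0"] V(2) zero by metis
    next
      fix f g assume "f \<in> N'" "g \<in> N'"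
      then obtain P Q where PQ: "G P" "\<phi> P \<in> V" "f = restrict (val P) X"
        "G Q" "\<phi> Q \<in> V" "g = restrict (val Q) X" by (auto simp: N'_def)
      have "restrict (\<lambda>ch. f ch + g ch) X = restrict (val (\<lambda>m. P m + Q m)) X"
        by (rule restrict_eqI) (simp add: PQ val_add)
      then show "restrict (\<lambda>ch. f ch + g ch) X \<in> N'"
        using N'[OF G_add[OF PQ(1,4)]] V(3)[OF PQ(2,5)] add PQ by simp
    next
      fix p f assume p: "in_k p" and "f \<in> N'"
      then obtain P where P: "G P" "\<phi> P \<in> V" "f = restrict (val P) X" by (auto simp: N'_def)
      have "restrict (\<lambda>ch. poly p (ch lam) * f ch) X = restrict (val (\<lambda>m. p * P m)) X"
        by (rule restrict_eqI) (simp add: P val_mult_left)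
      then show "restrict (\<lambda>ch. poly p (ch lam) * f ch) X \<in> N'"
        using N'[OF G_mult[OF p P(1)]] V(4)[OF P(2)] mult p P by simp
    qed
    moreover obtain U where U: "G U" "\<phi> U = (\<lambda>i'. if i' = i then 1 else 0)"
      using delta i by auto
    moreover have "restrict (val U) X \<in> M_ring" using U by (auto simp: M_ring_def M_iff_G)
    ultimately have "restrict (val U) X \<in> N'" using sp by auto
    then obtain P where P: "\<phi> P \<in> V" "\<forall>ch\<in>X. val U ch = val P ch"
      by (auto simp: N'_def restrict_eq_iff)
    have "\<phi> U = \<phi> P" by (intro cong val_eqD P(2))
    then show "(\<lambda>i'. if i' = i then 1 else 0) \<in> V" using P U by simp
  qed (use fin in auto)
  also have "\<dots> \<le> card S" by (rule card_image_le[OF fin])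
  finally show "n \<le> card S" by simp
qed

section \<open>Torsion and freeness\<close>

lemma torsion_free_M: "torsion_free_module scal_ring trace_mod"
  unfolding torsion_free_module_def
proof (intro ballI impI)
  fix r f assume "r \<in> carrier scal_ring" "f \<in> carrier trace_mod"
    and rf: "r \<odot>\<^bsub>trace_mod\<^esub> f = \<zero>\<^bsub>trace_mod\<^esub>"
  then obtain p P where p: "r = restrict (\<lambda>ch. poly p (ch lam)) X"
    and P: "G P" "\<forall>ch\<in>X. f ch = val P ch" and f: "f \<in> extensional X"
    by (auto simp: M_ring_iff M_iff_G)
  have "\<forall>ch\<in>X. val (\<lambda>m. p * P m) ch = 0"
    using rf by (simp add: restrict_eq_iff p P val_mult_left)
  then have "p * P m = 0" if "m < 8" for m using val_eq_0_imp that by blast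
  then have "p = 0 \<or> (\<forall>m<8. P m = 0)" by auto
  then show "r = \<zero>\<^bsub>scal_ring\<^esub> \<or> f = \<zero>\<^bsub>trace_mod\<^esub>"
  proof
    assume "\<forall>m<8. P m = 0"
    then have "\<forall>ch\<in>X. f ch = 0" using P by (simp add: val_def)
    then have "f = restrict (\<lambda>_. 0) X" using f by (metis extensional_restrict restrict_eqI)
    then show ?thesis by simp
  qed (simp add: p)
qed

text \<open>Generators of the free submodule in which the ideal (2, l) is replaced by (2); index 8
  carries 2j instead of j.\<close>

definition sixteen :: "nat \<Rightarrow> (pi1 \<Rightarrow> complex) \<Rightarrow> complex" where
  "sixteen i ch = (if i < 8 then bas i ch else if i = 8 then 2 * j else j * bas (i - 8) ch)"

lemma M_bas: "m < 8 \<Longrightarrow> M (bas m)" "0 < m \<Longrightarrow> m < 8 \<Longrightarrow> M (\<lambda>ch. j * bas m ch)"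
proof -
  have 1: "M (\<lambda>ch. bas m ch * c)" if "0 < m" "m < 8" "c \<in> kj" for c
    using that by (intro M_bas_mult N_const)
  show "M (bas m)" if "m < 8"
    using 1[of 1] M_1 that by (cases "m = 0") (simp_all add: bas_def[abs_def])
  show "M (\<lambda>ch. j * bas m ch)" if "0 < m" "m < 8"
    using 1[of j] that by (simp add: mult.commute)
qed

lemma M_sixteen: "i < 16 \<Longrightarrow> M (sixteen i)"
  using M_bas(1)[of i] M_bas(2)[of "i - 8"] M_2j
  by (cases "i < 8"; cases "i = 8") (simp_all add: sixteen_def[abs_def])

text \<open>The only generators of \<open>M\<close> that may be missing from the span are the l^n
  (jl), and 2 (jl) = l (2j).\<close>

lemma double_sixteen:
  assumes "M f"
  shows "\<exists>c. (\<forall>i. in_k (c i)) \<and> (\<forall>ch\<in>X. 2 * f ch = (\<Sum>i<16. poly (c i) (ch lam) * sixteen i ch))"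
proof -
  define Q where "Q f \<longleftrightarrow>
    (\<exists>c. (\<forall>i. in_k (c i)) \<and> (\<forall>ch\<in>X. 2 * f ch = (\<Sum>i<16. poly (c i) (ch lam) * sixteen i ch))) " for f
  have single: "Q f" if "i < 16" "in_k p" "\<And>ch. ch \<in> X \<Longrightarrow> 2 * f ch = poly p (ch lam) * sixteen i ch"
    for f i p
    unfolding Q_def
  proof (intro exI[of _ "\<lambda>i'. if i' = i then p else 0"] conjI ballI)
    fix ch assume "ch \<in> X"
    have "(\<Sum>i'<16. poly (if i' = i then p else 0) (ch lam) * sixteen i' ch)
        = (\<Sum>i'<16. if i' = i then poly p (ch lam) * sixteen i ch else 0)"
      by (rule sum.cong) auto
    then show "2 * f ch = (\<Sum>i'<16. poly (if i' = i then p else 0) (ch lam) * sixteen i' ch)"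
      using that \<open>ch \<in> X\<close> by simp
  qed (use that in auto)
  have monom: "in_k (Polynomial.monom a n)" if "a \<in> k" for a n using that by (simp add: in_k_def)
  from assms have "Q f"
  proof (induction rule: M_induct)
    case zero
    show ?case by (rule single[of 0 0]) auto
  next
    case (add f g)
    then obtain c d where "\<forall>i. in_k (c i)" "\<forall>i. in_k (d i)"
      "\<forall>ch\<in>X. 2 * f ch = (\<Sum>i<16. poly (c i) (ch lam) * sixteen i ch)"
      "\<forall>ch\<in>X. 2 * g ch = (\<Sum>i<16. poly (d i) (ch lam) * sixteen i ch)"
      unfolding Q_def by blast
    then show ?case unfolding Q_def
      by (intro exI[of _ "\<lambda>i. c i + d i"]) (simp add: in_k_add algebra_simps sum.distrib)
  next
    case (agree f g)
    then show ?case by (simp add: Q_def)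
  next
    case (real a n m)
    then show ?case
      by (intro single[of m "Polynomial.monom (2 * a) n"] monom)
        (auto simp: poly_monom sixteen_def k_mult)
  next
    case (imag b n m)
    then show ?case
      by (intro single[of "m + 8" "Polynomial.monom (2 * b) n"] monom)
        (auto simp: poly_monom sixteen_def k_mult)
  next
    case (imag_lam b n)
    then show ?case
      by (intro single[of 8 "Polynomial.monom b (Suc n)"] monom)
        (auto simp: poly_monom sixteen_def algebra_simps)
  next
    case (imag_2 b)
    then show ?case
      by (intro single[of 8 "Polynomial.monom (2 * b) 0"] monom)
        (auto simp: poly_monom sixteen_def k_mult)
  qed
  then show ?thesis by (simp add: Q_def)
qed

lemma lincomb_eval:
  assumes "finite S" "S \<subseteq> M_ring" "a \<in> S \<rightarrow> carrier scal_ring"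
  shows "module.lincomb trace_mod a S = restrict (\<lambda>ch. \<Sum>v\<in>S. a v ch * v ch) X"
proof -
  interpret m: module scal_ring trace_mod by (rule module_M)
  define F where "F v = a v \<odot>\<^bsub>trace_mod\<^esub> v" for v
  have cl: "F v \<in> carrier trace_mod" if "v \<in> S" for v
    unfolding F_def using assms that by (intro m.smult_closed) auto
  have F: "F v ch = a v ch * v ch" if "ch \<in> X" for v ch
    using that by (simp add: F_def)
  have "finsum trace_mod F S' = restrict (\<lambda>ch. \<Sum>v\<in>S'. a v ch * v ch) X"
    if "finite S'" "S' \<subseteq> S" for S'
    using that
  proof (induction S')
    case (insert w S')
    have "finsum trace_mod F (insert w S') = F w \<oplus>\<^bsub>trace_mod\<^esub> finsum trace_mod F S'"
      using insert cl by (intro m.finsum_insert) auto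
    also have "\<dots> = restrict (\<lambda>ch. F w ch + finsum trace_mod F S' ch) X"
      by (simp only: trace_mod_simps)
    also have "finsum trace_mod F S' = restrict (\<lambda>ch. \<Sum>v\<in>S'. a v ch * v ch) X"
      using insert by blast
    finally show ?case using insert(1,2) by (auto intro!: restrict_eqI simp: F)
  qed (use m.finsum_empty in simp)
  then have "finsum trace_mod F S = restrict (\<lambda>ch. \<Sum>v\<in>S. a v ch * v ch) X" using assms(1) by simp
  then show ?thesis unfolding m.lincomb_def F_def .
qed

text \<open>Let d express the sixteen elements through the basis Y, and let c express 2b, for b in
  Y, through the sixteen. Independence gives cd = 2 as matrices of functions of l. At one point of
  the curve this is an identity of complex matrices, and there the sixteen rows of d span all
  functions on Y.\<close>

lemma basis_card_le:
  assumes Y: "Y \<subseteq> M_ring" and span: "module.span scal_ring trace_mod Y = M_ring"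
    and ind: "\<not> module.lin_dep scal_ring trace_mod Y"
  shows "finite Y" "card Y \<le> 16"
proof -
  interpret m: module scal_ring trace_mod by (rule module_M)
  define K where "K = carrier scal_ring"
  have K: "subring K (fun_ring X)"
  proof -
    have "K = subalg_gen k X {I_fun X lam}" by (simp only: K_def scal_ring_simps scalars_carrier)
    then show ?thesis using subalg_gen_subring[of "{I_fun X lam}" X k] by (simp add: I_fun_def)
  qed
  note Kc = subring_fun_ring_closed[OF this]
  have K_sum: "finite I \<Longrightarrow> (\<And>i. i \<in> I \<Longrightarrow> restrict (f i) X \<in> K) \<Longrightarrow>
      restrict (\<lambda>ch. \<Sum>i\<in>I. f i ch) X \<in> K" for I :: "nat set" and f
    by (rule sum_closed[of "\<lambda>f. restrict f X \<in> K", OF Kc(6) Kc(1)])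
  have Kp: "restrict (\<lambda>ch. poly p (ch lam)) X \<in> K" if "in_k p" for p using that by (auto simp: K_def)
  have dep: "\<forall>v\<in>S. \<forall>ch\<in>X. a v ch = 0"
    if S: "finite S" "S \<subseteq> Y" and a: "\<And>v. v \<in> S \<Longrightarrow> restrict (a v) X \<in> K"
      and 0: "\<forall>ch\<in>X. (\<Sum>v\<in>S. a v ch * v ch) = 0" for S a
  proof (rule ballI, rule ccontr)
    fix v assume v: "v \<in> S" and nz: "\<not> (\<forall>ch\<in>X. a v ch = 0)"
    define a' where "a' v = restrict (a v) X" for v
    have 1: "a' v \<noteq> \<zero>\<^bsub>scal_ring\<^esub>"
      unfolding a'_def scal_ring_simps restrict_eq_iff by (rule nz)
    have 2: "a' \<in> S \<rightarrow> carrier scal_ring"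
      unfolding K_def[symmetric] by (rule Pi_I) (simp only: a'_def a)
    have "m.lincomb a' S = restrict (\<lambda>ch. \<Sum>v\<in>S. a' v ch * v ch) X"
      using S Y by (intro lincomb_eval 2) auto
    also have "\<dots> = restrict (\<lambda>_. 0) X"
    proof (rule restrict_eqI)
      fix ch assume "ch \<in> X"
      then show "(\<Sum>v\<in>S. a' v ch * v ch) = 0" using 0 by (simp add: a'_def)
    qed
    finally have "m.lincomb a' S = \<zero>\<^bsub>trace_mod\<^esub>" by (simp only: trace_mod_simps)
    with 1 2 S v have "m.lin_dep Y"
      unfolding m.lin_dep_def by (intro exI[of _ S] exI[of _ a'] exI[of _ v] conjI)
    then show False using ind by simp
  qed
  have "\<exists>S d. finite S \<and> S \<subseteq> Y \<and> d \<in> S \<rightarrow> K \<and> restrict (sixteen i) X = m.lincomb d S" if "i < 16" for i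
  proof -
    have "restrict (sixteen i) X \<in> m.span Y" using M_sixteen[OF that] span by (auto simp: M_ring_def)
    then obtain d S where "restrict (sixteen i) X = m.lincomb d S" "finite S" "S \<subseteq> Y"
      "d \<in> S \<rightarrow> carrier scal_ring"
      unfolding m.span_def by (elim CollectE exE conjE) (rule that)
    then show ?thesis unfolding K_def by (intro exI conjI)
  qed
  then have "\<forall>i. \<exists>p. i < 16 \<longrightarrow> finite (fst p) \<and> fst p \<subseteq> Y \<and> snd p \<in> fst p \<rightarrow> K \<and>
      restrict (sixteen i) X = m.lincomb (snd p) (fst p)" by simp
  from choice[OF this] obtain p where p: "\<forall>i<16. finite (fst (p i)) \<and> fst (p i) \<subseteq> Y \<and>
      snd (p i) \<in> fst (p i) \<rightarrow> K \<and> restrict (sixteen i) X = m.lincomb (snd (p i)) (fst (p i))"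
    by (elim exE) (rule that)
  define S0 d0 where "S0 i = fst (p i)" and "d0 i = snd (p i)" for i
  have S0: "finite (S0 i) \<and> S0 i \<subseteq> Y \<and> d0 i \<in> S0 i \<rightarrow> K \<and>
      restrict (sixteen i) X = m.lincomb (d0 i) (S0 i)" if "i < 16" for i
    unfolding S0_def d0_def by (rule p[rule_format, OF that])
  define S where "S = (\<Union>i<16. S0 i)"
  have S: "finite S" "S \<subseteq> Y" using S0 by (auto simp: S_def)
  \<comment> \<open>Extended by 0, so that all sixteen expansions run over the common finite set
    S.\<close>
  define d where "d i v ch = (if v \<in> S0 i then d0 i v ch else 0)" for i v ch
  have dK: "restrict (d i v) X \<in> K" if "i < 16" for i v
  proof (cases "v \<in> S0 i")
    case True
    then have mem: "d0 i v \<in> K" using S0[OF that] by blast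
    have eq: "d i v = d0 i v" by (rule ext) (simp only: d_def True if_True)
    have "d0 i v \<in> extensional X" using subringE(1)[OF K] mem by (simp add: subset_iff)
    then have "restrict (d0 i v) X = d0 i v" by (rule extensional_restrict)
    then show ?thesis using mem by (simp only: eq)
  next
    case False
    then show ?thesis using Kc(6) by (simp only: d_def[abs_def] if_False)
  qed
  have six: "sixteen i ch = (\<Sum>v\<in>S. d i v ch * v ch)" if "i < 16" "ch \<in> X" for i ch
  proof -
    have "restrict (sixteen i) X = restrict (\<lambda>ch. \<Sum>v\<in>S0 i. d0 i v ch * v ch) X"
      using S0[OF that(1)] Y unfolding K_def by (subst lincomb_eval[symmetric]) blast+
    then have "sixteen i ch = (\<Sum>v\<in>S0 i. d0 i v ch * v ch)"
      using that(2) unfolding restrict_eq_iff by blast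
    also have "\<dots> = (\<Sum>v\<in>S. d i v ch * v ch)"
      using S that by (intro sum.mono_neutral_cong_left) (auto simp: S_def d_def)
    finally show ?thesis .
  qed
  have main: "\<exists>c. (\<forall>i. in_k (c i)) \<and> b \<in> S \<and>
      (\<forall>v\<in>S. \<forall>ch\<in>X. (\<Sum>i<16. poly (c i) (ch lam) * d i v ch) = (if v = b then 2 else 0))"
    if b: "b \<in> Y" for b
  proof -
    have "M b" using b Y by (auto simp: M_ring_iff)
    from double_sixteen[OF this] obtain c where c: "\<forall>i. in_k (c i)"
      "\<forall>ch\<in>X. 2 * b ch = (\<Sum>i<16. poly (c i) (ch lam) * sixteen i ch)"
      by (elim exE conjE) (rule that)
    define a where "a v ch = (\<Sum>i<16. poly (c i) (ch lam) * d i v ch) - (if v = b then 2 else 0)" for v ch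
    have two: "restrict (\<lambda>_. if v = b then 2 else 0) X \<in> K" for v
    proof -
      have "in_k (if v = b then [:2:] else 0)" by (simp add: in_k_pCons)
      moreover have "restrict (\<lambda>_. if v = b then 2 else 0) X
          = restrict (\<lambda>ch. poly (if v = b then [:2:] else 0) (ch lam)) X"
        by (rule restrict_eqI) simp
      ultimately show ?thesis by (simp only: Kp)
    qed
    \<comment> \<open>Comparison of coefficients in the two expansions of 2b; b is inserted because
      it is not yet known to lie in S.\<close>
    have "\<forall>v\<in>insert b S. \<forall>ch\<in>X. a v ch = 0"
    proof (rule dep)
      show "restrict (a v) X \<in> K" for v
        unfolding a_def[abs_def]
        by (rule Kc(4)[OF K_sum two], simp, rule Kc(2)[OF Kp dK]) (use c in auto)
      show "\<forall>ch\<in>X. (\<Sum>v\<in>insert b S. a v ch * v ch) = 0"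
      proof
        fix ch assume ch: "ch \<in> X"
        have z: "d i v ch = 0" if "v \<notin> S" "i < 16" for i v using that by (auto simp: d_def S_def)
        have "(\<Sum>v\<in>insert b S. a v ch * v ch)
            = (\<Sum>v\<in>insert b S. (\<Sum>i<16. poly (c i) (ch lam) * d i v ch) * v ch)
              - (\<Sum>v\<in>insert b S. (if v = b then 2 else 0) * v ch)"
          by (simp add: a_def left_diff_distrib sum_subtractf)
        also have "(\<Sum>v\<in>insert b S. (if v = b then 2 else 0) * v ch) = 2 * b ch"
        proof -
          have "(\<Sum>v\<in>insert b S. (if v = b then 2 else 0) * v ch)
              = (\<Sum>v\<in>insert b S. if v = b then 2 * b ch else 0)"
            by (rule sum.cong) auto
          then show ?thesis using S by simp
        qed
        also have "(\<Sum>v\<in>insert b S. (\<Sum>i<16. poly (c i) (ch lam) * d i v ch) * v ch)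
            = (\<Sum>v\<in>S. (\<Sum>i<16. poly (c i) (ch lam) * d i v ch) * v ch)"
          using S z by (intro sum.mono_neutral_right) auto
        also have "\<dots> = (\<Sum>v\<in>S. \<Sum>i<16. poly (c i) (ch lam) * (d i v ch * v ch))"
          by (simp only: sum_distrib_right mult.assoc)
        also have "\<dots> = (\<Sum>i<16. \<Sum>v\<in>S. poly (c i) (ch lam) * (d i v ch * v ch))"
          by (rule sum.swap)
        also have "\<dots> = (\<Sum>i<16. poly (c i) (ch lam) * (\<Sum>v\<in>S. d i v ch * v ch))"
          by (simp only: sum_distrib_left)
        also have "\<dots> = 2 * b ch" using c(2) ch by (simp add: six)
        finally show "(\<Sum>v\<in>insert b S. a v ch * v ch) = 0" by simp
      qed
    qed (use S b in auto)
    then have a0: "\<forall>v\<in>insert b S. \<forall>ch\<in>X.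
        (\<Sum>i<16. poly (c i) (ch lam) * d i v ch) = (if v = b then 2 else 0)"
      by (simp add: a_def)
    \<comment> \<open>Outside S all coefficients vanish, so the equation at v = b would read 0 = 2.
      This makes Y equal to the finite set S.\<close>
    have "b \<in> S"
    proof (rule ccontr)
      assume "b \<notin> S"
      obtain ch where ch: "ch \<in> X" using X_nonempty by blast
      have "(\<Sum>i<16. poly (c i) (ch lam) * d i b ch) = 0"
        using \<open>b \<notin> S\<close> by (intro sum.neutral) (auto simp: d_def S_def)
      then show False using a0 ch by auto
    qed
    then show ?thesis using c a0 by auto
  qed
  then have "Y = S" using S by blast
  then show "finite Y" using S by simp
  obtain ch where ch: "ch \<in> X" using X_nonempty by blast
  \<comment> \<open>The rows of d at a single point; over C the factor 2 can be divided out.\<close>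
  define D where "D i v = (if v \<in> S then d i v ch else 0)" for i v
  have "card Y \<le> card (D ` {..<16})"
  proof (rule delta_card_le)
    fix V b
    assume b: "b \<in> Y" and V: "D ` {..<16} \<subseteq> V" "0 \<in> V"
      "\<And>v w. v \<in> V \<Longrightarrow> w \<in> V \<Longrightarrow> v + w \<in> V" "\<And>c v. v \<in> V \<Longrightarrow> (\<lambda>i. c * v i) \<in> V"
    obtain c where c: "\<forall>v\<in>S. (\<Sum>i<16. poly (c i) (ch lam) * d i v ch) = (if v = b then 2 else 0)" "b \<in> S"
      using main[OF b] ch by blast
    have mem: "(\<Sum>i\<in>I. (\<lambda>v. poly (c i) (ch lam) / 2 * D i v)) \<in> V"
      if "I \<subseteq> {..<16}" "finite I" for I
      using that(2,1)
    proof (induction I)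
      case (insert i I)
      have 1: "(\<lambda>v. poly (c i) (ch lam) / 2 * D i v) \<in> V" using insert V(1) by (intro V(4)) auto
      have 2: "(\<Sum>i\<in>I. (\<lambda>v. poly (c i) (ch lam) / 2 * D i v)) \<in> V" using insert by blast
      show ?case unfolding sum.insert[OF insert(1,2)] by (rule V(3)[OF 1 2])
    qed (use V(2) in simp)
    have eq: "(\<Sum>i\<in>{..<16}. (\<lambda>v. poly (c i) (ch lam) / 2 * D i v)) = (\<lambda>v. if v = b then 1 else 0)"
    proof
      fix v
      have "(\<Sum>i\<in>{..<16}. (\<lambda>v. poly (c i) (ch lam) / 2 * D i v)) v
          = (\<Sum>i<16. poly (c i) (ch lam) * D i v) / 2"
        by (simp add: sum_fun_apply sum_divide_distrib)
      also have "\<dots> = (if v = b then 1 else 0)" using c by (cases "v \<in> S") (auto simp: D_def)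
      finally show "(\<Sum>i\<in>{..<16}. (\<lambda>v. poly (c i) (ch lam) / 2 * D i v)) v = (if v = b then 1 else 0)" .
    qed
    show "(\<lambda>v. if v = b then 1 else 0) \<in> V" unfolding eq[symmetric] by (rule mem) auto
  qed (use \<open>finite Y\<close> in auto)
  also have "\<dots> \<le> 16" using card_image_le[of "{..<16}" D] by simp
  finally show "card Y \<le> 16" .
qed

lemma not_free_M:
  assumes "enat 17 \<le> gen_rank scal_ring trace_mod"
  shows "\<not> free_module scal_ring trace_mod"
proof
  assume "free_module scal_ring trace_mod"
  then obtain Y where "Y \<subseteq> carrier trace_mod"
    "module.span scal_ring trace_mod Y = carrier trace_mod"
    and ind: "\<not> module.lin_dep scal_ring trace_mod Y"
    unfolding free_module_def by (elim exE conjE) (rule that)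
  then have Y: "Y \<subseteq> M_ring" "module.span scal_ring trace_mod Y = M_ring"
    by (simp_all only: trace_mod_simps)
  note b = basis_card_le[OF Y ind]
  have "gen_rank scal_ring trace_mod \<le> enat (card Y)"
    unfolding gen_rank_def
    by (rule INF_lower) (simp only: mem_Collect_eq trace_mod_simps Y b subset_refl simp_thms)
  also have "\<dots> \<le> enat 16" using b(2) by simp
  finally have "enat 17 \<le> enat 16" using assms order_trans by blast
  then show False by simp
qed

end

section \<open>The ranks\<close>

context curve
begin

lemma j_Re_Im: "Re j = 0" "Im j * Im j = 1"
  using j csquare_plus_1[of j] by auto

lemma gen_rank_eq:
  assumes "gen_rank scal_ring trace_mod \<le> enat n" "enat n \<le> gen_rank scal_ring trace_mod"
  shows "gen_rank scal_ring trace_mod = enat n"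
  using assms by (rule antisym)

lemma gen_rank_C:
  assumes "k = UNIV"
  shows "gen_rank scal_ring trace_mod = 8"
proof -
  have in_k: "in_k p" for p unfolding in_k_def using assms by simp
  have "gen_rank scal_ring trace_mod \<le> enat 8"
  proof (rule gen_rank_le[where g = bas])
    show "\<exists>i<8. \<exists>p. in_k p \<and> (\<forall>ch\<in>X. bas m ch = poly p (ch lam) * bas i ch)" if "m < 8" for m
      using that by (intro exI[of _ m] conjI exI[of _ 1]) (simp_all add: in_k)
    show "\<exists>i<8. \<exists>p. in_k p \<and> (\<forall>ch\<in>X. j * bas m ch = poly p (ch lam) * bas i ch)"
      if "m < 8" for m
      using that by (intro exI[of _ m] conjI exI[of _ "[:j:]"]) (simp_all add: in_k)
    show "\<exists>i<8. \<exists>p. in_k p \<and> (\<forall>ch\<in>X. j * ch lam = poly p (ch lam) * bas i ch)"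
      by (intro exI[of _ 0] conjI exI[of _ "[:0, j:]"]) (simp_all add: in_k)
    show "\<exists>i<8. \<exists>p. in_k p \<and> (\<forall>ch\<in>X. 2 * j = poly p (ch lam) * bas i ch)"
      by (intro exI[of _ 0] conjI exI[of _ "[:2 * j:]"]) (simp_all add: in_k)
  qed (rule M_bas)
  moreover have "enat 8 \<le> gen_rank scal_ring trace_mod"
  proof (rule gen_rank_ge)
    \<comment> \<open>The eight coefficients at l = 0; a scalar acts through its own value
      there.\<close>
    let ?\<phi> = "\<lambda>(P :: nat \<Rightarrow> complex poly) i. if i < 8 then poly.coeff (P i) 0 else 0"
    show "?\<phi> (\<lambda>_. 0) = 0" by (simp add: fun_eq_iff)
    show "?\<phi> (\<lambda>m. P m + Q m) = ?\<phi> P + ?\<phi> Q" for P Q by (simp add: fun_eq_iff)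
    show "?\<phi> (\<lambda>m. p * P m) = (\<lambda>i. poly.coeff p 0 * ?\<phi> P i)" for p P
      by (simp add: fun_eq_iff coeff_mult_0)
    show "?\<phi> P = ?\<phi> Q" if "\<And>m. m < 8 \<Longrightarrow> P m = Q m" for P Q
      using that by (simp add: fun_eq_iff)
    show "\<exists>U. G U \<and> ?\<phi> U = (\<lambda>i'. if i' = i then 1 else 0)" if "i < 8" for i
      using that by (intro exI[of _ "\<lambda>m. if m = i then 1 else 0"]) (auto simp: fun_eq_iff G_def)
  qed
  ultimately show ?thesis unfolding numeral_eq_enat by (rule gen_rank_eq)
qed

lemma gen_rank_Q:
  assumes "k = \<rat>"
  shows "gen_rank scal_ring trace_mod = 16"
proof -
  have half: "1 / 2 \<in> k" unfolding assms by simp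
  have in_k: "in_k 1" by (simp add: one_pCons in_k_pCons)
  have "gen_rank scal_ring trace_mod \<le> enat 16"
  proof (rule gen_rank_le[where g = sixteen])
    show "\<exists>i<16. \<exists>p. in_k p \<and> (\<forall>ch\<in>X. bas m ch = poly p (ch lam) * sixteen i ch)" if "m < 8" for m
      using that by (intro exI[of _ m] conjI exI[of _ 1]) (simp_all add: in_k sixteen_def)
    show "\<exists>i<16. \<exists>p. in_k p \<and> (\<forall>ch\<in>X. j * bas m ch = poly p (ch lam) * sixteen i ch)"
      if "0 < m" "m < 8" for m
      using that by (intro exI[of _ "m + 8"] conjI exI[of _ 1]) (simp_all add: in_k sixteen_def)
    show "\<exists>i<16. \<exists>p. in_k p \<and> (\<forall>ch\<in>X. j * ch lam = poly p (ch lam) * sixteen i ch)"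
      by (intro exI[of _ 8] conjI exI[of _ "[:0, 1 / 2:]"]) (use half in \<open>simp_all add: in_k_pCons sixteen_def\<close>)
    show "\<exists>i<16. \<exists>p. in_k p \<and> (\<forall>ch\<in>X. 2 * j = poly p (ch lam) * sixteen i ch)"
      by (intro exI[of _ 8] conjI exI[of _ 1]) (simp_all add: in_k sixteen_def)
  qed (rule M_sixteen)
  moreover have "enat 16 \<le> gen_rank scal_ring trace_mod"
  proof (rule gen_rank_ge)
    \<comment> \<open>Both coordinates of the eight values at l = 0 with respect to 1 and j: as -j *
      j = 1, the real part of -j * c is the coefficient of j. Rational scalars are real and act on
      each coordinate.\<close>
    let ?\<phi> = "\<lambda>(P :: nat \<Rightarrow> complex poly) i. if i < 8 then Re (poly.coeff (P i) 0)
      else if i < 16 then Re (- j * poly.coeff (P (i - 8)) 0) else 0"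
    show "?\<phi> (\<lambda>_. 0) = 0" by (simp add: fun_eq_iff)
    show "?\<phi> (\<lambda>m. P m + Q m) = ?\<phi> P + ?\<phi> Q" for P Q by (auto simp: fun_eq_iff algebra_simps)
    show "?\<phi> (\<lambda>m. p * P m) = (\<lambda>i. Re (poly.coeff p 0) * ?\<phi> P i)" if "in_k p" for p P
    proof -
      have "poly.coeff p 0 \<in> k" using that by (simp add: in_k_def)
      then have "poly.coeff p 0 \<in> \<rat>" by (simp only: assms)
      then obtain a b :: int where "b \<noteq> 0" "poly.coeff p 0 = of_rat (Fract a b)"
        by (metis Rats_cases Rat_cases less_imp_neq)
      then have "poly.coeff p 0 = of_real (of_int a / of_int b)" by (simp add: of_rat_rat)
      then obtain r where q: "poly.coeff p 0 = of_real r" ..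
      show ?thesis by (auto simp: fun_eq_iff coeff_mult_0 q algebra_simps)
    qed
    show "?\<phi> P = ?\<phi> Q" if "\<And>m. m < 8 \<Longrightarrow> P m = Q m" for P Q
      using that by (simp add: fun_eq_iff)
    have j2: "j \<in> k2j" using k2jI[OF k_simps(2) half] by simp
    show "\<exists>U. G U \<and> ?\<phi> U = (\<lambda>i'. if i' = i then 1 else 0)" if "i < 16" for i
    proof (cases "i < 8")
      case True
      then show ?thesis
        by (intro exI[of _ "\<lambda>m. if m = i then 1 else 0"]) (auto simp: fun_eq_iff G_def j_Re_Im)
    next
      case False
      then show ?thesis using that j2
        by (intro exI[of _ "\<lambda>m. if m = i - 8 then [:j:] else 0"])
          (auto simp: fun_eq_iff G_def j_Re_Im coeffs_in_pCons)
    qed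
  qed
  ultimately show ?thesis unfolding numeral_eq_enat by (rule gen_rank_eq)
qed

text \<open>The coordinates of an element of Z[j] with respect to 1 and j; on such elements the
  floor only changes the type.\<close>

definition re_int :: "complex \<Rightarrow> int" where "re_int c = \<lfloor>Re c\<rfloor>"

definition im_int :: "complex \<Rightarrow> int" where "im_int c = \<lfloor>Re (- j * c)\<rfloor>"

lemma re_im_int [simp]:
  "re_int (of_int a + j * of_int b) = a" "im_int (of_int a + j * of_int b) = b"
proof -
  have "- j * (of_int a + j * of_int b) = of_int b - j * of_int a" using j by Groebner_Basis.algebra
  then show "im_int (of_int a + j * of_int b) = b" by (simp only: im_int_def) (simp add: j_Re_Im)
qed (simp add: re_int_def j_Re_Im)

lemma re_im_int_ring:
  assumes k: "k = \<int>"
  shows "c \<in> kj \<Longrightarrow> d \<in> kj \<Longrightarrow> re_int (c + d) = re_int c + re_int d"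
    and "c \<in> kj \<Longrightarrow> d \<in> kj \<Longrightarrow> im_int (c + d) = im_int c + im_int d"
    and "a \<in> k \<Longrightarrow> d \<in> kj \<Longrightarrow> re_int (a * d) = re_int a * re_int d"
    and "a \<in> k \<Longrightarrow> d \<in> kj \<Longrightarrow> im_int (a * d) = re_int a * im_int d"
    and "c \<in> k2j \<Longrightarrow> even (im_int c)"
proof -
  have kj: "\<exists>a b. c = of_int a + j * of_int b" if "c \<in> kj" for c
    using that unfolding kj_def unfolding k by (auto elim!: Ints_cases)
  have kk: "\<exists>a. c = of_int a + j * of_int 0" if "c \<in> k" for c
    using that unfolding k by (auto elim!: Ints_cases)
  have add: "(of_int a + j * of_int b) + (of_int a' + j * of_int b') = of_int (a + a') + j * of_int (b + b')"
    for a a' b b' by (simp add: algebra_simps)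
  have mult: "(of_int a + j * of_int 0) * (of_int a' + j * of_int b') = of_int (a * a') + j * of_int (a * b')"
    for a a' b' by (simp add: algebra_simps)
  show "re_int (c + d) = re_int c + re_int d" "im_int (c + d) = im_int c + im_int d"
    if cd: "c \<in> kj" "d \<in> kj"
  proof -
    obtain a b a' b' where "c = of_int a + j * of_int b" "d = of_int a' + j * of_int b'"
      using kj[OF cd(1)] kj[OF cd(2)] by (elim exE) (rule that)
    then show "re_int (c + d) = re_int c + re_int d" "im_int (c + d) = im_int c + im_int d"
      by (simp_all only: add re_im_int)
  qed
  show "re_int (a * d) = re_int a * re_int d" "im_int (a * d) = re_int a * im_int d"
    if ad: "a \<in> k" "d \<in> kj"
  proof -
    obtain a0 a' b' where "a = of_int a0 + j * of_int 0" "d = of_int a' + j * of_int b'"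
      using kk[OF ad(1)] kj[OF ad(2)] by (elim exE) (rule that)
    then show "re_int (a * d) = re_int a * re_int d" "im_int (a * d) = re_int a * im_int d"
      by (simp_all only: mult re_im_int)
  qed
  show "even (im_int c)" if c: "c \<in> k2j"
  proof -
    obtain a b :: int where "c = of_int a + 2 * j * of_int b"
      using c unfolding k2j_def unfolding k by (auto elim!: Ints_cases)
    then have "c = of_int a + j * of_int (2 * b)" by simp
    then show ?thesis by (simp only: re_im_int) simp
  qed
qed

text \<open>The summand \<open>(2, l)\<close> of the module needs two generators: \<open>2f + lg\<close> is mapped to
  \<open>(f(0), g(0))\<close> modulo 2.\<close>

lemma gen_rank_Z:
  assumes k: "k = \<int>"
  shows "gen_rank scal_ring trace_mod = 17"
proof -
  have in_k: "in_k 1" by (simp add: one_pCons in_k_pCons)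
  let ?g = "\<lambda>i. if i < 16 then sixteen i else (\<lambda>ch. j * ch lam)"
  have "gen_rank scal_ring trace_mod \<le> enat 17"
  proof (rule gen_rank_le[where g = ?g])
    show "\<exists>i<17. \<exists>p. in_k p \<and> (\<forall>ch\<in>X. bas m ch = poly p (ch lam) * ?g i ch)" if "m < 8" for m
      using that by (intro exI[of _ m] conjI exI[of _ 1]) (simp_all add: in_k sixteen_def)
    show "\<exists>i<17. \<exists>p. in_k p \<and> (\<forall>ch\<in>X. j * bas m ch = poly p (ch lam) * ?g i ch)"
      if "0 < m" "m < 8" for m
      using that by (intro exI[of _ "m + 8"] conjI exI[of _ 1]) (simp_all add: in_k sixteen_def)
    show "\<exists>i<17. \<exists>p. in_k p \<and> (\<forall>ch\<in>X. j * ch lam = poly p (ch lam) * ?g i ch)"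
      by (intro exI[of _ 16] conjI exI[of _ 1]) (simp_all add: in_k)
    show "\<exists>i<17. \<exists>p. in_k p \<and> (\<forall>ch\<in>X. 2 * j = poly p (ch lam) * ?g i ch)"
      by (intro exI[of _ 8] conjI exI[of _ 1]) (simp_all add: in_k sixteen_def)
    show "M (?g i)" for i
      using M_sixteen[of i] M_lam[OF N_const[of j]] by (simp add: mult.commute)
  qed
  moreover have "enat 17 \<le> gen_rank scal_ring trace_mod"
  proof (rule gen_rank_ge)
    \<comment> \<open>All entries are taken modulo 2: real coordinates at 0 to 7, imaginary ones at
      9 to 15. For the basis element 1 the imaginary constant term is even and is halved at index 8;
      the imaginary coefficient of l stands at index 16.\<close>
    define \<phi> :: "(nat \<Rightarrow> complex poly) \<Rightarrow> nat \<Rightarrow> bit" where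
      "\<phi> P i = of_int (if i < 8 then re_int (poly.coeff (P i) 0)
        else if i = 8 then im_int (poly.coeff (P 0) 0) div 2
        else if i < 16 then im_int (poly.coeff (P (i - 8)) 0)
        else if i = 16 then im_int (poly.coeff (P 0) 1) else 0)" for P i
    have c: "poly.coeff (P m) n \<in> kj" if "G P" "m < 8" for P m n
      using that by (auto simp: G_def coeffs_in_def)
    have c0: "even (im_int (poly.coeff (P 0) 0))" if "G P" for P
      using that re_im_int_ring(5)[OF k] by (auto simp: G_def)
    have zero: "re_int 0 = 0" "im_int 0 = 0" using re_im_int[of 0 0] by simp_all
    have one: "re_int 1 = 1" "im_int 1 = 0" "re_int j = 0" "im_int j = 1" "re_int (2 * j) = 0"
      "im_int (2 * j) = 2"
      using re_im_int[of 1 0] re_im_int[of 0 1] re_im_int[of 0 2] by (simp_all add: mult.commute)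
    show "\<phi> (\<lambda>_. 0) = 0" by (simp add: fun_eq_iff \<phi>_def zero)
    show "\<phi> (\<lambda>m. P m + Q m) = \<phi> P + \<phi> Q" if "G P" "G Q" for P Q
      using c0[OF that(1)] c0[OF that(2)]
      by (auto simp: fun_eq_iff \<phi>_def re_im_int_ring[OF k] c that elim!: evenE)
    show "\<phi> (\<lambda>m. p * P m) = (\<lambda>i. of_int (re_int (poly.coeff p 0)) * \<phi> P i)"
      if "in_k p" "G P" for p P
    proof
      fix i :: nat
      have p: "poly.coeff p n \<in> k" for n using that by (simp add: in_k_def)
      note r = re_im_int_ring(3,4)[OF k p c[OF that(2)]]
      consider "i < 8" | "i = 8" | "8 < i" "i < 16" | "i = 16" | "16 < i" by linarith
      then show "\<phi> (\<lambda>m. p * P m) i = of_int (re_int (poly.coeff p 0)) * \<phi> P i"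
      proof cases
        case 2
        then show ?thesis using c0[OF that(2)] by (auto simp: \<phi>_def coeff_mult_0 r elim!: evenE)
      next
        case 4
        \<comment> \<open>The second summand has an even imaginary coordinate, so modulo 2 the
          scalar acts at index 16 through its constant term alone.\<close>
        have "poly.coeff (p * P 0) 1 = poly.coeff p 0 * poly.coeff (P 0) 1
            + poly.coeff p 1 * poly.coeff (P 0) 0"
          by (simp add: coeff_mult)
        then have "im_int (poly.coeff (p * P 0) 1) = re_int (poly.coeff p 0) * im_int (poly.coeff (P 0) 1)
            + re_int (poly.coeff p 1) * im_int (poly.coeff (P 0) 0)"
          using re_im_int_ring(2)[OF k kj_mult kj_mult, OF k_subset(1)[OF p] c[OF that(2)]
            k_subset(1)[OF p] c[OF that(2)]] by (simp add: r)
        then show ?thesis using 4 c0[OF that(2)] by (auto simp: \<phi>_def elim!: evenE)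
      qed (auto simp: \<phi>_def coeff_mult_0 r)
    qed
    show "\<phi> P = \<phi> Q" if "\<And>m. m < 8 \<Longrightarrow> P m = Q m" for P Q
      using that by (auto simp: fun_eq_iff \<phi>_def)
    have j2: "2 * j \<in> k2j" by (intro kj_double) simp
    have jj: "2 * j \<in> kj" by (intro kj_mult) simp_all
    show "\<exists>U. G U \<and> \<phi> U = (\<lambda>i'. if i' = i then 1 else 0)" if i: "i < 17" for i
    proof -
      consider "i < 8" | "i = 8" | "8 < i" "i < 16" | "i = 16" using i by linarith
      then show ?thesis
      proof cases
        case 1
        then show ?thesis
          by (intro exI[of _ "\<lambda>m. if m = i then 1 else 0"]) (auto simp: fun_eq_iff G_def \<phi>_def zero one)
      next
        case 2
        then show ?thesis using j2 jj
          by (intro exI[of _ "\<lambda>m. if m = 0 then [:2 * j:] else 0"])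
            (auto simp: fun_eq_iff G_def \<phi>_def zero one coeffs_in_pCons)
      next
        case 3
        then show ?thesis
          by (intro exI[of _ "\<lambda>m. if m = i - 8 then [:j:] else 0"])
            (auto simp: fun_eq_iff G_def \<phi>_def zero one coeffs_in_pCons)
      next
        case 4
        then show ?thesis
          by (intro exI[of _ "\<lambda>m. if m = 0 then [:0, j:] else 0"])
            (auto simp: fun_eq_iff G_def \<phi>_def zero one coeffs_in_pCons)
      qed
    qed
  qed
  ultimately show ?thesis unfolding numeral_eq_enat by (rule gen_rank_eq)
qed

end

section \<open>Irreducibility\<close>

lemma coord_ring_subring: "subring (coord_ring Y) (fun_ring Y)"
  unfolding coord_ring_def by (intro subalg_gen_subring I_fun_extensional)

text \<open>Restriction is built in, so that regular functions can be written as plain expressions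
  in the character.\<close>

definition coord_fun :: "((pi1 \<Rightarrow> complex) \<Rightarrow> complex) \<Rightarrow> bool" where
  "coord_fun f \<longleftrightarrow> restrict f char_variety \<in> coord_ring char_variety"

lemma coord_fun_closed:
  "coord_fun f \<Longrightarrow> coord_fun g \<Longrightarrow> coord_fun (\<lambda>ch. f ch + g ch)"
  "coord_fun f \<Longrightarrow> coord_fun g \<Longrightarrow> coord_fun (\<lambda>ch. f ch * g ch)"
  "coord_fun f \<Longrightarrow> coord_fun g \<Longrightarrow> coord_fun (\<lambda>ch. f ch - g ch)"
  "coord_fun f \<Longrightarrow> coord_fun (\<lambda>ch. f ch ^ n)"
  unfolding coord_fun_def by (rule subring_fun_ring_closed[OF coord_ring_subring]; assumption)+

lemma coord_fun_simps: "coord_fun (\<lambda>_. c)" "coord_fun (\<lambda>ch. ch \<gamma>)"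
proof -
  show "coord_fun (\<lambda>_. c)"
    using subalg_gen_contains(1)[of char_variety UNIV "range (I_fun char_variety)"]
    by (auto simp: coord_fun_def coord_ring_def consts_on_def)
  show "coord_fun (\<lambda>ch. ch \<gamma>)"
    using subalg_gen_contains(2)[of "range (I_fun char_variety)" UNIV char_variety]
    by (auto simp: coord_fun_def coord_ring_def I_fun_def)
qed

lemma zariski_closedI:
  assumes "\<And>f. f \<in> F \<Longrightarrow> coord_fun f" "Z = {ch \<in> char_variety. \<forall>f\<in>F. f ch = 0}"
  shows "zariski_closed Z"
  unfolding zariski_closed_def
proof (intro exI conjI)
  show "(\<lambda>f. restrict f char_variety) ` F \<subseteq> coord_ring char_variety"
    using assms(1) by (auto simp: coord_fun_def)
qed (use assms(2) in auto)

lemma zariski_closedE: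
  assumes "zariski_closed Z"
  obtains F where "\<forall>f\<in>F. coord_fun f" "Z = {ch \<in> char_variety. \<forall>f\<in>F. f ch = 0}"
proof -
  obtain F where F: "F \<subseteq> coord_ring char_variety" "Z = {ch \<in> char_variety. \<forall>f\<in>F. f ch = 0}"
    using assms by (auto simp: zariski_closed_def)
  have "coord_fun f" if "f \<in> F" for f
  proof -
    have "f \<in> extensional char_variety"
      using that F(1) subringE(1)[OF coord_ring_subring] by auto
    then show ?thesis using that F(1) by (auto simp: coord_fun_def extensional_restrict)
  qed
  then show ?thesis using that F(2) by blast
qed

lemma zariski_closed_Int:
  assumes "zariski_closed Y" "zariski_closed Z"
  shows "zariski_closed (Y \<inter> Z)"
proof -
  obtain F where F: "\<forall>f\<in>F. coord_fun f" "Y = {ch \<in> char_variety. \<forall>f\<in>F. f ch = 0}"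
    using zariski_closedE[OF assms(1)] .
  obtain H where H: "\<forall>f\<in>H. coord_fun f" "Z = {ch \<in> char_variety. \<forall>f\<in>H. f ch = 0}"
    using zariski_closedE[OF assms(2)] .
  show ?thesis by (rule zariski_closedI[of "F \<union> H"]) (use F H in auto)
qed

lemma zariski_closed_Un:
  assumes "zariski_closed Y" "zariski_closed Z"
  shows "zariski_closed (Y \<union> Z)"
proof -
  obtain F where F: "\<forall>f\<in>F. coord_fun f" "Y = {ch \<in> char_variety. \<forall>f\<in>F. f ch = 0}"
    using zariski_closedE[OF assms(1)] .
  obtain H where H: "\<forall>f\<in>H. coord_fun f" "Z = {ch \<in> char_variety. \<forall>f\<in>H. f ch = 0}"
    using zariski_closedE[OF assms(2)] .
  have "(\<forall>f\<in>{\<lambda>ch. f ch * h ch | f h. f \<in> F \<and> h \<in> H}. f ch = 0) \<longleftrightarrow>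
      (\<forall>f\<in>F. f ch = 0) \<or> (\<forall>h\<in>H. h ch = 0)" for ch
    by (auto; metis mult_eq_0_iff)
  then show ?thesis
    by (intro zariski_closedI[of "{\<lambda>ch. f ch * h ch | f h. f \<in> F \<and> h \<in> H}"])
      (use F H coord_fun_closed(2) in auto)
qed

lemma irreducible_closed_Un:
  assumes "irreducible_closed Z" "zariski_closed P" "zariski_closed Q" "Z \<subseteq> P \<union> Q"
  shows "Z \<subseteq> P \<or> Z \<subseteq> Q"
proof -
  have Z: "zariski_closed Z" using assms(1) by (simp add: irreducible_closed_def)
  have "Z = (Z \<inter> P) \<union> (Z \<inter> Q)" using assms(4) by blast
  then have "Z = Z \<inter> P \<or> Z = Z \<inter> Q"
    using assms(1) zariski_closed_Int[OF Z assms(2)] zariski_closed_Int[OF Z assms(3)]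
    unfolding irreducible_closed_def by blast
  then show ?thesis by blast
qed

lemma zariski_closed_vanishing: "coord_fun f \<Longrightarrow> zariski_closed {ch \<in> char_variety. f ch = 0}"
  by (rule zariski_closedI[of "{f}"]) auto

lemma curve_chars_closed: "zariski_closed (curve_chars j)"
proof (rule zariski_closedI)
  let ?F = "{\<lambda>ch. cy ch * cz ch - 2 * cx ch, \<lambda>ch. cz ch ^ 2 - (2 * cx ch ^ 2 - 4),
    \<lambda>ch. ct ch - j * (cx ch ^ 2 - 2), \<lambda>ch. cta ch - j * cx ch,
    \<lambda>ch. ctb ch - j * (cx ch * cz ch - cy ch), \<lambda>ch. ctab ch - j * cz ch}"
  show "coord_fun f" if "f \<in> ?F" for f
    using that by (elim insertE emptyE; simp only:; intro coord_fun_closed coord_fun_simps)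
  show "curve_chars j = {ch \<in> char_variety. \<forall>f\<in>?F. f ch = 0}"
    by (auto simp: curve_chars_def)
qed

text \<open>The curve \<open>z\<^sup>2 = 2x\<^sup>2 - 4\<close> is parametrised by \<open>s = \<surd>2 x + z\<close>, with \<open>4/s = \<surd>2 x - z\<close>.\<close>

definition rational_in_s :: "(complex \<Rightarrow> complex) \<Rightarrow> bool" where
  "rational_in_s f \<longleftrightarrow> (\<exists>p n. \<forall>s. s \<noteq> 0 \<longrightarrow> s^2 \<noteq> 4 \<longrightarrow> f s * (s * (s^2 - 4)) ^ n = poly p s)"

lemma rational_in_s_mult:
  assumes "rational_in_s f" "rational_in_s g"
  shows "rational_in_s (\<lambda>s. f s * g s)"
proof -
  obtain p n q m where
    p: "\<And>s. s \<noteq> 0 \<Longrightarrow> s^2 \<noteq> 4 \<Longrightarrow> f s * (s * (s^2 - 4)) ^ n = poly p s" and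
    q: "\<And>s. s \<noteq> 0 \<Longrightarrow> s^2 \<noteq> 4 \<Longrightarrow> g s * (s * (s^2 - 4)) ^ m = poly q s"
    using assms unfolding rational_in_s_def by blast
  have "f s * g s * (s * (s^2 - 4)) ^ (n + m) = poly (p * q) s" if "s \<noteq> 0" "s^2 \<noteq> 4" for s
    unfolding poly_mult p[OF that, symmetric] q[OF that, symmetric] power_add by (simp only: mult_ac)
  then show ?thesis unfolding rational_in_s_def by blast
qed

lemma rational_in_s_add:
  assumes "rational_in_s f" "rational_in_s g"
  shows "rational_in_s (\<lambda>s. f s + g s)"
proof -
  obtain p n q m where
    p: "\<And>s. s \<noteq> 0 \<Longrightarrow> s^2 \<noteq> 4 \<Longrightarrow> f s * (s * (s^2 - 4)) ^ n = poly p s" and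
    q: "\<And>s. s \<noteq> 0 \<Longrightarrow> s^2 \<noteq> 4 \<Longrightarrow> g s * (s * (s^2 - 4)) ^ m = poly q s"
    using assms unfolding rational_in_s_def by blast
  define D :: "complex poly" where "D = [:0, -4, 0, 1:]"
  have D: "poly D s = s * (s^2 - 4)" for s by (simp add: D_def power2_eq_square algebra_simps)
  have "(f s + g s) * (s * (s^2 - 4)) ^ (n + m) = poly (p * D ^ m + q * D ^ n) s"
    if "s \<noteq> 0" "s^2 \<noteq> 4" for s
    unfolding poly_add poly_mult poly_power D p[OF that, symmetric] q[OF that, symmetric] power_add
    by (simp only: distrib_right mult_ac)
  then show ?thesis unfolding rational_in_s_def by blast
qed

lemma rational_in_s_const: "rational_in_s (\<lambda>_. c)"
  unfolding rational_in_s_def by (intro exI[of _ "[:c:]"] exI[of _ 0]) simp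

lemma rational_in_s_poly: "rational_in_s f \<Longrightarrow> rational_in_s (\<lambda>s. poly p (f s))"
  by (induction p) (simp_all add: rational_in_s_const rational_in_s_add rational_in_s_mult)

definition r2 :: complex where "r2 = csqrt 2"

lemma r2: "r2 * r2 = 2" "r2 \<noteq> 0"
proof -
  have "r2^2 = 2" unfolding r2_def by (rule power2_csqrt)
  then show "r2 * r2 = 2" "r2 \<noteq> 0" by (auto simp: power2_eq_square)
qed

definition px :: "complex \<Rightarrow> complex" where "px s = (s + 4 / s) / (2 * r2)"
definition pz :: "complex \<Rightarrow> complex" where "pz s = (s - 4 / s) / 2"
definition py :: "complex \<Rightarrow> complex" where "py s = 2 * px s / pz s"

lemma param_eqs:
  assumes "s \<noteq> 0" "s^2 \<noteq> 4"
  shows "pz s \<noteq> 0" "py s * pz s = 2 * px s" "pz s ^ 2 = 2 * px s ^ 2 - 4"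
proof -
  show 1: "pz s \<noteq> 0" using assms by (simp add: pz_def field_simps power2_eq_square)
  then show "py s * pz s = 2 * px s" by (simp add: py_def)
  define t where "t = 4 / s"
  have t: "s * t = 4" using assms by (simp add: t_def)
  have "(2 * r2 * px s) = s + t" using r2 by (simp add: px_def t_def)
  then have "4 * (r2 * r2) * (px s * px s) = (s + t) * (s + t)"
    by Groebner_Basis.algebra
  then have "8 * (px s * px s) = (s + t) * (s + t)" by (simp add: r2)
  moreover have "2 * pz s = s - t" by (simp add: pz_def t_def)
  then have "4 * (pz s * pz s) = (s - t) * (s - t)" by Groebner_Basis.algebra
  ultimately have "4 * (pz s * pz s - (2 * (px s * px s) - 4)) = 0" using t by Groebner_Basis.algebra
  moreover have "w = 0" if "4 * w = 0" for w :: complex using that by simp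
  ultimately have "pz s * pz s - (2 * (px s * px s) - 4) = 0" by blast
  then show "pz s ^ 2 = 2 * px s ^ 2 - 4" by (simp add: power2_eq_square)
qed

lemma param_rational: "rational_in_s px" "rational_in_s py" "rational_in_s pz"
proof -
  have "px s * (s * (s^2 - 4)) ^ 1 = poly (Polynomial.smult (1 / (2 * r2)) ([:4, 0, 1:] * [:-4, 0, 1:])) s"
    if "s \<noteq> 0" for s
    using that by (simp add: px_def field_simps power2_eq_square r2)
  then show "rational_in_s px" unfolding rational_in_s_def by blast
  have "pz s * (s * (s^2 - 4)) ^ 1 = poly (Polynomial.smult (1 / 2) ([:-4, 0, 1:] * [:-4, 0, 1:])) s"
    if "s \<noteq> 0" for s
    using that by (simp add: pz_def field_simps power2_eq_square)
  then show "rational_in_s pz" unfolding rational_in_s_def by blast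
  have "py s * (s * (s^2 - 4)) ^ 1 = poly (Polynomial.smult (2 / r2) ([:0, 1:] * [:4, 0, 1:])) s"
    if "s \<noteq> 0" "s^2 \<noteq> 4" for s
  proof -
    have "s^2 - 4 \<noteq> 0" using that by simp
    moreover have "pz s = (s^2 - 4) / (2 * s)" "px s = (s^2 + 4) / (2 * r2 * s)"
      using that r2 by (simp_all add: px_def pz_def field_simps power2_eq_square)
    moreover have "2 * (n / (2 * r2 * s)) / (d / (2 * s)) = 2 * n / (r2 * d)" if "d \<noteq> 0" for n d
      using that \<open>s \<noteq> 0\<close> r2 by (simp add: field_simps)
    ultimately have "py s = 2 * (s^2 + 4) / (r2 * (s^2 - 4))" by (simp only: py_def)
    moreover have "2 * n / (r2 * d) * (s * d) = 2 / r2 * (s * n)" if "d \<noteq> 0" for n d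
      using that r2 by (simp add: field_simps)
    ultimately have "py s * (s * (s^2 - 4)) = 2 / r2 * (s * (s^2 + 4))"
      using \<open>s^2 - 4 \<noteq> 0\<close> by (simp only: not_False_eq_True)
    then show ?thesis by (simp add: power2_eq_square algebra_simps)
  qed
  then show "rational_in_s py" unfolding rational_in_s_def by blast
qed

text \<open>The product of the two numerators vanishes outside 0, 2 and -2, hence is the zero
  polynomial, and polynomials form a domain.\<close>

lemma rational_in_s_zero:
  assumes "rational_in_s f" "rational_in_s g"
    and zero: "\<And>s. s \<noteq> 0 \<Longrightarrow> s^2 \<noteq> 4 \<Longrightarrow> f s * g s = 0"
  shows "(\<forall>s. s \<noteq> 0 \<longrightarrow> s^2 \<noteq> 4 \<longrightarrow> f s = 0) \<or> (\<forall>s. s \<noteq> 0 \<longrightarrow> s^2 \<noteq> 4 \<longrightarrow> g s = 0)"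
proof -
  obtain p n q m where
    p: "\<And>s. s \<noteq> 0 \<Longrightarrow> s^2 \<noteq> 4 \<Longrightarrow> f s * (s * (s^2 - 4)) ^ n = poly p s" and
    q: "\<And>s. s \<noteq> 0 \<Longrightarrow> s^2 \<noteq> 4 \<Longrightarrow> g s * (s * (s^2 - 4)) ^ m = poly q s"
    using assms(1,2) unfolding rational_in_s_def by blast
  have "p * q = 0"
  proof (rule ccontr)
    assume "p * q \<noteq> 0"
    then have "finite {s. poly (p * q) s = 0}" by (rule poly_roots_finite)
    moreover have "UNIV - {0, 2, -2} \<subseteq> {s. poly (p * q) s = 0}"
    proof
      fix s :: complex assume "s \<in> UNIV - {0, 2, -2}"
      then have s: "s \<noteq> 0" "s \<noteq> 2" "s \<noteq> -2" by auto
      have "(s - 2) * (s + 2) \<noteq> 0" using s by (simp add: eq_neg_iff_add_eq_0)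
      then have s2: "s^2 \<noteq> 4" by (simp add: power2_eq_square algebra_simps)
      have "f s = 0 \<or> g s = 0" using zero[OF s(1) s2] by simp
      then show "s \<in> {s. poly (p * q) s = 0}"
        using p[OF s(1) s2] q[OF s(1) s2] by auto
    qed
    moreover have "infinite (UNIV - {0, 2, -2 :: complex})" by (simp add: infinite_UNIV_char_0)
    ultimately show False using finite_subset by blast
  qed
  moreover have "f s = 0" if "p = 0" "s \<noteq> 0" "s^2 \<noteq> 4" for s
    using p[OF that(2,3)] that by simp
  moreover have "g s = 0" if "q = 0" "s \<noteq> 0" "s^2 \<noteq> 4" for s
    using q[OF that(2,3)] that by simp
  ultimately show ?thesis by auto
qed

lemma param_surj:
  assumes "y * z = 2 * x" "z^2 = 2 * x^2 - 4"
  obtains s where "s \<noteq> 0" "s^2 \<noteq> 4" "x = px s" "y = py s" "z = pz s"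
proof -
  define s where "s = r2 * x + z"
  define t where "t = r2 * x - z"
  have z0: "z \<noteq> 0"
  proof
    assume "z = 0"
    then show False using assms by simp
  qed
  have st: "s * t = 4"
  proof -
    have "s * t = (r2 * r2) * x^2 - z^2"
      by (simp add: s_def t_def power2_eq_square algebra_simps)
    then show ?thesis by (simp add: r2 assms)
  qed
  have s0: "s \<noteq> 0" using st by auto
  have t: "t = 4 / s" using st s0 by (simp add: field_simps)
  have z: "z = pz s" unfolding pz_def t[symmetric] by (simp add: s_def t_def)
  have x: "x = px s" unfolding px_def t[symmetric] using r2 by (simp add: s_def t_def)
  have y: "y = py s" unfolding py_def x[symmetric] z[symmetric] using assms z0 by (simp add: field_simps)
  \<comment> \<open>s^2 = 4 = st would give s = t, that is z = 0.\<close>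
  have "s^2 \<noteq> 4"
  proof
    assume "s^2 = 4"
    then have "s * (s - t) = 0" using st by (simp add: power2_eq_square algebra_simps)
    then show False using s0 z0 by (simp add: s_def t_def)
  qed
  then show ?thesis using that s0 x y z by blast
qed

context curve
begin

text \<open>The pullback of \<open>val P\<close> along the parametrisation.\<close>

definition vals :: "(nat \<Rightarrow> complex poly) \<Rightarrow> complex \<Rightarrow> complex" where
  "vals P s = (let x = px s; y = py s; z = pz s; l = x * x + y * y + (-6) in
    poly (P 0) l + poly (P 1) l * (x * x) + poly (P 2) l * x + poly (P 3) l * (x * (x * x))
      + poly (P 4) l * y + poly (P 5) l * (x * (x * y)) + poly (P 6) l * z + poly (P 7) l * (x * y))"

lemma rational_vals: "rational_in_s (vals P)"
  unfolding vals_def Let_def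
  by (intro rational_in_s_add rational_in_s_mult rational_in_s_poly rational_in_s_const param_rational)

lemma val_vals:
  assumes "ch \<in> X" "cx ch = px s" "cy ch = py s" "cz ch = pz s"
  shows "val P ch = vals P s"
  using assms curve_eqs(5)[OF assms(1)] by (simp add: val_def sum_8 vals_def Let_def)

text \<open>Pulled back to the parameter s, the two functions become rational functions with
  vanishing product; surjectivity of the parametrisation carries the vanishing factor back to the
  curve.\<close>

lemma M_prime:
  assumes "M f" "M g" and fg: "\<And>ch. ch \<in> X \<Longrightarrow> f ch * g ch = 0"
  shows "(\<forall>ch\<in>X. f ch = 0) \<or> (\<forall>ch\<in>X. g ch = 0)"
proof -
  obtain P Q where P: "\<forall>ch\<in>X. f ch = val P ch" and Q: "\<forall>ch\<in>X. g ch = val Q ch"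
    using assms(1,2) unfolding M_def by blast
  have "vals P s * vals Q s = 0" if s: "s \<noteq> 0" "s^2 \<noteq> 4" for s
  proof -
    obtain ch where "ch \<in> X" "cx ch = px s" "cy ch = py s" "cz ch = pz s"
      using curve_chars_point[OF j param_eqs(2,3)[OF s]] .
    then show ?thesis using fg[of ch] P Q by (simp add: val_vals)
  qed
  from rational_in_s_zero[OF rational_vals rational_vals this]
  have *: "(\<forall>s. s \<noteq> 0 \<longrightarrow> s^2 \<noteq> 4 \<longrightarrow> vals P s = 0) \<or> (\<forall>s. s \<noteq> 0 \<longrightarrow> s^2 \<noteq> 4 \<longrightarrow> vals Q s = 0)" .
  have "val P ch = 0" if vals: "\<forall>s. s \<noteq> 0 \<longrightarrow> s^2 \<noteq> 4 \<longrightarrow> vals P s = 0" and ch: "ch \<in> X" for P ch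
  proof -
    obtain s where "s \<noteq> 0" "s^2 \<noteq> 4" "cx ch = px s" "cy ch = py s" "cz ch = pz s"
      using param_surj[of "cy ch" "cz ch" "cx ch"] ch by (auto simp: curve_chars_def)
    then show ?thesis using vals ch by (simp add: val_vals)
  qed
  with * P Q show ?thesis by auto
qed

text \<open>The functions on the whole variety whose restriction to the curve satisfies
  \<open>M\<close> form a C-subalgebra containing the traces.\<close>

lemma coord_fun_M:
  assumes "k = UNIV" "coord_fun f"
  shows "M f"
proof -
  define R where "R = {restrict f char_variety | f. M f}"
  have R: "restrict f char_variety \<in> R" if "M f" for f using that by (auto simp: R_def)
  have sub: "X \<subseteq> char_variety" by (auto simp: curve_chars_def)
  have M_res: "M (restrict f char_variety) \<longleftrightarrow> M f" for f
    using M_cong[of f "restrict f char_variety"] M_cong[of "restrict f char_variety" f] sub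
    by (auto simp: subset_iff)
  have Rf: "M f" if "f \<in> R" for f using that by (auto simp: R_def M_res)
  have "coord_ring char_variety \<subseteq> R"
    unfolding coord_ring_def
  proof (rule subalg_gen_least)
    show "subring R (fun_ring char_variety)"
    proof (rule subring_fun_ringI)
      show "R \<subseteq> extensional char_variety" by (auto simp: R_def)
      show "restrict (\<lambda>_. 1) char_variety \<in> R" by (intro R M_1)
      show "restrict (\<lambda>ch. - f ch) char_variety \<in> R" if "f \<in> R" for f
        by (intro R M_uminus Rf that)
      show "restrict (\<lambda>ch. f ch * g ch) char_variety \<in> R" if "f \<in> R" "g \<in> R" for f g
        by (intro R M_mult Rf that)
      show "restrict (\<lambda>ch. f ch + g ch) char_variety \<in> R" if "f \<in> R" "g \<in> R" for f g
        by (intro R M_add Rf that)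
    qed
    show "consts_on char_variety UNIV \<subseteq> R"
    proof
      fix f assume "f \<in> consts_on char_variety UNIV"
      then obtain c where f: "f = restrict (\<lambda>_. c) char_variety" by (auto simp: consts_on_def)
      have "c \<in> k" using assms(1) by simp
      then show "f \<in> R" unfolding f by (intro R M_const k_subset(2))
    qed
    show "range (I_fun char_variety) \<subseteq> R"
      by (auto simp: I_fun_def intro!: R M_trace_fun)
  qed
  then have "M (restrict f char_variety)" using assms(2) Rf by (auto simp: coord_fun_def)
  then show ?thesis by (simp add: M_res)
qed

lemma curve_chars_irreducible:
  assumes "k = UNIV"
  shows "irreducible_closed X"
  unfolding irreducible_closed_def
proof (intro conjI allI impI)
  show "zariski_closed X" by (rule curve_chars_closed)
  show "X \<noteq> {}" by (rule X_nonempty)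
  fix Y Z assume YZ: "zariski_closed Y" "zariski_closed Z" and X: "X = Y \<union> Z"
  obtain F where F: "\<forall>f\<in>F. coord_fun f" "Y = {ch \<in> char_variety. \<forall>f\<in>F. f ch = 0}"
    using zariski_closedE[OF YZ(1)] .
  obtain H where H: "\<forall>f\<in>H. coord_fun f" "Z = {ch \<in> char_variety. \<forall>f\<in>H. f ch = 0}"
    using zariski_closedE[OF YZ(2)] .
  have sub: "X \<subseteq> char_variety" by (auto simp: curve_chars_def)
  show "X = Y \<or> X = Z"
  proof (rule ccontr)
    assume "\<not> (X = Y \<or> X = Z)"
    then obtain a b where ab: "a \<in> X" "a \<notin> Y" "b \<in> X" "b \<notin> Z" using X by blast
    have "a \<in> char_variety" "b \<in> char_variety" using ab sub by blast+
    then obtain f h where f: "f \<in> F" "f a \<noteq> 0" and h: "h \<in> H" "h b \<noteq> 0"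
      using ab(2,4) unfolding F(2) H(2) by blast
    have "f ch * h ch = 0" if "ch \<in> X" for ch
    proof -
      have "ch \<in> Y \<or> ch \<in> Z" using that X by blast
      then have "f ch = 0 \<or> h ch = 0" unfolding F(2) H(2) using f(1) h(1) by blast
      then show ?thesis by simp
    qed
    then have "(\<forall>ch\<in>X. f ch = 0) \<or> (\<forall>ch\<in>X. h ch = 0)"
      by (intro M_prime coord_fun_M assms F(1)[rule_format] f H(1)[rule_format] h)
    then show False using ab(1,3) f(2) h(2) by blast
  qed
qed

end

text \<open>X is irreducible and covered by four closed sets: x = 0, l = 2 and the two explicit
  curves. The faithful character excludes the first two, so X lies in one of the curves; that curve
  is irreducible, and maximality of the component X gives equality.\<close>

lemma hyperbolic_curve_eq:
  assumes "hyperbolic_curve X"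
  obtains j where "j * j = -1" "X = curve_chars j"
proof -
  obtain \<rho> where irr: "irreducible_component X" and \<rho>: "\<rho> \<in> hom pi1_N SL2C" "inj \<rho>"
    and mem: "character \<rho> \<in> X"
    using assms by (auto simp: hyperbolic_curve_def discrete_faithful_def)
  define Zx where "Zx = {ch \<in> char_variety. cx ch = 0}"
  define Zl where "Zl = {ch \<in> char_variety. ch lam - 2 = 0}"
  have cl: "zariski_closed Zx" "zariski_closed Zl" unfolding Zx_def Zl_def
    by (intro zariski_closed_vanishing coord_fun_closed coord_fun_simps)+
  have ic: "irreducible_closed X" using irr by (simp add: irreducible_component_def)
  then have sub: "X \<subseteq> char_variety" by (auto simp: irreducible_closed_def elim!: zariski_closedE)
  have "X \<subseteq> (Zx \<union> Zl) \<union> (curve_chars \<i> \<union> curve_chars (- \<i>))"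
    using char_variety_cases sub by (auto simp: Zx_def Zl_def)
  then have "X \<subseteq> Zx \<or> X \<subseteq> Zl \<or> X \<subseteq> curve_chars \<i> \<or> X \<subseteq> curve_chars (- \<i>)"
    using irreducible_closed_Un[OF ic] cl curve_chars_closed zariski_closed_Un by metis
  moreover have "character \<rho> \<notin> Zx" "character \<rho> \<notin> Zl"
    using faithful_cx[OF \<rho>] faithful_lam[OF \<rho>] by (auto simp: Zx_def Zl_def character_def)
  ultimately have "X \<subseteq> curve_chars \<i> \<or> X \<subseteq> curve_chars (- \<i>)" using mem by blast
  then obtain j where j: "j * j = -1" "X \<subseteq> curve_chars j" using csquare_plus_1 by blast
  interpret C: curve j UNIV by unfold_locales (rule j(1), rule coeff_ring_examples)
  have "irreducible_closed (curve_chars j)" by (rule C.curve_chars_irreducible) simp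
  then have "curve_chars j = X" using irr j(2) by (auto simp: irreducible_component_def)
  then show ?thesis using that j(1) by blast
qed

theorem theorem14:
  fixes X :: "(pi1 \<Rightarrow> complex) set"
  assumes "hyperbolic_curve X"
  shows "Rk_C X lam = 8 \<and>
    Rk_Q X lam = 16 \<and>
    Rk_Z X lam = 17 \<and>
    torsion_free_module (scalars \<int> X lam) (as_module X (trace_ring X)) \<and>
    \<not> free_module (scalars \<int> X lam) (as_module X (trace_ring X))"
proof -
  obtain j where j: "j * j = -1" and X: "X = curve_chars j"
    using hyperbolic_curve_eq[OF assms] .
  interpret C: curve j UNIV by unfold_locales (rule j, rule coeff_ring_examples)
  interpret Q: curve j \<rat> by unfold_locales (rule j, rule coeff_ring_examples)
  interpret Z: curve j \<int> by unfold_locales (rule j, rule coeff_ring_examples)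
  have C: "coord_ring X = C.M_ring" by (simp add: coord_ring_def X C.subalg_gen_eq)
  have Q: "trace_ring_Q X = Q.M_ring" by (simp add: trace_ring_Q_eq X Q.subalg_gen_eq)
  have Z: "trace_ring X = Z.M_ring" by (simp add: trace_ring_eq X Z.subalg_gen_eq)
  have "Rk_C X lam = 8" unfolding Rk_C_def C unfolding X by (rule C.gen_rank_C) simp
  moreover have "Rk_Q X lam = 16" unfolding Rk_Q_def Q unfolding X by (rule Q.gen_rank_Q) simp
  moreover have rk: "gen_rank (scalars \<int> X lam) (as_module X Z.M_ring) = 17"
    unfolding X by (rule Z.gen_rank_Z) simp
  then have "Rk_Z X lam = 17" unfolding Rk_Z_def Z .
  moreover have "torsion_free_module (scalars \<int> X lam) (as_module X (trace_ring X))"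
    unfolding Z unfolding X by (rule Z.torsion_free_M)
  moreover have "\<not> free_module (scalars \<int> X lam) (as_module X (trace_ring X))"
    unfolding Z using rk unfolding X by (intro Z.not_free_M) (simp add: numeral_eq_enat)
  ultimately show ?thesis by blast
qed

end
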